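(* The restricted two-parameter quantum group $\mathfrak u_{r,s}(G_2)$ is a pointed Hopf algebra, and so are its Hopf subalgebras $\mathfrak b$ (generated by $e_i,\omega_i^{\pm1}$, $i=1,2$) and $\mathfrak b'$ (generated by $f_i,(\omega_i')^{\pm1}$, $i=1,2$).
   Context: Pointed means that every simple subcoalgebra is one-dimensional. $\mathbb{K}$ is a field of characteristic $0$; $r\in\mathbb K$ is a primitive $d$th root of unity, $s\in\mathbb K$ is a primitive $d'$th root of unity, $\ell=\mathrm{lcm}(d,d')$, $\mathbb K$ contains a primitive $\ell$th root of unity, and $\ell$ is coprime to $3$. It is assumed that $r^3\neq s^3$ and $r^4\neq s^4$. Put $r_1=r$, $s_1=s$, $r_2=r^3$, $s_2=s^3$, and $\langle\omega_1',\omega_1\rangle=rs^{-1}$, $\langle\omega_1',\omega_2\rangle=r^{-3}$, $\langle\omega_2',\omega_1\rangle=s^3$, $\langle\omega_2',\omega_2\rangle=r^3s^{-3}$. $U_{r,s}(G_2)$ is the unital associative $\mathbb{K}$-algebra generated by $e_i,f_i,\omega_i^{\pm1},\omega_i'^{\pm1}$ ($i=1,2$) with relations: (G1) all $\omega_i^{\pm1},\omega_j'^{\pm1}$ commute with each other, and $\omega_i\omega_i^{-1}=1=\omega_j'\omega_j'^{-1}$; (G2) $\omega_je_i\omega_j^{-1}=\langle\omega_i',\omega_j\rangle e_i$, $\omega_jf_i\omega_j^{-1}=\langle\omega_i',\omega_j\rangle^{-1}f_i$; (G3) $\omega_j'e_i\omega_j'^{-1}=\langle\omega_j',\omega_i\rangle^{-1}e_i$,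 $\omega_j'f_i\omega_j'^{-1}=\langle\omega_j',\omega_i\rangle f_i$; (G4) $e_if_j-f_je_i=\delta_{ij}\frac{\omega_i-\omega_i'}{r_i-s_i}$; (G5) $e_2^2e_1-(r^{-3}+s^{-3})e_2e_1e_2+(rs)^{-3}e_1e_2^2=0$ and $e_1^4e_2-(r+s)(r^2+s^2)e_1^3e_2e_1+rs(r^2+s^2)(r^2+rs+s^2)e_1^2e_2e_1^2-(rs)^3(r+s)(r^2+s^2)e_1e_2e_1^3+(rs)^6e_2e_1^4=0$; (G6) $f_1f_2^2-(r^{-3}+s^{-3})f_2f_1f_2+(rs)^{-3}f_2^2f_1=0$ and $f_2f_1^4-(r+s)(r^2+s^2)f_1f_2f_1^3+rs(r^2+s^2)(r^2+rs+s^2)f_1^2f_2f_1^2-(rs)^3(r+s)(r^2+s^2)f_1^3f_2f_1+(rs)^6f_1^4f_2=0$. It is a Hopf algebra in which $\omega_i^{\pm1},\omega_i'^{\pm1}$ are group-like, $\Delta(e_i)=e_i\otimes1+\omega_i\otimes e_i$, $\Delta(f_i)=1\otimes f_i+f_i\otimes\omega_i'$, $\varepsilon(e_i)=\varepsilon(f_i)=0$, $S(e_i)=-\omega_i^{-1}e_i$, $S(f_i)=-f_i\omega_i'^{-1}$. Quantum root vectors: $E_1=e_1$, $E_2=e_2$, $E_{12}=e_1e_2-s^3e_2e_1$, $E_{112}=e_1E_{12}-rs^2E_{12}e_1$, $E_{1112}=e_1E_{112}-r^2sE_{112}e_1$, $E_{11212}=E_{112}E_{12}-r^2sE_{12}E_{112}$;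 $F_1=f_1$, $F_2=f_2$, $F_{12}=f_2f_1-r^3f_1f_2$, $F_{112}=F_{12}f_1-r^2sf_1F_{12}$, $F_{1112}=F_{112}f_1-rs^2f_1F_{112}$, $F_{11212}=F_{12}F_{112}-rs^2F_{112}F_{12}$. $\mathfrak u_{r,s}(G_2)=U_{r,s}(G_2)/\mathcal I$, where $\mathcal I$ is the two-sided ideal generated by the $\ell$th powers of the twelve quantum root vectors $E_1,E_{1112},E_{112},E_{11212},E_{12},E_2,F_1,F_{1112},F_{112},F_{11212},F_{12},F_2$ and by $\omega_k^\ell-1$, $(\omega_k')^\ell-1$ ($k=1,2$), with the Hopf algebra structure induced from $U_{r,s}(G_2)$ (and the images of the generators denoted by the same symbols).
   Formalization: It is assumed explicitly that the ideal I is a Hopf ideal of U_{r,s}(G_2), so that the induced Hopf structure exists; the conditions on r, s, ℓ do not imply this (e.g. r=θ, s=θ^{-1}, θ a primitive 10th root of unity). *)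

theory Defs
  imports "HOL-Library.Poly_Mapping" "HOL-Algebra.QuotRing" "HOL-Algebra.Module"
begin

section \<open>Algebras, tensor products and Hopf algebras over a field\<close>

text \<open>The ground field is a type \<open>'k\<close> of class \<open>field\<close>; \<open>base\<close> is that field as a
  one-dimensional algebra over itself. Vector spaces, algebras and Hopf algebras are
  HOL-Algebra structures over \<open>base\<close>.\<close>

definition base :: "('k::field, 'k) module" where
  "base = \<lparr>carrier = UNIV, mult = (*), one = 1, zero = 0, add = (+), smult = (*)\<rparr>"

text \<open>The locale \<open>algebra\<close> of HOL-Algebra is restricted to commutative algebras.\<close>

locale k_algebra = module base A + ring A
  for A :: "('k::field, 'a, 'z) module_scheme" (structure) +
  assumes smult_mult_left:
      "\<lbrakk>x \<in> carrier A; y \<in> carrier A\<rbrakk> \<Longrightarrow> (c \<odot> x) \<otimes> y = c \<odot> (x \<otimes> y)"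
    and smult_mult_right:
      "\<lbrakk>x \<in> carrier A; y \<in> carrier A\<rbrakk> \<Longrightarrow> x \<otimes> (c \<odot> y) = c \<odot> (x \<otimes> y)"

definition k_linear ::
  "('k::field, 'a, 'y) module_scheme \<Rightarrow> ('k, 'b, 'z) module_scheme \<Rightarrow> ('a \<Rightarrow> 'b) \<Rightarrow> bool" where
  "k_linear A B f \<longleftrightarrow> f \<in> carrier A \<rightarrow> carrier B \<and>
     (\<forall>x\<in>carrier A. \<forall>y\<in>carrier A. f (x \<oplus>\<^bsub>A\<^esub> y) = f x \<oplus>\<^bsub>B\<^esub> f y) \<and>
     (\<forall>c. \<forall>x\<in>carrier A. f (c \<odot>\<^bsub>A\<^esub> x) = c \<odot>\<^bsub>B\<^esub> f x)"

definition subalg :: "('k::field, 'a, 'z) module_scheme \<Rightarrow> 'a set \<Rightarrow> bool" where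
  "subalg A B \<longleftrightarrow> submodule B base A \<and> \<one>\<^bsub>A\<^esub> \<in> B \<and> (\<forall>x\<in>B. \<forall>y\<in>B. x \<otimes>\<^bsub>A\<^esub> y \<in> B)"

definition subalg_generated :: "('k::field, 'a, 'z) module_scheme \<Rightarrow> 'a set \<Rightarrow> 'a set" where
  "subalg_generated A X = \<Inter>{B. subalg A B \<and> X \<subseteq> B}"

definition opposite :: "('k::field, 'a) module \<Rightarrow> ('k, 'a) module" where
  "opposite A = A\<lparr>mult := (\<lambda>x y. y \<otimes>\<^bsub>A\<^esub> x)\<rparr>"

text \<open>The quotient by a two-sided ideal. The same record is used for the quotient of a vector
  space by a subspace; then only its module part is meaningful.\<close>

definition quot_alg :: "('k::field, 'a, 'z) module_scheme \<Rightarrow> 'a set \<Rightarrow> ('k, 'a set) module" where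
  "quot_alg A I = ring.extend (A Quot I)
     (module.fields (\<lambda>c X. \<Union>x\<in>X. I +>\<^bsub>A\<^esub> (c \<odot>\<^bsub>A\<^esub> x)))"


subsection \<open>Tensor products\<close>

definition scal :: "'k::field \<Rightarrow> ('a \<Rightarrow>\<^sub>0 'k) \<Rightarrow> ('a \<Rightarrow>\<^sub>0 'k)" (infixr \<open>\<cdot>\<close> 75) where
  "c \<cdot> p = Poly_Mapping.map ((*) c) p"

text \<open>\<open>A \<otimes> B\<close> is the vector space with basis \<open>carrier A \<times> carrier B\<close>, with the product
  \<open>(a, b) (a', b') = (a a', b b')\<close>, modulo the bilinearity relations.\<close>

definition tensor_free ::
  "('k::field, 'a, 'y) module_scheme \<Rightarrow> ('k, 'b, 'z) module_scheme \<Rightarrow> ('k, ('a \<times> 'b) \<Rightarrow>\<^sub>0 'k) module"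
where
  "tensor_free A B =
     \<lparr>carrier = {p. Poly_Mapping.keys p \<subseteq> carrier A \<times> carrier B},
      mult = (\<lambda>p q. \<Sum>u\<in>Poly_Mapping.keys p. \<Sum>v\<in>Poly_Mapping.keys q.
                Poly_Mapping.single (u \<otimes>\<^bsub>A \<times>\<times> B\<^esub> v)
                  (Poly_Mapping.lookup p u * Poly_Mapping.lookup q v)),
      one = Poly_Mapping.single (\<one>\<^bsub>A\<^esub>, \<one>\<^bsub>B\<^esub>) 1,
      zero = 0, add = (+), smult = scal\<rparr>"

inductive_set tensor_rel ::
  "('k::field, 'a, 'y) module_scheme \<Rightarrow> ('k, 'b, 'z) module_scheme \<Rightarrow> (('a \<times> 'b) \<Rightarrow>\<^sub>0 'k) set"
  for A :: "('k::field, 'a, 'y) module_scheme" and B :: "('k, 'b, 'z) module_scheme"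
where
  add_left: "\<lbrakk>x \<in> carrier A; x' \<in> carrier A; y \<in> carrier B\<rbrakk> \<Longrightarrow>
    Poly_Mapping.single (x \<oplus>\<^bsub>A\<^esub> x', y) 1 - Poly_Mapping.single (x, y) 1
      - Poly_Mapping.single (x', y) 1 \<in> tensor_rel A B"
| add_right: "\<lbrakk>x \<in> carrier A; y \<in> carrier B; y' \<in> carrier B\<rbrakk> \<Longrightarrow>
    Poly_Mapping.single (x, y \<oplus>\<^bsub>B\<^esub> y') 1 - Poly_Mapping.single (x, y) 1
      - Poly_Mapping.single (x, y') 1 \<in> tensor_rel A B"
| smult_left: "\<lbrakk>x \<in> carrier A; y \<in> carrier B\<rbrakk> \<Longrightarrow>
    Poly_Mapping.single (c \<odot>\<^bsub>A\<^esub> x, y) 1 - Poly_Mapping.single (x, y) c \<in> tensor_rel A B"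
| smult_right: "\<lbrakk>x \<in> carrier A; y \<in> carrier B\<rbrakk> \<Longrightarrow>
    Poly_Mapping.single (x, c \<odot>\<^bsub>B\<^esub> y) 1 - Poly_Mapping.single (x, y) c \<in> tensor_rel A B"
| zero: "0 \<in> tensor_rel A B"
| add: "\<lbrakk>p \<in> tensor_rel A B; q \<in> tensor_rel A B\<rbrakk> \<Longrightarrow> p + q \<in> tensor_rel A B"
| scal: "p \<in> tensor_rel A B \<Longrightarrow> c \<cdot> p \<in> tensor_rel A B"

definition tensor ::
  "('k::field, 'a, 'y) module_scheme \<Rightarrow> ('k, 'b, 'z) module_scheme \<Rightarrow>
     ('k, (('a \<times> 'b) \<Rightarrow>\<^sub>0 'k) set) module" where
  "tensor A B = quot_alg (tensor_free A B) (tensor_rel A B)"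

definition tensor_class ::
  "('k::field, 'a, 'y) module_scheme \<Rightarrow> ('k, 'b, 'z) module_scheme \<Rightarrow>
     (('a \<times> 'b) \<Rightarrow>\<^sub>0 'k) \<Rightarrow> (('a \<times> 'b) \<Rightarrow>\<^sub>0 'k) set" where
  "tensor_class A B t = tensor_rel A B +>\<^bsub>tensor_free A B\<^esub> t"

definition pure_tensor ::
  "('k::field, 'a, 'y) module_scheme \<Rightarrow> ('k, 'b, 'z) module_scheme \<Rightarrow>
     'a \<Rightarrow> 'b \<Rightarrow> (('a \<times> 'b) \<Rightarrow>\<^sub>0 'k) set" where
  "pure_tensor A B x y = tensor_class A B (Poly_Mapping.single (x, y) 1)"

text \<open>The image of \<open>X \<otimes> Y\<close> in \<open>A \<otimes> B\<close>, for subspaces \<open>X\<close> of \<open>A\<close> and \<open>Y\<close> of \<open>B\<close>.\<close>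

definition sub_tensor ::
  "('k::field, 'a, 'y) module_scheme \<Rightarrow> ('k, 'b, 'z) module_scheme \<Rightarrow>
     'a set \<Rightarrow> 'b set \<Rightarrow> (('a \<times> 'b) \<Rightarrow>\<^sub>0 'k) set set" where
  "sub_tensor A B X Y = tensor_class A B ` {t. Poly_Mapping.keys t \<subseteq> X \<times> Y}"

text \<open>The linear map on a tensor product induced by a bilinear map \<open>\<beta>\<close> with values in \<open>M\<close>; when
  \<open>\<beta>\<close> is bilinear, the choice of the representative \<open>t\<close> is irrelevant.\<close>

definition tensor_lift ::
  "('k::field, 'c, 'z) module_scheme \<Rightarrow> ('a \<times> 'b \<Rightarrow> 'c) \<Rightarrow> (('a \<times> 'b) \<Rightarrow>\<^sub>0 'k) set \<Rightarrow> 'c" where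
  "tensor_lift M \<beta> T = (let t = (SOME t. t \<in> T) in
     \<Oplus>\<^bsub>M\<^esub>u\<in>Poly_Mapping.keys t. Poly_Mapping.lookup t u \<odot>\<^bsub>M\<^esub> \<beta> u)"

definition tensor_map ::
  "('k::field, 'c, 'y) module_scheme \<Rightarrow> ('k, 'd, 'z) module_scheme \<Rightarrow> ('a \<Rightarrow> 'c) \<Rightarrow> ('b \<Rightarrow> 'd) \<Rightarrow>
     (('a \<times> 'b) \<Rightarrow>\<^sub>0 'k) set \<Rightarrow> (('c \<times> 'd) \<Rightarrow>\<^sub>0 'k) set" where
  "tensor_map C D f g = tensor_lift (tensor C D) (\<lambda>(x, y). pure_tensor C D (f x) (g y))"

text \<open>The associativity isomorphism \<open>(A \<otimes> B) \<otimes> C \<rightarrow> A \<otimes> (B \<otimes> C)\<close>.\<close>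

definition tensor_assoc where
  "tensor_assoc A B C =
     tensor_lift (tensor A (tensor B C))
       (\<lambda>(u, z). tensor_lift (tensor A (tensor B C))
          (\<lambda>(x, y). pure_tensor A (tensor B C) x (pure_tensor B C y z)) u)"


subsection \<open>Coalgebras and Hopf algebras\<close>

record (overloaded) ('k::zero, 'a) hopf = "('k, 'a) module" +
  comult :: "'a \<Rightarrow> (('a \<times> 'a) \<Rightarrow>\<^sub>0 'k) set"
  counit :: "'a \<Rightarrow> 'k"
  antipode :: "'a \<Rightarrow> 'a"

locale coalgebra = module base C
  for C :: "('k::field, 'a, 'z) hopf_scheme" (structure) +
  assumes comult_linear: "k_linear C (tensor C C) (comult C)"
    and counit_linear: "k_linear C base (counit C)"
    and coassoc: "x \<in> carrier C \<Longrightarrow>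
      tensor_assoc C C C (tensor_map (tensor C C) C (comult C) id (comult C x)) =
      tensor_map C (tensor C C) id (comult C) (comult C x)"
    and counit_left: "x \<in> carrier C \<Longrightarrow>
      tensor_lift C (\<lambda>(y, z). counit C y \<odot> z) (comult C x) = x"
    and counit_right: "x \<in> carrier C \<Longrightarrow>
      tensor_lift C (\<lambda>(y, z). counit C z \<odot> y) (comult C x) = x"

locale hopf_algebra = k_algebra H + coalgebra H
  for H :: "('k::field, 'a, 'z) hopf_scheme" (structure) +
  assumes comult_hom: "comult H \<in> ring_hom H (tensor H H)"
    and counit_hom: "counit H \<in> ring_hom H base"
    and antipode_linear: "k_linear H H (antipode H)"
    and antipode_left: "x \<in> carrier H \<Longrightarrow>
      tensor_lift H (\<lambda>(y, z). antipode H y \<otimes> z) (comult H x) = counit H x \<odot> \<one>"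
    and antipode_right: "x \<in> carrier H \<Longrightarrow>
      tensor_lift H (\<lambda>(y, z). y \<otimes> antipode H z) (comult H x) = counit H x \<odot> \<one>"

definition subcoalgebra :: "('k::field, 'a, 'z) hopf_scheme \<Rightarrow> 'a set \<Rightarrow> bool" where
  "subcoalgebra C D \<longleftrightarrow> submodule D base C \<and> comult C ` D \<subseteq> sub_tensor C C D D"

definition simple_subcoalgebra :: "('k::field, 'a, 'z) hopf_scheme \<Rightarrow> 'a set \<Rightarrow> bool" where
  "simple_subcoalgebra C D \<longleftrightarrow> subcoalgebra C D \<and> D \<noteq> {\<zero>\<^bsub>C\<^esub>} \<and>
     (\<forall>D'. subcoalgebra C D' \<and> D' \<subseteq> D \<longrightarrow> D' = {\<zero>\<^bsub>C\<^esub>} \<or> D' = D)"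

definition one_dimensional :: "('k::field, 'a, 'z) module_scheme \<Rightarrow> 'a set \<Rightarrow> bool" where
  "one_dimensional V D \<longleftrightarrow> (\<exists>x\<in>carrier V. x \<noteq> \<zero>\<^bsub>V\<^esub> \<and> D = range (\<lambda>c. c \<odot>\<^bsub>V\<^esub> x))"

definition pointed :: "('k::field, 'a, 'z) hopf_scheme \<Rightarrow> bool" where
  "pointed C \<longleftrightarrow> (\<forall>D. simple_subcoalgebra C D \<longrightarrow> one_dimensional C D)"

definition hopf_subalgebra :: "('k::field, 'a, 'z) hopf_scheme \<Rightarrow> 'a set \<Rightarrow> bool" where
  "hopf_subalgebra H B \<longleftrightarrow> subalg H B \<and> comult H ` B \<subseteq> sub_tensor H H B B \<and> antipode H ` B \<subseteq> B"

text \<open>A Hopf subalgebra \<open>B\<close> as a Hopf algebra in its own right. Its comultiplication has to take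
  values in \<open>B \<otimes> B\<close>, not in the image of \<open>B \<otimes> B\<close> in \<open>H \<otimes> H\<close>; over a field the map
  \<open>B \<otimes> B \<rightarrow> H \<otimes> H\<close> is injective, so the choice of \<open>t\<close> is irrelevant.\<close>

definition hopf_restrict :: "('k::field, 'a) hopf \<Rightarrow> 'a set \<Rightarrow> ('k, 'a) hopf" where
  "hopf_restrict H B = H\<lparr>carrier := B,
     comult := (\<lambda>x. tensor_class (H\<lparr>carrier := B\<rparr>) (H\<lparr>carrier := B\<rparr>)
       (SOME t. Poly_Mapping.keys t \<subseteq> B \<times> B \<and> tensor_class H H t = comult H x))\<rparr>"

definition hopf_ideal :: "('k::field, 'a, 'z) hopf_scheme \<Rightarrow> 'a set \<Rightarrow> bool" where
  "hopf_ideal H I \<longleftrightarrow> ideal I H \<and>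
     comult H ` I \<subseteq> sub_tensor H H I (carrier H) <+>\<^bsub>tensor H H\<^esub> sub_tensor H H (carrier H) I \<and>
     (\<forall>x\<in>I. counit H x = 0) \<and> antipode H ` I \<subseteq> I"

text \<open>\<open>H / I\<close> with the structure induced from \<open>H\<close>; the choice of representatives is irrelevant
  when \<open>I\<close> is a Hopf ideal.\<close>

definition quot_hopf :: "('k::field, 'a) hopf \<Rightarrow> 'a set \<Rightarrow> ('k, 'a set) hopf" where
  "quot_hopf H I = (let Q = quot_alg H I; \<pi> = (\<lambda>x. I +>\<^bsub>H\<^esub> x) in
     module.extend Q (hopf.fields
       (\<lambda>X. tensor_map Q Q \<pi> \<pi> (comult H (SOME x. x \<in> X)))
       (\<lambda>X. counit H (SOME x. x \<in> X))
       (\<lambda>X. \<pi> (antipode H (SOME x. x \<in> X)))))"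


section \<open>The free algebra on the generators\<close>

datatype idx = I1 | I2

datatype gen = gE idx | gF idx | gW idx | gWinv idx | gW' idx | gW'inv idx

text \<open>Words in the generators, as an additively written monoid: with this instance the library
  multiplication on \<open>word \<Rightarrow>\<^sub>0 'k\<close> is that of the free associative algebra.\<close>

datatype word = Word (letters: "gen list")

instantiation word :: monoid_add
begin

definition zero_word :: word where "0 = Word []"
definition plus_word :: "word \<Rightarrow> word \<Rightarrow> word" where
  "v + w = Word (letters v @ letters w)"

instance
  by standard (auto simp: zero_word_def plus_word_def)

end

type_synonym 'k free = "word \<Rightarrow>\<^sub>0 'k"

definition free_alg :: "('k::field, 'k free) module" where
  "free_alg = \<lparr>carrier = UNIV, mult = (*), one = 1, zero = 0, add = (+), smult = scal\<rparr>"

definition G :: "gen \<Rightarrow> 'k::field free" where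
  "G g = Poly_Mapping.single (Word [g]) 1"

text \<open>The algebra homomorphism from the free algebra to \<open>A\<close> sending each generator \<open>g\<close>
  to \<open>\<phi> g\<close>.\<close>

definition free_lift ::
  "('k::field, 'a, 'z) module_scheme \<Rightarrow> (gen \<Rightarrow> 'a) \<Rightarrow> 'k free \<Rightarrow> 'a" where
  "free_lift A \<phi> p = (\<Oplus>\<^bsub>A\<^esub>w\<in>Poly_Mapping.keys p.
     Poly_Mapping.lookup p w \<odot>\<^bsub>A\<^esub> foldr (\<lambda>g a. \<phi> g \<otimes>\<^bsub>A\<^esub> a) (letters w) \<one>\<^bsub>A\<^esub>)"


section \<open>The two-parameter quantum group of type \<open>G\<^sub>2\<close>\<close>

text \<open>\<open>pairing r s i j\<close> is \<open>\<langle>\<omega>\<^sub>i', \<omega>\<^sub>j\<rangle>\<close>.\<close>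

fun pairing :: "'k::field \<Rightarrow> 'k \<Rightarrow> idx \<Rightarrow> idx \<Rightarrow> 'k" where
  "pairing r s I1 I1 = r * inverse s"
| "pairing r s I1 I2 = inverse (r ^ 3)"
| "pairing r s I2 I1 = s ^ 3"
| "pairing r s I2 I2 = r ^ 3 * inverse (s ^ 3)"

fun param :: "'k::field \<Rightarrow> idx \<Rightarrow> 'k" where
  "param r I1 = r"
| "param r I2 = r ^ 3"

definition toral :: "gen set" where
  "toral = range gW \<union> range gWinv \<union> range gW' \<union> range gW'inv"

definition rels_G1 :: "'k::field free set" where
  "rels_G1 = {G g * G h - G h * G g |g h. g \<in> toral \<and> h \<in> toral}
     \<union> {G (gW i) * G (gWinv i) - 1 |i. True} \<union> {G (gW' i) * G (gW'inv i) - 1 |i. True}"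

definition rels_G2 :: "'k::field \<Rightarrow> 'k \<Rightarrow> 'k free set" where
  "rels_G2 r s =
     {G (gW j) * G (gE i) * G (gWinv j) - pairing r s i j \<cdot> G (gE i) |i j. True}
     \<union> {G (gW j) * G (gF i) * G (gWinv j) - inverse (pairing r s i j) \<cdot> G (gF i) |i j. True}"

definition rels_G3 :: "'k::field \<Rightarrow> 'k \<Rightarrow> 'k free set" where
  "rels_G3 r s =
     {G (gW' j) * G (gE i) * G (gW'inv j) - inverse (pairing r s j i) \<cdot> G (gE i) |i j. True}
     \<union> {G (gW' j) * G (gF i) * G (gW'inv j) - pairing r s j i \<cdot> G (gF i) |i j. True}"

definition rels_G4 :: "'k::field \<Rightarrow> 'k \<Rightarrow> 'k free set" where
  "rels_G4 r s =
     {G (gE i) * G (gF j) - G (gF j) * G (gE i)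
        - (if i = j then inverse (param r i - param s i) \<cdot> (G (gW i) - G (gW' i)) else 0) |i j. True}"

definition rels_G5 :: "'k::field \<Rightarrow> 'k \<Rightarrow> 'k free set" where
  "rels_G5 r s = (let e1 = G (gE I1); e2 = G (gE I2) in
     {e2^2 * e1 - (inverse (r^3) + inverse (s^3)) \<cdot> (e2 * e1 * e2) + inverse ((r*s)^3) \<cdot> (e1 * e2^2),
      e1^4 * e2
      - ((r + s) * (r^2 + s^2)) \<cdot> (e1^3 * e2 * e1)
      + (r * s * (r^2 + s^2) * (r^2 + r*s + s^2)) \<cdot> (e1^2 * e2 * e1^2)
      - ((r*s)^3 * (r + s) * (r^2 + s^2)) \<cdot> (e1 * e2 * e1^3)
      + ((r*s)^6) \<cdot> (e2 * e1^4)})"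

definition rels_G6 :: "'k::field \<Rightarrow> 'k \<Rightarrow> 'k free set" where
  "rels_G6 r s = (let f1 = G (gF I1); f2 = G (gF I2) in
     {f1 * f2^2 - (inverse (r^3) + inverse (s^3)) \<cdot> (f2 * f1 * f2) + inverse ((r*s)^3) \<cdot> (f2^2 * f1),
      f2 * f1^4
      - ((r + s) * (r^2 + s^2)) \<cdot> (f1 * f2 * f1^3)
      + (r * s * (r^2 + s^2) * (r^2 + r*s + s^2)) \<cdot> (f1^2 * f2 * f1^2)
      - ((r*s)^3 * (r + s) * (r^2 + s^2)) \<cdot> (f1^3 * f2 * f1)
      + ((r*s)^6) \<cdot> (f1^4 * f2)})"

definition U_ideal :: "'k::field \<Rightarrow> 'k \<Rightarrow> 'k free set" where
  "U_ideal r s = Idl\<^bsub>free_alg\<^esub>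
     (rels_G1 \<union> rels_G2 r s \<union> rels_G3 r s \<union> rels_G4 r s \<union> rels_G5 r s \<union> rels_G6 r s)"

definition U_alg :: "'k::field \<Rightarrow> 'k \<Rightarrow> ('k, 'k free set) module" where
  "U_alg r s = quot_alg free_alg (U_ideal r s)"

definition U_proj :: "'k::field \<Rightarrow> 'k \<Rightarrow> 'k free \<Rightarrow> 'k free set" where
  "U_proj r s p = U_ideal r s +>\<^bsub>free_alg\<^esub> p"

fun U_comult_gen :: "'k::field \<Rightarrow> 'k \<Rightarrow> gen \<Rightarrow> (('k free set \<times> 'k free set) \<Rightarrow>\<^sub>0 'k) set" where
  "U_comult_gen r s (gE i) =
     (let U = U_alg r s; \<gamma> = (\<lambda>g. U_proj r s (G g)) in
      pure_tensor U U (\<gamma> (gE i)) \<one>\<^bsub>U\<^esub> \<oplus>\<^bsub>tensor U U\<^esub> pure_tensor U U (\<gamma> (gW i)) (\<gamma> (gE i)))"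
| "U_comult_gen r s (gF i) =
     (let U = U_alg r s; \<gamma> = (\<lambda>g. U_proj r s (G g)) in
      pure_tensor U U \<one>\<^bsub>U\<^esub> (\<gamma> (gF i)) \<oplus>\<^bsub>tensor U U\<^esub> pure_tensor U U (\<gamma> (gF i)) (\<gamma> (gW' i)))"
| "U_comult_gen r s g =
     (let U = U_alg r s; \<gamma> = (\<lambda>g. U_proj r s (G g)) in pure_tensor U U (\<gamma> g) (\<gamma> g))"

fun U_counit_gen :: "gen \<Rightarrow> 'k::field" where
  "U_counit_gen (gE i) = 0"
| "U_counit_gen (gF i) = 0"
| "U_counit_gen g = 1"

fun U_antipode_gen :: "'k::field \<Rightarrow> 'k \<Rightarrow> gen \<Rightarrow> 'k free set" where
  "U_antipode_gen r s (gE i) = U_proj r s (- (G (gWinv i) * G (gE i)))"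
| "U_antipode_gen r s (gF i) = U_proj r s (- (G (gF i) * G (gW'inv i)))"
| "U_antipode_gen r s (gW i) = U_proj r s (G (gWinv i))"
| "U_antipode_gen r s (gWinv i) = U_proj r s (G (gW i))"
| "U_antipode_gen r s (gW' i) = U_proj r s (G (gW'inv i))"
| "U_antipode_gen r s (gW'inv i) = U_proj r s (G (gW' i))"

text \<open>The comultiplication and the counit are the algebra homomorphisms, and the antipode is the
  algebra antihomomorphism, with the above values on the generators.\<close>

definition U_hopf :: "'k::field \<Rightarrow> 'k \<Rightarrow> ('k, 'k free set) hopf" where
  "U_hopf r s = (let U = U_alg r s in module.extend U (hopf.fields
     (\<lambda>X. free_lift (tensor U U) (U_comult_gen r s) (SOME p. p \<in> X))
     (\<lambda>X. free_lift base U_counit_gen (SOME p. p \<in> X))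
     (\<lambda>X. free_lift (opposite U) (U_antipode_gen r s) (SOME p. p \<in> X))))"


section \<open>The restricted quantum group\<close>

text \<open>The root vectors are formed in the free algebra; their images in \<open>U\<close> are the quantum root
  vectors.\<close>

definition root_vectors_E :: "'k::field \<Rightarrow> 'k \<Rightarrow> 'k free set" where
  "root_vectors_E r s =
    (let E1 = G (gE I1);
         E2 = G (gE I2);
         E12 = E1 * E2 - s^3 \<cdot> (E2 * E1);
         E112 = E1 * E12 - (r * s^2) \<cdot> (E12 * E1);
         E1112 = E1 * E112 - (r^2 * s) \<cdot> (E112 * E1);
         E11212 = E112 * E12 - (r^2 * s) \<cdot> (E12 * E112)
     in {E1, E1112, E112, E11212, E12, E2})"

definition root_vectors_F :: "'k::field \<Rightarrow> 'k \<Rightarrow> 'k free set" where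
  "root_vectors_F r s =
    (let F1 = G (gF I1);
         F2 = G (gF I2);
         F12 = F2 * F1 - r^3 \<cdot> (F1 * F2);
         F112 = F12 * F1 - (r^2 * s) \<cdot> (F1 * F12);
         F1112 = F112 * F1 - (r * s^2) \<cdot> (F1 * F112);
         F11212 = F12 * F112 - (r * s^2) \<cdot> (F112 * F12)
     in {F1, F1112, F112, F11212, F12, F2})"

definition restricted_ideal :: "'k::field \<Rightarrow> 'k \<Rightarrow> nat \<Rightarrow> 'k free set set" where
  "restricted_ideal r s l = Idl\<^bsub>U_alg r s\<^esub> (U_proj r s `
     ((\<lambda>x. x ^ l) ` (root_vectors_E r s \<union> root_vectors_F r s)
      \<union> {G (gW k) ^ l - 1 |k. True} \<union> {G (gW' k) ^ l - 1 |k. True}))"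

definition u_hopf :: "'k::field \<Rightarrow> 'k \<Rightarrow> nat \<Rightarrow> ('k, 'k free set set) hopf" where
  "u_hopf r s l = quot_hopf (U_hopf r s) (restricted_ideal r s l)"

definition u_gen :: "'k::field \<Rightarrow> 'k \<Rightarrow> nat \<Rightarrow> gen \<Rightarrow> 'k free set set" where
  "u_gen r s l g = restricted_ideal r s l +>\<^bsub>U_alg r s\<^esub> U_proj r s (G g)"

definition u_b :: "'k::field \<Rightarrow> 'k \<Rightarrow> nat \<Rightarrow> 'k free set set set" where
  "u_b r s l = subalg_generated (u_hopf r s l)
     (u_gen r s l ` (range gE \<union> range gW \<union> range gWinv))"

definition u_b' :: "'k::field \<Rightarrow> 'k \<Rightarrow> nat \<Rightarrow> 'k free set set set" where
  "u_b' r s l = subalg_generated (u_hopf r s l)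
     (u_gen r s l ` (range gF \<union> range gW' \<union> range gW'inv))"

definition primitive_root_of_unity :: "nat \<Rightarrow> 'k::field \<Rightarrow> bool" where
  "primitive_root_of_unity n x \<longleftrightarrow> 0 < n \<and> x ^ n = 1 \<and> (\<forall>m. 0 < m \<and> m < n \<longrightarrow> x ^ m \<noteq> 1)"

end

theory Submission
  imports "HOL.Vector_Spaces" Defs
begin

text \<open>
  Every algebra in question is generated by grouplike elements and by skew primitive elements \<open>x\<close>,
  \<open>\<Delta> x = x \<otimes> h + g \<otimes> x\<close> with \<open>g\<close>, \<open>h\<close> grouplike, and this alone gives all the claims. Each
  Hopf algebra axiom holds on a subalgebra, and this subalgebra contains the generators.
  For pointedness, let \<open>D \<noteq> 0\<close> be a subcoalgebra and \<open>S\<close> a subspace with \<open>D \<inter> S = 0\<close>. Some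
  functional \<open>f\<close> vanishes on \<open>S\<close> and is the counit on \<open>D\<close>, so \<open>(id \<otimes> f) \<Delta>\<close> is the identity on \<open>D\<close>.
  With \<open>S\<close> the span of the products of grouplike generators, \<open>(id \<otimes> f) \<Delta>\<close> lowers the number of
  skew primitive factors, so iterating it gives \<open>D = 0\<close>, a contradiction; hence \<open>D\<close> meets this span. With \<open>S\<close> the span of all but one
  of a minimal set of grouplike elements whose span meets \<open>D\<close>, it follows that \<open>D\<close> contains a
  grouplike element, and a simple \<open>D\<close> is spanned by it.

  That comultiplication, counit and antipode respect the relations of \<open>U\<^sub>r\<^sub>,\<^sub>s(G\<^sub>2)\<close> is only hard for
  the quantum Serre relations. They are iterated \<open>q\<close>-commutators of \<open>e\<^sub>1\<close> and \<open>e\<^sub>2\<close> whose order is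
  irrelevant, and in a suitable order all mixed terms vanish. The relations for \<open>f\<^sub>1\<close>, \<open>f\<^sub>2\<close> are the
  same ones in the opposite algebra.
\<close>

text \<open>The structure maps of the quotients are evaluated at chosen representatives, so each
  makes sense only once some homomorphism is known to kill the ideal in question. For U this becomes
  one question: which values in an algebra \<open>A\<close> satisfy the relations
  (\<open>G2_rep\<close>)? The values of coproduct, counit and antipode do so in the tensor square,
  the ground field and the opposite algebra, so no basis of U enters. The Serre relations fit
  because their scalars form geometric progressions in the pairing; for the quartic one they are p
  q^k with p = s^3 and q = r/s. Hence an element b with b a = q a b and b c = p c b moves past every
  iterated commutator of a and c with exactly the scalar that the next commutator subtracts.
  Pointedness: the coproduct of a product with n skew factors is a sum of terms u \<otimes> v whose
  numbers of skew factors add up to n. A functional vanishing on products of grouplike generators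
  kills the terms without skew factor in v, so u has fewer than n. The Hopf subalgebras fall under
  the same argument once their own coproduct, a choice of preimage in B \<otimes> B, is shown to be
  multiplicative.\<close>

abbreviation "keys \<equiv> Poly_Mapping.keys"
abbreviation "lookup \<equiv> Poly_Mapping.lookup"
abbreviation "single \<equiv> Poly_Mapping.single"

section \<open>The ground field as an algebra over itself, and arithmetic in algebras over
  it\<close>

lemma base_simps [simp]:
  "carrier base = UNIV" "a \<otimes>\<^bsub>base\<^esub> b = a * b" "\<one>\<^bsub>base\<^esub> = 1" "\<zero>\<^bsub>base\<^esub> = 0"
  "a \<oplus>\<^bsub>base\<^esub> b = a + b" "a \<odot>\<^bsub>base\<^esub> b = a * b"
  by (auto simp: base_def)

lemma cring_base: "cring (base :: ('k::field, 'k) module)"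
proof (rule cringI)
  show "abelian_group (base :: ('k, 'k) module)"
    by (rule abelian_groupI) (auto simp: algebra_simps intro: exI[of _ "- x" for x])
  show "comm_monoid (base :: ('k, 'k) module)"
    by (rule comm_monoidI) (auto simp: algebra_simps)
qed (auto simp: algebra_simps)

lemma base_a_inv [simp]: "\<ominus>\<^bsub>base\<^esub> (a :: 'k::field) = - a"
proof -
  interpret cring "base :: ('k, 'k) module" by (rule cring_base)
  show ?thesis by (rule minus_equality) auto
qed

lemma k_algebraI:
  fixes A :: "('k::field, 'a, 'z) module_scheme" (structure)
  assumes "abelian_group A"
    and "\<And>x y. \<lbrakk>x \<in> carrier A; y \<in> carrier A\<rbrakk> \<Longrightarrow> x \<otimes> y \<in> carrier A" and "\<one> \<in> carrier A"
    and "\<And>x y z. \<lbrakk>x \<in> carrier A; y \<in> carrier A; z \<in> carrier A\<rbrakk> \<Longrightarrow> x \<otimes> y \<otimes> z = x \<otimes> (y \<otimes> z)"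
    and "\<And>x. x \<in> carrier A \<Longrightarrow> \<one> \<otimes> x = x" and "\<And>x. x \<in> carrier A \<Longrightarrow> x \<otimes> \<one> = x"
    and "\<And>x y z. \<lbrakk>x \<in> carrier A; y \<in> carrier A; z \<in> carrier A\<rbrakk> \<Longrightarrow> (x \<oplus> y) \<otimes> z = x \<otimes> z \<oplus> y \<otimes> z"
    and "\<And>x y z. \<lbrakk>x \<in> carrier A; y \<in> carrier A; z \<in> carrier A\<rbrakk> \<Longrightarrow> z \<otimes> (x \<oplus> y) = z \<otimes> x \<oplus> z \<otimes> y"
    and "\<And>c x. x \<in> carrier A \<Longrightarrow> c \<odot> x \<in> carrier A"
    and "\<And>a b x. x \<in> carrier A \<Longrightarrow> (a + b) \<odot> x = a \<odot> x \<oplus> b \<odot> x"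
    and "\<And>a x y. \<lbrakk>x \<in> carrier A; y \<in> carrier A\<rbrakk> \<Longrightarrow> a \<odot> (x \<oplus> y) = a \<odot> x \<oplus> a \<odot> y"
    and "\<And>a b x. x \<in> carrier A \<Longrightarrow> (a * b) \<odot> x = a \<odot> (b \<odot> x)"
    and "\<And>x. x \<in> carrier A \<Longrightarrow> 1 \<odot> x = x"
    and "\<And>c x y. \<lbrakk>x \<in> carrier A; y \<in> carrier A\<rbrakk> \<Longrightarrow> (c \<odot> x) \<otimes> y = c \<odot> (x \<otimes> y)"
    and "\<And>c x y. \<lbrakk>x \<in> carrier A; y \<in> carrier A\<rbrakk> \<Longrightarrow> x \<otimes> (c \<odot> y) = c \<odot> (x \<otimes> y)"
  shows "k_algebra A"
proof -
  have "module base A"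
    by (rule moduleI) (simp_all add: assms cring_base)
  moreover have "ring A"
    by (rule ringI) (auto intro!: monoidI simp: assms)
  ultimately show ?thesis
    by (simp add: k_algebra_def k_algebra_axioms_def assms)
qed

lemma k_algebra_base: "k_algebra (base :: ('k::field, 'k) module)"
proof -
  interpret cring "base :: ('k, 'k) module" by (rule cring_base)
  show ?thesis by (rule k_algebraI) (auto simp: algebra_simps is_abelian_group)
qed

context k_algebra
begin

lemma smc [simp, intro]: "x \<in> carrier A \<Longrightarrow> c \<odot> x \<in> carrier A"
  using smult_closed by simp

lemma sm_add_l: "x \<in> carrier A \<Longrightarrow> (a + b) \<odot> x = a \<odot> x \<oplus> b \<odot> x"
  using smult_l_distr[of a b x] by simp

lemma sm_add_r: "\<lbrakk>x \<in> carrier A; y \<in> carrier A\<rbrakk> \<Longrightarrow> a \<odot> (x \<oplus> y) = a \<odot> x \<oplus> a \<odot> y"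
  using smult_r_distr[of a x y] by simp

lemma sm_sm [simp]: "x \<in> carrier A \<Longrightarrow> a \<odot> (b \<odot> x) = (a * b) \<odot> x"
  using smult_assoc1[of a b x] by simp

lemma sm_1 [simp]: "x \<in> carrier A \<Longrightarrow> 1 \<odot> x = x"
  using smult_one[of x] by simp

lemma sm_0 [simp]: "x \<in> carrier A \<Longrightarrow> 0 \<odot> x = \<zero>"
  using smult_l_null[of x] by simp

lemma sm_zero [simp]: "c \<odot> \<zero> = \<zero>"
  using smult_r_null[of c] by simp

lemma sm_uminus_l: "x \<in> carrier A \<Longrightarrow> (- c) \<odot> x = \<ominus> (c \<odot> x)"
  using smult_l_minus[of c x] by simp

lemma sm_uminus_r: "x \<in> carrier A \<Longrightarrow> c \<odot> (\<ominus> x) = \<ominus> (c \<odot> x)"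
  using smult_r_minus[of c x] by simp

lemma uminus_sm: "x \<in> carrier A \<Longrightarrow> \<ominus> x = (- 1) \<odot> x"
  using sm_uminus_l[of x 1] by simp

lemma sm_diff_r: "\<lbrakk>x \<in> carrier A; y \<in> carrier A\<rbrakk> \<Longrightarrow> a \<odot> (x \<ominus> y) = a \<odot> x \<ominus> a \<odot> y"
  by (simp add: minus_eq sm_add_r sm_uminus_r)

lemma sm_mult_l [simp]: "\<lbrakk>x \<in> carrier A; y \<in> carrier A\<rbrakk> \<Longrightarrow> (c \<odot> x) \<otimes> y = c \<odot> (x \<otimes> y)"
  by (rule smult_mult_left)

lemma sm_mult_r [simp]: "\<lbrakk>x \<in> carrier A; y \<in> carrier A\<rbrakk> \<Longrightarrow> x \<otimes> (c \<odot> y) = c \<odot> (x \<otimes> y)"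
  by (rule smult_mult_right)

lemma diff_zero_iff: "\<lbrakk>x \<in> carrier A; y \<in> carrier A\<rbrakk> \<Longrightarrow> x \<ominus> y = \<zero> \<longleftrightarrow> x = y"
  by (metis add.inv_closed minus_eq minus_equality minus_minus r_neg)

text \<open>Negatives are the multiples by -1 and zero is the multiple by 0 of any element, so
  closure under sums and scalars suffices.\<close>

lemma subm_iff: "submodule B base A \<longleftrightarrow> B \<subseteq> carrier A \<and> \<zero> \<in> B \<and>
    (\<forall>x\<in>B. \<forall>y\<in>B. x \<oplus> y \<in> B) \<and> (\<forall>c. \<forall>x\<in>B. c \<odot> x \<in> B)" (is "?l = ?r")
proof
  assume ?l
  then have "submodule B base A" .
  note s = submoduleE[OF this]
  obtain x where "x \<in> B" using s(2) by auto
  then have "0 \<odot> x \<in> B" "x \<in> carrier A" using s(4)[of 0 x] s(1) by auto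
  then show ?r using s by auto
next
  assume r: ?r
  show ?l
  proof (rule submoduleI)
    fix a assume "a \<in> B"
    then show "\<ominus> a \<in> B" using r uminus_sm[of a] by auto
  qed (use r in auto)
qed

end

subsection \<open>Linear extension\<close>

lemma lookup_scal [simp]: "lookup (c \<cdot> p) u = c * lookup p u"
  by (simp add: scal_def map.rep_eq when_def)

lemma keys_scal: "keys (c \<cdot> p) \<subseteq> keys p"
  by (auto simp: in_keys_iff)

lemma scal_simps [simp]:
  "c \<cdot> single u a = single u (c * a)" "1 \<cdot> p = p" "0 \<cdot> p = 0" "c \<cdot> 0 = 0"
  "a \<cdot> (b \<cdot> p) = (a * b) \<cdot> p"
  by (auto intro!: poly_mapping_eqI simp: lookup_single when_def)

lemma scal_distrib:
  "c \<cdot> (p + q) = c \<cdot> p + c \<cdot> q" "c \<cdot> (p - q) = c \<cdot> p - c \<cdot> q" "c \<cdot> (- p) = - (c \<cdot> p)"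
  "(a + b) \<cdot> p = a \<cdot> p + b \<cdot> p"
  by (auto intro!: poly_mapping_eqI simp: lookup_add lookup_minus algebra_simps)

lemma single_scal: "single u c = c \<cdot> single u 1"
  by simp

lemma keys_add_in: "keys p \<subseteq> X \<Longrightarrow> keys q \<subseteq> X \<Longrightarrow> keys (p + q) \<subseteq> X"
  by (rule order_trans[OF Poly_Mapping.keys_add]) auto

lemma keys_uminus_eq [simp]: "keys (- p) = keys (p :: 'a \<Rightarrow>\<^sub>0 'b::ab_group_add)"
  by (auto simp: in_keys_iff)

lemma keys_diff_in:
  fixes p q :: "'a \<Rightarrow>\<^sub>0 'b::ab_group_add"
  shows "keys p \<subseteq> X \<Longrightarrow> keys q \<subseteq> X \<Longrightarrow> keys (p - q) \<subseteq> X"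
  using keys_add_in[of p X "- q"] by simp

lemma keys_scal_in: "keys p \<subseteq> X \<Longrightarrow> keys (c \<cdot> p) \<subseteq> X"
  by (rule order_trans[OF keys_scal])

lemma keys_single_in: "u \<in> X \<Longrightarrow> keys (single u c) \<subseteq> X"
  by simp

lemma keys_sum_in: "(\<And>i. i \<in> I \<Longrightarrow> keys (f i) \<subseteq> X) \<Longrightarrow> keys (sum f I) \<subseteq> X"
proof (induction I rule: infinite_finite_induct)
  case (insert i I)
  then show ?case by (simp add: keys_add_in)
qed auto

lemma poly_mapping_sum_single:
  fixes p :: "'a \<Rightarrow>\<^sub>0 'b::comm_monoid_add"
  assumes "finite Y" "keys p \<subseteq> Y"
  shows "(\<Sum>u\<in>Y. single u (lookup p u)) = p"
proof (rule poly_mapping_eqI)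
  fix v
  have "(\<Sum>u\<in>Y. lookup (single u (lookup p u)) v)
      = (\<Sum>u\<in>Y. if u = v then lookup p v else 0)"
    by (intro sum.cong) (auto simp: lookup_single when_def)
  also have "\<dots> = lookup p v" using assms by (auto simp: in_keys_iff)
  finally show "lookup (\<Sum>u\<in>Y. single u (lookup p u)) v
    = lookup p v" by (simp add: lookup_sum)
qed

text \<open>A finitely supported function is the sum of its one-point parts. Keeping all supports
  inside \<open>X\<close> makes the carrier conditions on basis elements available in every
  induction step.\<close>

lemma keys_induct [consumes 1, case_names zero single add]:
  fixes p :: "'a \<Rightarrow>\<^sub>0 'b::comm_monoid_add"
  assumes "keys p \<subseteq> X" and "P 0"
    and s: "\<And>u c. u \<in> X \<Longrightarrow> P (single u c)"
    and a: "\<And>p q. \<lbrakk>keys p \<subseteq> X; keys q \<subseteq> X; P p; P q\<rbrakk> \<Longrightarrow> P (p + q)"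
  shows "P p"
proof -
  have "keys (\<Sum>u\<in>Y. single u (lookup p u)) \<subseteq> X \<and>
     P (\<Sum>u\<in>Y. single u (lookup p u))" if "finite Y" "Y \<subseteq> X" for Y
    using that
  proof (induction Y)
    case (insert u Y)
    then show ?case by (simp add: a s keys_add_in)
  qed (simp add: assms(2))
  from this[of "keys p"] show ?thesis
    using assms(1) by (simp add: poly_mapping_sum_single)
qed

text \<open>The common core of \<open>tensor_lift\<close> and \<open>free_lift\<close>: both are
  this sum, the former at a chosen representative. Facts about either are therefore proved here
  once.\<close>

definition lin_ext :: "('k::field, 'a, 'z) module_scheme \<Rightarrow> ('u \<Rightarrow> 'a) \<Rightarrow> ('u \<Rightarrow>\<^sub>0 'k) \<Rightarrow> 'a" where
  "lin_ext M \<beta> p = (\<Oplus>\<^bsub>M\<^esub>u\<in>keys p. lookup p u \<odot>\<^bsub>M\<^esub> \<beta> u)"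

context k_algebra
begin

text \<open>The index set of the sum depends on \<open>p\<close>; enlarging it by zero terms gives
  several functions a common index set, as additivity requires.\<close>

lemma lin_ext_superset:
  assumes "\<beta> \<in> X \<rightarrow> carrier A" "keys p \<subseteq> Y" "Y \<subseteq> X" "finite Y"
  shows "lin_ext A \<beta> p = (\<Oplus>u\<in>Y. lookup p u \<odot> \<beta> u)"
  unfolding lin_ext_def
proof (rule add.finprod_mono_neutral_cong_left)
  show "lookup p i \<odot> \<beta> i = \<zero>" if "i \<in> Y - keys p" for i
    using that assms by (auto simp: in_keys_iff Pi_iff)
qed (use assms in auto)

lemma lin_ext_closed [intro]:
  "\<beta> \<in> X \<rightarrow> carrier A \<Longrightarrow> keys p \<subseteq> X \<Longrightarrow> lin_ext A \<beta> p \<in> carrier A"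
  unfolding lin_ext_def by (intro finsum_closed) auto

lemma lin_ext_zero [simp]: "lin_ext A \<beta> 0 = \<zero>"
  by (simp add: lin_ext_def)

lemma lin_ext_single: "\<beta> u \<in> carrier A \<Longrightarrow> lin_ext A \<beta> (single u c) = c \<odot> \<beta> u"
  using lin_ext_superset[of \<beta> "{u}" "single u c" "{u}"] by simp

lemma lin_ext_add:
  assumes "\<beta> \<in> X \<rightarrow> carrier A" "keys p \<subseteq> X" "keys q \<subseteq> X"
  shows "lin_ext A \<beta> (p + q) = lin_ext A \<beta> p \<oplus> lin_ext A \<beta> q"
proof -
  let ?Y = "keys p \<union> keys q"
  have Y: "?Y \<subseteq> X" "finite ?Y" using assms by auto
  have *: "\<And>u. u \<in> ?Y \<Longrightarrow> \<beta> u \<in> carrier A" using Y assms by auto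
  have k: "keys (p + q) \<subseteq> ?Y" by (rule Poly_Mapping.keys_add)
  have "lin_ext A \<beta> (p + q) = (\<Oplus>u\<in>?Y. lookup (p + q) u \<odot> \<beta> u)"
    by (rule lin_ext_superset[OF assms(1) k Y])
  also have "\<dots> = (\<Oplus>u\<in>?Y. lookup p u \<odot> \<beta> u \<oplus> lookup q u \<odot> \<beta> u)"
    using * by (intro finsum_cong') (auto simp: lookup_add sm_add_l)
  also have "\<dots> = (\<Oplus>u\<in>?Y. lookup p u \<odot> \<beta> u) \<oplus> (\<Oplus>u\<in>?Y. lookup q u \<odot> \<beta> u)"
    by (rule finsum_addf) (use * in auto)
  also have "\<dots> = lin_ext A \<beta> p \<oplus> lin_ext A \<beta> q"
    using lin_ext_superset[OF assms(1) _ Y, of p] lin_ext_superset[OF assms(1) _ Y, of q] by simp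
  finally show ?thesis .
qed

lemma lin_ext_scal:
  assumes "\<beta> \<in> X \<rightarrow> carrier A" "keys p \<subseteq> X"
  shows "lin_ext A \<beta> (c \<cdot> p) = c \<odot> lin_ext A \<beta> p"
  using assms(2)
proof (induction rule: keys_induct)
  case (single u d)
  then have "\<beta> u \<in> carrier A" using assms by auto
  then show ?case by (simp add: lin_ext_single)
next
  case (add p q)
  then show ?case
    using assms by (simp add: scal_distrib lin_ext_add[of _ X] keys_scal_in sm_add_r lin_ext_closed[of _ X])
qed simp

lemma lin_ext_uminus:
  assumes "\<beta> \<in> X \<rightarrow> carrier A" "keys p \<subseteq> X"
  shows "lin_ext A \<beta> (- p) = \<ominus> lin_ext A \<beta> p"
proof -
  have "- p = (- 1) \<cdot> p" by (auto intro!: poly_mapping_eqI)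
  then show ?thesis using assms lin_ext_scal[OF assms, of "- 1"] uminus_sm[of "lin_ext A \<beta> p"]
    by (simp add: lin_ext_closed[of _ X])
qed

lemma lin_ext_diff:
  assumes "\<beta> \<in> X \<rightarrow> carrier A" "keys p \<subseteq> X" "keys q \<subseteq> X"
  shows "lin_ext A \<beta> (p - q) = lin_ext A \<beta> p \<ominus> lin_ext A \<beta> q"
  using assms lin_ext_add[of \<beta> X p "- q"] lin_ext_uminus[of \<beta> X q] by (simp add: minus_eq)

lemma lin_ext_mem:
  assumes "submodule B base A" "\<And>u. u \<in> keys p \<Longrightarrow> \<beta> u \<in> B"
  shows "lin_ext A \<beta> p \<in> B"
proof -
  have B: "B \<subseteq> carrier A" using assms(1) by (simp add: subm_iff)
  \<comment> \<open>Taking as support bound the set of all \<open>u\<close> with \<beta> u in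
    \<open>B\<close> turns the pointwise hypothesis into the form that the induction needs.\<close>
  have "keys p \<subseteq> {u. \<beta> u \<in> B}" using assms(2) by auto
  then show ?thesis
  proof (induction rule: keys_induct)
    case (single u c)
    then show ?case using assms(1) B by (auto simp: subm_iff lin_ext_single subsetD)
  next
    case (add p q)
    then show ?case
      using assms(1) B lin_ext_add[of \<beta> "{u. \<beta> u \<in> B}" p q] by (simp add: subm_iff Pi_iff subset_iff)
  qed (use assms in \<open>simp add: subm_iff\<close>)
qed

end

lemma tensor_lift_lin_ext: "tensor_lift M \<beta> T = lin_ext M \<beta> (SOME t. t \<in> T)"
  by (simp add: tensor_lift_def lin_ext_def Let_def)

lemma free_lift_lin_ext: "free_lift A \<phi> p = lin_ext A (\<lambda>w. foldr (\<lambda>g a. \<phi> g \<otimes>\<^bsub>A\<^esub> a) (letters w) \<one>\<^bsub>A\<^esub>) p"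
  by (simp add: free_lift_def lin_ext_def)

subsection \<open>Linear maps and algebra homomorphisms\<close>

lemma k_linearI:
  assumes "\<And>x. x \<in> carrier A \<Longrightarrow> f x \<in> carrier B"
    and "\<And>x y. \<lbrakk>x \<in> carrier A; y \<in> carrier A\<rbrakk> \<Longrightarrow> f (x \<oplus>\<^bsub>A\<^esub> y) = f x \<oplus>\<^bsub>B\<^esub> f y"
    and "\<And>c x. x \<in> carrier A \<Longrightarrow> f (c \<odot>\<^bsub>A\<^esub> x) = c \<odot>\<^bsub>B\<^esub> f x"
  shows "k_linear A B f"
  using assms by (auto simp: k_linear_def)

lemma k_linearD:
  assumes "k_linear A B f"
  shows "x \<in> carrier A \<Longrightarrow> f x \<in> carrier B"
    and "\<lbrakk>x \<in> carrier A; y \<in> carrier A\<rbrakk> \<Longrightarrow> f (x \<oplus>\<^bsub>A\<^esub> y) = f x \<oplus>\<^bsub>B\<^esub> f y"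
    and "x \<in> carrier A \<Longrightarrow> f (c \<odot>\<^bsub>A\<^esub> x) = c \<odot>\<^bsub>B\<^esub> f x"
  using assms by (auto simp: k_linear_def)

lemma k_linear_zero:
  assumes "k_algebra A" "k_algebra B" "k_linear A B f"
  shows "f \<zero>\<^bsub>A\<^esub> = \<zero>\<^bsub>B\<^esub>"
proof -
  interpret A: k_algebra A by fact
  interpret B: k_algebra B by fact
  have "f (0 \<odot>\<^bsub>A\<^esub> \<zero>\<^bsub>A\<^esub>) = 0 \<odot>\<^bsub>B\<^esub> f \<zero>\<^bsub>A\<^esub>" by (rule k_linearD(3)[OF assms(3)]) simp
  then show ?thesis using k_linearD(1)[OF assms(3), of "\<zero>\<^bsub>A\<^esub>"] by simp
qed

lemma k_linear_uminus:
  assumes "k_algebra A" "k_algebra B" "k_linear A B f" "x \<in> carrier A"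
  shows "f (\<ominus>\<^bsub>A\<^esub> x) = \<ominus>\<^bsub>B\<^esub> f x"
proof -
  interpret A: k_algebra A by fact
  interpret B: k_algebra B by fact
  show ?thesis using assms(4) k_linearD[OF assms(3)] by (simp add: A.uminus_sm B.uminus_sm)
qed

lemma k_linear_diff:
  assumes "k_algebra A" "k_algebra B" "k_linear A B f" "x \<in> carrier A" "y \<in> carrier A"
  shows "f (x \<ominus>\<^bsub>A\<^esub> y) = f x \<ominus>\<^bsub>B\<^esub> f y"
proof -
  interpret A: k_algebra A by fact
  interpret B: k_algebra B by fact
  show ?thesis using assms(4,5) k_linearD[OF assms(3)] k_linear_uminus[OF assms(1-3)]
    by (simp add: A.minus_eq B.minus_eq)
qed

lemma k_linear_lin_ext:
  assumes "k_algebra A" "k_algebra B" "k_linear A B f" "\<beta> \<in> X \<rightarrow> carrier A" "keys p \<subseteq> X"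
  shows "f (lin_ext A \<beta> p) = lin_ext B (\<lambda>u. f (\<beta> u)) p"
proof -
  interpret A: k_algebra A by fact
  interpret B: k_algebra B by fact
  have *: "(\<lambda>u. f (\<beta> u)) \<in> X \<rightarrow> carrier B" using assms(4) k_linearD(1)[OF assms(3)] by (auto simp: Pi_iff)
  show ?thesis using assms(5)
  proof (induction rule: keys_induct)
    case zero
    then show ?case using k_linear_zero[OF assms(1-3)] by simp
  next
    case (single u c)
    then have "\<beta> u \<in> carrier A" using assms(4) by auto
    then show ?case using k_linearD[OF assms(3)] by (simp add: A.lin_ext_single B.lin_ext_single)
  next
    case (add p q)
    then show ?case
      using assms(4) * k_linearD[OF assms(3)]
      by (simp add: A.lin_ext_add[of _ X] B.lin_ext_add[of _ X] A.lin_ext_closed[of _ X])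
  qed
qed

section \<open>Algebra homomorphisms and generated subalgebras\<close>

definition alg_hom :: "('k::field, 'a, 'y) module_scheme \<Rightarrow> ('k, 'b, 'z) module_scheme \<Rightarrow> ('a \<Rightarrow> 'b) \<Rightarrow> bool" where
  "alg_hom A B f \<longleftrightarrow> k_linear A B f \<and> f \<in> ring_hom A B"

lemma alg_homI:
  assumes "k_linear A B f" "\<And>x y. \<lbrakk>x \<in> carrier A; y \<in> carrier A\<rbrakk> \<Longrightarrow> f (x \<otimes>\<^bsub>A\<^esub> y) = f x \<otimes>\<^bsub>B\<^esub> f y"
    "f \<one>\<^bsub>A\<^esub> = \<one>\<^bsub>B\<^esub>"
  shows "alg_hom A B f"
  using assms by (auto simp: alg_hom_def ring_hom_def k_linear_def)

lemma alg_homD: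
  assumes "alg_hom A B f"
  shows "k_linear A B f"
    and "x \<in> carrier A \<Longrightarrow> f x \<in> carrier B"
    and "\<lbrakk>x \<in> carrier A; y \<in> carrier A\<rbrakk> \<Longrightarrow> f (x \<oplus>\<^bsub>A\<^esub> y) = f x \<oplus>\<^bsub>B\<^esub> f y"
    and "x \<in> carrier A \<Longrightarrow> f (c \<odot>\<^bsub>A\<^esub> x) = c \<odot>\<^bsub>B\<^esub> f x"
    and "\<lbrakk>x \<in> carrier A; y \<in> carrier A\<rbrakk> \<Longrightarrow> f (x \<otimes>\<^bsub>A\<^esub> y) = f x \<otimes>\<^bsub>B\<^esub> f y"
    and "f \<one>\<^bsub>A\<^esub> = \<one>\<^bsub>B\<^esub>"
  using assms by (auto simp: alg_hom_def ring_hom_def k_linear_def)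

lemma alg_hom_comp: "alg_hom A B f \<Longrightarrow> alg_hom B C g \<Longrightarrow> alg_hom A C (\<lambda>x. g (f x))"
  by (auto intro!: alg_homI k_linearI simp: alg_homD)

lemma alg_hom_id: "k_algebra A \<Longrightarrow> alg_hom A A (\<lambda>x. x)"
  by (auto intro!: alg_homI k_linearI)

context k_algebra
begin

lemma subalg_iff: "subalg A B \<longleftrightarrow> B \<subseteq> carrier A \<and> \<one> \<in> B \<and> (\<forall>x\<in>B. \<forall>y\<in>B. x \<oplus> y \<in> B) \<and>
    (\<forall>c. \<forall>x\<in>B. c \<odot> x \<in> B) \<and> (\<forall>x\<in>B. \<forall>y\<in>B. x \<otimes> y \<in> B)" (is "?l = ?r")
proof
  assume r: ?r
  then have "0 \<odot> \<one> \<in> B" by blast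
  then show ?l using r by (auto simp: subalg_def subm_iff)
qed (auto simp: subalg_def subm_iff)

lemma subalg_carrier: "subalg A (carrier A)"
  by (auto simp: subalg_iff)

text \<open>For \<open>X\<close> inside the carrier the intersected family is nonempty, since the
  carrier is a member of it; this confines the intersection to the carrier.\<close>

lemma subalg_subalg_generated:
  assumes "X \<subseteq> carrier A"
  shows "subalg A (subalg_generated A X)"
proof -
  have "subalg_generated A X \<subseteq> carrier A"
    using assms subalg_carrier by (auto simp: subalg_generated_def)
  then show ?thesis
    unfolding subalg_iff by (simp add: subalg_generated_def subalg_iff)
qed

lemma subalg_generated_incl: "X \<subseteq> subalg_generated A X"
  by (auto simp: subalg_generated_def)

lemma subalg_generated_least: "subalg A B \<Longrightarrow> X \<subseteq> B \<Longrightarrow> subalg_generated A X \<subseteq> B"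
  by (auto simp: subalg_generated_def)

lemma subalg_equalizer:
  assumes "k_algebra B" "alg_hom A B f" "alg_hom A B g"
  shows "subalg A {x \<in> carrier A. f x = g x}"
  using alg_homD[OF assms(2)] alg_homD[OF assms(3)] by (auto simp: subalg_iff)

lemma subalg_preimage:
  assumes "alg_hom A B f" "k_algebra B" "subalg B Y"
  shows "subalg A {x \<in> carrier A. f x \<in> Y}"
  using alg_homD[OF assms(1)] assms(3) by (auto simp: subalg_iff k_algebra.subalg_iff[OF assms(2)])

end

text \<open>The equalizer of two homomorphisms is a subalgebra; containing \<open>X\<close>, it
  contains everything that \<open>X\<close> generates. Each Hopf axiom that compares homomorphisms
  is reduced to generators in this way.\<close>

lemma alg_hom_eqI:
  assumes "k_algebra A" "k_algebra B" "alg_hom A B f" "alg_hom A B g"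
    "carrier A \<subseteq> subalg_generated A X" "X \<subseteq> carrier A" "\<And>x. x \<in> X \<Longrightarrow> f x = g x" "x \<in> carrier A"
  shows "f x = g x"
  using k_algebra.subalg_generated_least[OF assms(1) k_algebra.subalg_equalizer[OF assms(1-4)], of X] assms(5-8)
  by auto

subsection \<open>Opposite algebras\<close>

lemma opposite_simps [simp]:
  "carrier (opposite A) = carrier A" "x \<otimes>\<^bsub>opposite A\<^esub> y = y \<otimes>\<^bsub>A\<^esub> x" "\<one>\<^bsub>opposite A\<^esub> = \<one>\<^bsub>A\<^esub>"
  "\<zero>\<^bsub>opposite A\<^esub> = \<zero>\<^bsub>A\<^esub>" "x \<oplus>\<^bsub>opposite A\<^esub> y = x \<oplus>\<^bsub>A\<^esub> y" "c \<odot>\<^bsub>opposite A\<^esub> y = c \<odot>\<^bsub>A\<^esub> y"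
  "opposite (opposite A) = A"
  by (simp_all add: opposite_def)

lemma opposite_a_inv [simp]: "\<ominus>\<^bsub>opposite A\<^esub> x = \<ominus>\<^bsub>A\<^esub> x" "x \<ominus>\<^bsub>opposite A\<^esub> y = x \<ominus>\<^bsub>A\<^esub> y"
  by (simp_all add: a_inv_def m_inv_def a_minus_def)

lemma k_algebra_opposite: 
  assumes "k_algebra A" shows "k_algebra (opposite A)"
proof -
  interpret k_algebra A by fact
  have "abelian_group (opposite A)"
    by (rule abelian_groupI) (auto simp: a_ac intro: l_neg bexI[of _ "\<ominus>\<^bsub>A\<^esub> x" for x])
  then show ?thesis
    by (rule k_algebraI) (auto simp: m_assoc l_distr r_distr sm_add_l sm_add_r)
qed

subsection \<open>Quotients\<close>

lemma quot_alg_simps: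
  "carrier (quot_alg A I) = a_rcosets\<^bsub>A\<^esub> I" "mult (quot_alg A I) = rcoset_mult A I"
  "\<one>\<^bsub>quot_alg A I\<^esub> = I +>\<^bsub>A\<^esub> \<one>\<^bsub>A\<^esub>" "\<zero>\<^bsub>quot_alg A I\<^esub> = I" "add (quot_alg A I) = set_add A"
  "smult (quot_alg A I) = (\<lambda>c X. \<Union>x\<in>X. I +>\<^bsub>A\<^esub> (c \<odot>\<^bsub>A\<^esub> x))"
  by (simp_all add: quot_alg_def FactRing_def ring.defs module.defs)

locale quot_algebra = k_algebra A + ideal I A for A :: "('k::field, 'a, 'z) module_scheme" (structure) and I
begin

abbreviation "Q \<equiv> quot_alg A I"
abbreviation "\<pi> x \<equiv> I +> x"

lemma carrier_Q: "carrier Q = \<pi> ` carrier A"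
  by (auto simp: quot_alg_simps A_RCOSETS_def')

lemma \<pi>_in [simp]: "x \<in> carrier A \<Longrightarrow> \<pi> x \<in> carrier Q"
  by (simp add: carrier_Q)

lemma \<pi>_eq_iff: "x \<in> carrier A \<Longrightarrow> y \<in> carrier A \<Longrightarrow> \<pi> x = \<pi> y \<longleftrightarrow> x \<ominus> y \<in> I"
  using quotient_eq_iff_same_a_r_cos[OF ideal_axioms] by simp

text \<open>An ideal is a ring-theoretic notion; scalars stay inside because c x is the product of c
  1 with x.\<close>

lemma I_sm: "x \<in> I \<Longrightarrow> c \<odot> x \<in> I"
proof -
  assume x: "x \<in> I"
  then have "c \<odot> x = (c \<odot> \<one>) \<otimes> x" by (simp add: Icarr)
  then show ?thesis using x by (metis I_l_closed smc one_closed)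
qed

lemma \<pi>_add: "\<lbrakk>x \<in> carrier A; y \<in> carrier A\<rbrakk> \<Longrightarrow> \<pi> (x \<oplus> y) = \<pi> x \<oplus>\<^bsub>Q\<^esub> \<pi> y"
  by (simp add: quot_alg_simps a_rcos_sum)

lemma \<pi>_mult: "\<lbrakk>x \<in> carrier A; y \<in> carrier A\<rbrakk> \<Longrightarrow> \<pi> (x \<otimes> y) = \<pi> x \<otimes>\<^bsub>Q\<^esub> \<pi> y"
  by (simp add: quot_alg_simps rcoset_mult_add)

lemma \<pi>_sm: "x \<in> carrier A \<Longrightarrow> \<pi> (c \<odot> x) = c \<odot>\<^bsub>Q\<^esub> \<pi> x"
proof -
  assume x: "x \<in> carrier A"
  \<comment> \<open>Scalar multiplication on the quotient is a union over all members of the coset.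
    Every member contributes the same coset, so the union collapses.\<close>
  have "\<pi> (c \<odot> y) = \<pi> (c \<odot> x)" if "y \<in> \<pi> x" for y
  proof -
    have y: "y \<in> carrier A" using that x a_elemrcos_carrier by blast
    have "\<pi> x = \<pi> y" using a_repr_independence'[OF that x] .
    then have "y \<ominus> x \<in> I" using \<pi>_eq_iff x y by blast
    then show ?thesis using x y I_sm[of "y \<ominus> x" c] by (simp add: \<pi>_eq_iff sm_diff_r)
  qed
  then have "(\<Union>y\<in>\<pi> x. \<pi> (c \<odot> y)) = (\<Union>y\<in>\<pi> x. \<pi> (c \<odot> x))" by (rule SUP_cong[OF refl])
  also have "\<dots> = \<pi> (c \<odot> x)" using a_rcos_self[OF x] by (rule UN_constant_eq) simp
  finally show ?thesis unfolding quot_alg_simps by simp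
qed

lemma \<pi>_one: "\<pi> \<one> = \<one>\<^bsub>Q\<^esub>"
  by (simp add: quot_alg_simps)

lemma \<pi>_zero_iff: "x \<in> carrier A \<Longrightarrow> \<pi> x = \<zero>\<^bsub>Q\<^esub> \<longleftrightarrow> x \<in> I"
  using \<pi>_eq_iff[of x \<zero>] by (simp add: quot_alg_simps minus_eq a_subset)

lemma \<pi>_zero: "\<pi> \<zero> = \<zero>\<^bsub>Q\<^esub>"
  by (simp add: \<pi>_zero_iff)

lemma \<pi>_someI: "T \<in> carrier Q \<Longrightarrow> (SOME x. x \<in> T) \<in> carrier A \<and> \<pi> (SOME x. x \<in> T) = T"
proof -
  assume "T \<in> carrier Q"
  then obtain x where x: "x \<in> carrier A" "T = \<pi> x" by (auto simp: carrier_Q)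
  then have "(SOME x. x \<in> T) \<in> \<pi> x" using a_rcos_self[of x] by (metis someI_ex)
  then show ?thesis using x a_elemrcos_carrier a_repr_independence'[OF _ x(1)] by metis
qed

lemma k_algebra_Q: "k_algebra Q"
proof (rule k_algebraI)
  show "abelian_group Q"
  proof (rule abelian_groupI)
    fix X assume "X \<in> carrier Q"
    then obtain x where x: "x \<in> carrier A" "X = \<pi> x" by (auto simp: carrier_Q)
    then show "\<exists>Y\<in>carrier Q. Y \<oplus>\<^bsub>Q\<^esub> X = \<zero>\<^bsub>Q\<^esub>"
      by (intro bexI[of _ "\<pi> (\<ominus> x)"]) (auto simp: \<pi>_add[symmetric] l_neg \<pi>_zero_iff)
  qed (auto simp: carrier_Q \<pi>_add[symmetric] \<pi>_zero[symmetric] a_ac)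
qed (auto simp: carrier_Q \<pi>_mult[symmetric] \<pi>_add[symmetric] \<pi>_sm[symmetric] \<pi>_one[symmetric] m_assoc
   l_distr r_distr sm_add_l sm_add_r)

lemma alg_hom_\<pi>: "alg_hom A Q \<pi>"
  by (intro alg_homI k_linearI) (auto simp: \<pi>_mult \<pi>_add \<pi>_sm \<pi>_one)

text \<open>Two representatives of a coset differ by an element of \<open>I\<close>, which
  \<open>f\<close> kills. So the value at the \<open>SOME\<close> representative is the value at any
  representative, and linearity descends.\<close>

lemma k_linear_factor:
  assumes B: "k_algebra B" and f: "k_linear A B f" and k: "\<And>x. x \<in> I \<Longrightarrow> f x = \<zero>\<^bsub>B\<^esub>"
  shows "k_linear Q B (\<lambda>X. f (SOME x. x \<in> X))" "x \<in> carrier A \<Longrightarrow> f (SOME y. y \<in> \<pi> x) = f x"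
proof -
  interpret B: k_algebra B by fact
  have eq: "f (SOME y. y \<in> \<pi> x) = f x" if x: "x \<in> carrier A" for x
  proof -
    let ?y = "SOME y. y \<in> \<pi> x"
    have y: "?y \<in> carrier A" "?y \<ominus> x \<in> I" using \<pi>_someI[of "\<pi> x"] x \<pi>_eq_iff by auto
    have "f ?y \<ominus>\<^bsub>B\<^esub> f x = \<zero>\<^bsub>B\<^esub>" 
      using k_linear_diff[OF k_algebra_axioms B f y(1) x] k[OF y(2)] by simp
    then show ?thesis using k_linearD(1)[OF f] x y B.diff_zero_iff by blast
  qed
  show "x \<in> carrier A \<Longrightarrow> f (SOME y. y \<in> \<pi> x) = f x" by fact
  show "k_linear Q B (\<lambda>X. f (SOME x. x \<in> X))"
    by (intro k_linearI) (auto simp: carrier_Q \<pi>_add[symmetric] \<pi>_sm[symmetric] eq k_linearD[OF f])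
qed

lemma alg_hom_factor:
  assumes B: "k_algebra B" and f: "alg_hom A B f" and k: "\<And>x. x \<in> I \<Longrightarrow> f x = \<zero>\<^bsub>B\<^esub>"
  shows "alg_hom Q B (\<lambda>X. f (SOME x. x \<in> X))"
  using k_linear_factor[OF B alg_homD(1)[OF f] k]
  by (intro alg_homI)
    (auto simp: carrier_Q \<pi>_mult[symmetric] \<pi>_one[symmetric] alg_homD[OF f])

end

subsection \<open>Tensor products of algebras\<close>

lemma mult_DirProd [simp]: "(a, b) \<otimes>\<^bsub>A \<times>\<times> B\<^esub> (a', b') = (a \<otimes>\<^bsub>A\<^esub> a', b \<otimes>\<^bsub>B\<^esub> b')"
  by (simp add: DirProd_def)

lemma tensor_free_simps [simp]:
  "carrier (tensor_free A B) = {p. keys p \<subseteq> carrier A \<times> carrier B}"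
  "\<one>\<^bsub>tensor_free A B\<^esub> = single (\<one>\<^bsub>A\<^esub>, \<one>\<^bsub>B\<^esub>) 1" "\<zero>\<^bsub>tensor_free A B\<^esub> = 0"
  "p \<oplus>\<^bsub>tensor_free A B\<^esub> q = p + q" "c \<odot>\<^bsub>tensor_free A B\<^esub> p = c \<cdot> p"
  by (simp_all add: tensor_free_def)

locale tensor_alg = A: k_algebra A + B: k_algebra B
  for A :: "('k::field, 'a, 'y) module_scheme" and B :: "('k, 'b, 'z) module_scheme"
begin

abbreviation "F \<equiv> tensor_free A B"
abbreviation "R \<equiv> tensor_rel A B"
abbreviation "X \<equiv> carrier A \<times> carrier B"
abbreviation fm (infixl \<open>\<star>\<close> 70) where "p \<star> q \<equiv> p \<otimes>\<^bsub>F\<^esub> q"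

text \<open>The product sums over the supports of its factors; padding with zero terms lets
  different factors share index sets, which gives distributivity.\<close>

lemma fm_superset:
  assumes "finite U" "keys p \<subseteq> U" "finite V" "keys q \<subseteq> V"
  shows "p \<star> q = (\<Sum>u\<in>U. \<Sum>v\<in>V. single (u \<otimes>\<^bsub>A \<times>\<times> B\<^esub> v)
                  (lookup p u * lookup q v))"
proof -
  have "(\<Sum>v\<in>keys q. single (u \<otimes>\<^bsub>A \<times>\<times> B\<^esub> v)
                  (lookup p u * lookup q v))
      = (\<Sum>v\<in>V. single (u \<otimes>\<^bsub>A \<times>\<times> B\<^esub> v)
                  (lookup p u * lookup q v))" for u
    using assms by (intro sum.mono_neutral_left) (auto simp: in_keys_iff)
  moreover have "(\<Sum>u\<in>keys p. \<Sum>v\<in>V. single (u \<otimes>\<^bsub>A \<times>\<times> B\<^esub> v)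
                  (lookup p u * lookup q v))
      = (\<Sum>u\<in>U. \<Sum>v\<in>V. single (u \<otimes>\<^bsub>A \<times>\<times> B\<^esub> v)
                  (lookup p u * lookup q v))"
    using assms by (intro sum.mono_neutral_left) (auto simp: in_keys_iff)
  ultimately show ?thesis by (simp add: tensor_free_def)
qed

lemma fm_single: "single u a \<star> single v b = single (u \<otimes>\<^bsub>A \<times>\<times> B\<^esub> v) (a * b)"
  by (subst fm_superset[of "{u}" _ "{v}"]) auto

lemma fm_add_l: "(p + p') \<star> q = p \<star> q + p' \<star> q"
proof -
  let ?U = "keys p \<union> keys p'" and ?V = "keys q"
  note s = fm_superset[of ?U _ ?V q]
  have "keys (p + p') \<subseteq> ?U" by (rule Poly_Mapping.keys_add)
  then show ?thesis
    by (simp add: s lookup_add distrib_right single_add sum.distrib)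
qed

lemma fm_add_r: "q \<star> (p + p') = q \<star> p + q \<star> p'"
proof -
  let ?U = "keys p \<union> keys p'" and ?V = "keys q"
  note s = fm_superset[of ?V q ?U]
  have "keys (p + p') \<subseteq> ?U" by (rule Poly_Mapping.keys_add)
  then show ?thesis
    by (simp add: s lookup_add distrib_left single_add sum.distrib)
qed

lemma fm_zero [simp]: "0 \<star> q = 0" "q \<star> 0 = 0"
  by (simp_all add: tensor_free_def)

lemma fm_scal_l: "(c \<cdot> p) \<star> q = c \<cdot> (p \<star> q)"
proof -
  have "keys p \<subseteq> UNIV" "keys q \<subseteq> UNIV" by auto
  then show ?thesis
  proof (induction arbitrary: q rule: keys_induct)
    case (single u a)
    show ?case using single(2)
      by (induction rule: keys_induct) (simp_all add: fm_single fm_add_r scal_distrib mult.assoc)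
  qed (simp_all add: fm_add_l scal_distrib)
qed

lemma fm_scal_r: "p \<star> (c \<cdot> q) = c \<cdot> (p \<star> q)"
proof -
  have "keys p \<subseteq> UNIV" "keys q \<subseteq> UNIV" by auto
  then show ?thesis
  proof (induction arbitrary: q rule: keys_induct)
    case (single u a)
    show ?case using single(2)
      by (induction rule: keys_induct) (simp_all add: fm_single fm_add_r scal_distrib mult_ac)
  qed (simp_all add: fm_add_l scal_distrib)
qed

lemma fm_diff_r: "q \<star> (p - p') = q \<star> p - q \<star> p'"
  using fm_add_r[of q "p - p'" p'] by (simp add: algebra_simps)

lemma fm_diff_l: "(p - p') \<star> q = p \<star> q - p' \<star> q"
  using fm_add_l[of "p - p'" p' q] by (simp add: algebra_simps)

lemma fm_keys:
  assumes "keys p \<subseteq> X" "keys q \<subseteq> X"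
  shows "keys (p \<star> q) \<subseteq> X"
proof -
  have "keys (\<Sum>u\<in>keys p. \<Sum>v\<in>keys q. single (u \<otimes>\<^bsub>A \<times>\<times> B\<^esub> v)
                  (lookup p u * lookup q v)) \<subseteq> X"
    using assms by (intro keys_sum_in keys_single_in) fastforce
  then show ?thesis by (simp add: tensor_free_def)
qed

lemma fm_assoc:
  assumes "keys p \<subseteq> X" "keys q \<subseteq> X" "keys t \<subseteq> X"
  shows "p \<star> q \<star> t = p \<star> (q \<star> t)"
  using assms(1)
proof (induction rule: keys_induct)
  case (single u a)
  show ?case using assms(2)
  proof (induction rule: keys_induct)
    case (single v b)
    show ?case using assms(3)
    proof (induction rule: keys_induct)
      case (single w c)
      then show ?case using \<open>u \<in> X\<close> \<open>v \<in> X\<close> by (auto simp: fm_single mult.assoc A.m_assoc B.m_assoc)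
    qed (simp_all add: fm_add_r)
  qed (simp_all add: fm_add_l fm_add_r)
qed (simp_all add: fm_add_l)

lemma fm_one:
  assumes "keys p \<subseteq> X"
  shows "single (\<one>\<^bsub>A\<^esub>, \<one>\<^bsub>B\<^esub>) 1 \<star> p = p" "p \<star> single (\<one>\<^bsub>A\<^esub>, \<one>\<^bsub>B\<^esub>) 1 = p"
  using assms by (induction rule: keys_induct) (auto simp: fm_single fm_add_l fm_add_r)

lemma k_algebra_F: "k_algebra F"
proof (rule k_algebraI)
  show "abelian_group F"
  proof (rule abelian_groupI)
    fix p assume "p \<in> carrier F"
    then show "\<exists>q\<in>carrier F. q \<oplus>\<^bsub>F\<^esub> p = \<zero>\<^bsub>F\<^esub>" by (intro bexI[of _ "- p"]) auto
  qed (auto simp: add_ac keys_add_in)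
qed (simp_all add: fm_keys fm_assoc fm_one keys_scal_in fm_add_l fm_add_r scal_distrib fm_scal_l fm_scal_r)

lemma F_diff: "p \<in> carrier F \<Longrightarrow> q \<in> carrier F \<Longrightarrow> p \<ominus>\<^bsub>F\<^esub> q = p - q"
proof -
  assume *: "p \<in> carrier F" "q \<in> carrier F"
  interpret F: k_algebra F by (rule k_algebra_F)
  have "\<ominus>\<^bsub>F\<^esub> q = - q" by (rule F.minus_equality) (use * in auto)
  then show ?thesis by (simp add: F.minus_eq)
qed

lemma rel_subset: "p \<in> R \<Longrightarrow> keys p \<subseteq> X"
  by (induction rule: tensor_rel.induct) (simp_all add: keys_diff_in keys_add_in keys_scal_in)

text \<open>Multiplying a bilinearity relation by a basis element gives a bilinearity relation of
  the same kind. Hence the relations form a two-sided ideal and the tensor product is an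
  algebra.\<close>

lemma rel_mult_single:
  assumes "p \<in> R" "a \<in> carrier A" "b \<in> carrier B"
  shows "single (a, b) c \<star> p \<in> R" "p \<star> single (a, b) c \<in> R"
proof -
  have eq: "single (a, b) c \<star> p = c \<cdot> (single (a, b) 1 \<star> p)"
    "p \<star> single (a, b) c = c \<cdot> (p \<star> single (a, b) 1)"
    by (simp flip: fm_scal_l, simp flip: fm_scal_r)
  have "single (a, b) 1 \<star> p \<in> R \<and> p \<star> single (a, b) 1 \<in> R"
    using assms(1)
  proof (induction rule: tensor_rel.induct)
    case (add_left x x' y)
    then show ?case using assms(2,3) tensor_rel.add_left[of "a \<otimes>\<^bsub>A\<^esub> x" A "a \<otimes>\<^bsub>A\<^esub> x'" "b \<otimes>\<^bsub>B\<^esub> y" B]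
      tensor_rel.add_left[of "x \<otimes>\<^bsub>A\<^esub> a" A "x' \<otimes>\<^bsub>A\<^esub> a" "y \<otimes>\<^bsub>B\<^esub> b" B]
      by (simp add: fm_diff_r fm_diff_l fm_single A.r_distr A.l_distr)
  next
    case (add_right x y y')
    then show ?case using assms(2,3) tensor_rel.add_right[of "a \<otimes>\<^bsub>A\<^esub> x" A "b \<otimes>\<^bsub>B\<^esub> y" B "b \<otimes>\<^bsub>B\<^esub> y'"]
      tensor_rel.add_right[of "x \<otimes>\<^bsub>A\<^esub> a" A "y \<otimes>\<^bsub>B\<^esub> b" B "y' \<otimes>\<^bsub>B\<^esub> b"]
      by (simp add: fm_diff_r fm_diff_l fm_single B.r_distr B.l_distr)
  next
    case (smult_left x y d)
    then show ?case using assms(2,3) tensor_rel.smult_left[of "a \<otimes>\<^bsub>A\<^esub> x" A "b \<otimes>\<^bsub>B\<^esub> y" B d]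
      tensor_rel.smult_left[of "x \<otimes>\<^bsub>A\<^esub> a" A "y \<otimes>\<^bsub>B\<^esub> b" B d]
      by (simp add: fm_diff_r fm_diff_l fm_single)
  next
    case (smult_right x y d)
    then show ?case using assms(2,3) tensor_rel.smult_right[of "a \<otimes>\<^bsub>A\<^esub> x" A "b \<otimes>\<^bsub>B\<^esub> y" B d]
      tensor_rel.smult_right[of "x \<otimes>\<^bsub>A\<^esub> a" A "y \<otimes>\<^bsub>B\<^esub> b" B d]
      by (simp add: fm_diff_r fm_diff_l fm_single)
  next
    case zero
    then show ?case by (simp add: tensor_rel.zero)
  next
    case (add p q)
    then show ?case by (simp add: fm_add_l fm_add_r tensor_rel.add)
  next
    case (scal p c)
    then show ?case by (simp add: fm_scal_l fm_scal_r tensor_rel.scal)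
  qed
  then show "single (a, b) c \<star> p \<in> R" "p \<star> single (a, b) c \<in> R"
    unfolding eq by (auto intro: tensor_rel.scal)
qed

lemma rel_mult:
  assumes "p \<in> R" "keys t \<subseteq> X"
  shows "t \<star> p \<in> R" "p \<star> t \<in> R"
proof -
  have "t \<star> p \<in> R \<and> p \<star> t \<in> R" using assms(2)
    by (induction rule: keys_induct)
      (auto simp: fm_add_l fm_add_r intro: tensor_rel.zero tensor_rel.add rel_mult_single[OF assms(1)])
  then show "t \<star> p \<in> R" "p \<star> t \<in> R" by auto
qed

lemma quot_algebra_tensor: "quot_algebra F R"
proof -
  interpret F: k_algebra F by (rule k_algebra_F)
  have "submodule R base F" unfolding F.subm_iff
    by (auto intro: tensor_rel.zero tensor_rel.add tensor_rel.scal dest: rel_subset)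
  then have "subgroup R (add_monoid F)" by (simp add: submodule_def)
  then have "ideal R F" by (intro idealI F.ring_axioms) (auto intro: rel_mult)
  then show ?thesis by (simp add: quot_algebra_def k_algebra_F)
qed

sublocale Q: quot_algebra F R
  by (rule quot_algebra_tensor)

abbreviation "T \<equiv> tensor A B"
abbreviation "tc \<equiv> tensor_class A B"
abbreviation "pt \<equiv> pure_tensor A B"

lemma T_alg: "k_algebra T"
  using Q.k_algebra_Q by (simp add: tensor_def)

lemma carrier_T: "carrier T = tc ` {p. keys p \<subseteq> X}"
  using Q.carrier_Q by (simp add: tensor_def tensor_class_def)

lemma tc_simps:
  "keys p \<subseteq> X \<Longrightarrow> tc p \<in> carrier T"
  "\<lbrakk>keys p \<subseteq> X; keys q \<subseteq> X\<rbrakk> \<Longrightarrow> tc (p + q) = tc p \<oplus>\<^bsub>T\<^esub> tc q"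
  "\<lbrakk>keys p \<subseteq> X; keys q \<subseteq> X\<rbrakk> \<Longrightarrow> tc (p \<star> q) = tc p \<otimes>\<^bsub>T\<^esub> tc q"
  "keys p \<subseteq> X \<Longrightarrow> tc (c \<cdot> p) = c \<odot>\<^bsub>T\<^esub> tc p"
  "tc 0 = \<zero>\<^bsub>T\<^esub>"
  using Q.\<pi>_in[of p] Q.\<pi>_add[of p q] Q.\<pi>_mult[of p q] Q.\<pi>_sm[of p c] Q.\<pi>_zero
  by (simp_all add: tensor_def tensor_class_def)

lemma tc_eq_iff:
  "\<lbrakk>keys p \<subseteq> X; keys q \<subseteq> X\<rbrakk> \<Longrightarrow> tc p = tc q \<longleftrightarrow> p - q \<in> R"
  using Q.\<pi>_eq_iff[of p q] by (simp add: tensor_class_def F_diff)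

lemma pt_in [simp, intro]: "\<lbrakk>x \<in> carrier A; y \<in> carrier B\<rbrakk> \<Longrightarrow> pt x y \<in> carrier T"
  by (simp add: pure_tensor_def tc_simps)

lemma pt_one: "\<one>\<^bsub>T\<^esub> = pt \<one>\<^bsub>A\<^esub> \<one>\<^bsub>B\<^esub>"
  using Q.\<pi>_one by (simp add: pure_tensor_def tensor_def tensor_class_def)

lemma tc_single: "\<lbrakk>x \<in> carrier A; y \<in> carrier B\<rbrakk> \<Longrightarrow> tc (single (x, y) c) = c \<odot>\<^bsub>T\<^esub> pt x y"
  using tc_simps(4)[of "single (x, y) 1" c] by (simp add: pure_tensor_def)

lemma pt_mult: "\<lbrakk>x \<in> carrier A; y \<in> carrier B; x' \<in> carrier A; y' \<in> carrier B\<rbrakk> \<Longrightarrow>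
    pt x y \<otimes>\<^bsub>T\<^esub> pt x' y' = pt (x \<otimes>\<^bsub>A\<^esub> x') (y \<otimes>\<^bsub>B\<^esub> y')"
  by (simp add: pure_tensor_def tc_simps(3)[symmetric] fm_single)

lemma pt_add_l: "\<lbrakk>x \<in> carrier A; x' \<in> carrier A; y \<in> carrier B\<rbrakk> \<Longrightarrow> pt (x \<oplus>\<^bsub>A\<^esub> x') y = pt x y \<oplus>\<^bsub>T\<^esub> pt x' y"
  using tensor_rel.add_left[of x A x' y B]
  by (simp add: pure_tensor_def tc_simps(2)[symmetric] tc_eq_iff keys_add_in diff_diff_add)

lemma pt_add_r: "\<lbrakk>x \<in> carrier A; y \<in> carrier B; y' \<in> carrier B\<rbrakk> \<Longrightarrow> pt x (y \<oplus>\<^bsub>B\<^esub> y') = pt x y \<oplus>\<^bsub>T\<^esub> pt x y'"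
  using tensor_rel.add_right[of x A y B y']
  by (simp add: pure_tensor_def tc_simps(2)[symmetric] tc_eq_iff keys_add_in diff_diff_add)

lemma pt_sm_l: "\<lbrakk>x \<in> carrier A; y \<in> carrier B\<rbrakk> \<Longrightarrow> pt (c \<odot>\<^bsub>A\<^esub> x) y = c \<odot>\<^bsub>T\<^esub> pt x y"
  using tensor_rel.smult_left[of x A y B c]
  by (simp add: pure_tensor_def tc_simps(4)[symmetric] tc_eq_iff)

lemma pt_sm_r: "\<lbrakk>x \<in> carrier A; y \<in> carrier B\<rbrakk> \<Longrightarrow> pt x (c \<odot>\<^bsub>B\<^esub> y) = c \<odot>\<^bsub>T\<^esub> pt x y"
  using tensor_rel.smult_right[of x A y B c]
  by (simp add: pure_tensor_def tc_simps(4)[symmetric] tc_eq_iff)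

lemma pt_zero [simp]: "x \<in> carrier A \<Longrightarrow> pt x \<zero>\<^bsub>B\<^esub> = \<zero>\<^bsub>T\<^esub>" "y \<in> carrier B \<Longrightarrow> pt \<zero>\<^bsub>A\<^esub> y = \<zero>\<^bsub>T\<^esub>"
proof -
  interpret T: k_algebra T by (rule T_alg)
  show "x \<in> carrier A \<Longrightarrow> pt x \<zero>\<^bsub>B\<^esub> = \<zero>\<^bsub>T\<^esub>" using pt_sm_r[of x "\<zero>\<^bsub>B\<^esub>" 0] by simp
  show "y \<in> carrier B \<Longrightarrow> pt \<zero>\<^bsub>A\<^esub> y = \<zero>\<^bsub>T\<^esub>" using pt_sm_l[of "\<zero>\<^bsub>A\<^esub>" y 0] by simp
qed

lemma tensor_induct [consumes 1, case_names zero pure add]: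
  assumes "t \<in> carrier T" "P \<zero>\<^bsub>T\<^esub>" "\<And>x y. \<lbrakk>x \<in> carrier A; y \<in> carrier B\<rbrakk> \<Longrightarrow> P (pt x y)"
    and a: "\<And>s t. \<lbrakk>s \<in> carrier T; t \<in> carrier T; P s; P t\<rbrakk> \<Longrightarrow> P (s \<oplus>\<^bsub>T\<^esub> t)"
  shows "P t"
proof -
  obtain p where p: "t = tc p" "keys p \<subseteq> X" using assms(1) by (auto simp: carrier_T)
  have "P (tc p)" using p(2)
  proof (induction rule: keys_induct)
    case (single u c)
    \<comment> \<open>The coefficient is absorbed into the left tensor factor, so the induction
      principle needs no case for scalar multiples.\<close>
    then show ?case using assms(3)[of "c \<odot>\<^bsub>A\<^esub> fst u" "snd u"] tc_single[of "fst u" "snd u" c] pt_sm_l[of "fst u" "snd u" c] by auto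
  qed (use assms in \<open>simp_all add: tc_simps\<close>)
  then show ?thesis using p by simp
qed

lemma tc_lin_ext:
  assumes "keys p \<subseteq> X"
  shows "tc p = lin_ext T (\<lambda>(x, y). pt x y) p"
proof -
  interpret T: k_algebra T by (rule T_alg)
  have *: "(\<lambda>(x, y). pt x y) \<in> X \<rightarrow> carrier T" by auto
  show ?thesis using assms
  proof (induction rule: keys_induct)
    case (single u c)
    then show ?case by (auto simp: tc_single T.lin_ext_single)
  next
    case (add p q)
    then show ?case using * by (simp add: tc_simps T.lin_ext_add[of _ X])
  qed (simp add: tc_simps)
qed

end

section \<open>Bilinear maps and the universal property of the tensor product\<close>

definition bilin :: "('k::field, 'a, 'x) module_scheme \<Rightarrow> ('k, 'b, 'y) module_scheme \<Rightarrow>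
    ('k, 'c, 'z) module_scheme \<Rightarrow> ('a \<times> 'b \<Rightarrow> 'c) \<Rightarrow> bool" where
  "bilin A B M \<beta> \<longleftrightarrow> (\<forall>y\<in>carrier B. k_linear A M (\<lambda>x. \<beta> (x, y))) \<and> (\<forall>x\<in>carrier A. k_linear B M (\<lambda>y. \<beta> (x, y)))"

lemma bilinI:
  assumes "\<And>x y. \<lbrakk>x \<in> carrier A; y \<in> carrier B\<rbrakk> \<Longrightarrow> \<beta> (x, y) \<in> carrier M"
    and "\<And>x x' y. \<lbrakk>x \<in> carrier A; x' \<in> carrier A; y \<in> carrier B\<rbrakk> \<Longrightarrow> \<beta> (x \<oplus>\<^bsub>A\<^esub> x', y) = \<beta> (x, y) \<oplus>\<^bsub>M\<^esub> \<beta> (x', y)"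
    and "\<And>x y y'. \<lbrakk>x \<in> carrier A; y \<in> carrier B; y' \<in> carrier B\<rbrakk> \<Longrightarrow> \<beta> (x, y \<oplus>\<^bsub>B\<^esub> y') = \<beta> (x, y) \<oplus>\<^bsub>M\<^esub> \<beta> (x, y')"
    and "\<And>c x y. \<lbrakk>x \<in> carrier A; y \<in> carrier B\<rbrakk> \<Longrightarrow> \<beta> (c \<odot>\<^bsub>A\<^esub> x, y) = c \<odot>\<^bsub>M\<^esub> \<beta> (x, y)"
    and "\<And>c x y. \<lbrakk>x \<in> carrier A; y \<in> carrier B\<rbrakk> \<Longrightarrow> \<beta> (x, c \<odot>\<^bsub>B\<^esub> y) = c \<odot>\<^bsub>M\<^esub> \<beta> (x, y)"
  shows "bilin A B M \<beta>"
  using assms by (auto simp: bilin_def intro!: k_linearI)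

lemma bilinD:
  assumes "bilin A B M \<beta>"
  shows "\<lbrakk>x \<in> carrier A; y \<in> carrier B\<rbrakk> \<Longrightarrow> \<beta> (x, y) \<in> carrier M"
    and "\<lbrakk>x \<in> carrier A; x' \<in> carrier A; y \<in> carrier B\<rbrakk> \<Longrightarrow> \<beta> (x \<oplus>\<^bsub>A\<^esub> x', y) = \<beta> (x, y) \<oplus>\<^bsub>M\<^esub> \<beta> (x', y)"
    and "\<lbrakk>x \<in> carrier A; y \<in> carrier B; y' \<in> carrier B\<rbrakk> \<Longrightarrow> \<beta> (x, y \<oplus>\<^bsub>B\<^esub> y') = \<beta> (x, y) \<oplus>\<^bsub>M\<^esub> \<beta> (x, y')"
    and "\<lbrakk>x \<in> carrier A; y \<in> carrier B\<rbrakk> \<Longrightarrow> \<beta> (c \<odot>\<^bsub>A\<^esub> x, y) = c \<odot>\<^bsub>M\<^esub> \<beta> (x, y)"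
    and "\<lbrakk>x \<in> carrier A; y \<in> carrier B\<rbrakk> \<Longrightarrow> \<beta> (x, c \<odot>\<^bsub>B\<^esub> y) = c \<odot>\<^bsub>M\<^esub> \<beta> (x, y)"
  using assms by (auto simp: bilin_def k_linear_def)

context tensor_alg
begin

lemma bilin_fun: "bilin A B M \<beta> \<Longrightarrow> \<beta> \<in> X \<rightarrow> carrier M"
  by (auto simp: bilinD)

text \<open>Each generating relation is exactly one instance of bilinearity. This is what makes
  \<open>tensor_lift\<close> independent of its representative.\<close>

lemma lin_ext_rel:
  assumes M: "k_algebra M" and \<beta>: "bilin A B M \<beta>" and p: "p \<in> R"
  shows "lin_ext M \<beta> p = \<zero>\<^bsub>M\<^esub>"
  using p
proof (induction rule: tensor_rel.induct)
  interpret M: k_algebra M by fact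
  note l = M.lin_ext_diff[OF bilin_fun[OF \<beta>]] M.lin_ext_single M.lin_ext_add[OF bilin_fun[OF \<beta>]]
    M.lin_ext_scal[OF bilin_fun[OF \<beta>]] keys_diff_in bilinD[OF \<beta>] rel_subset M.minus_eq M.r_neg
    M.a_ac M.r_neg1 M.r_neg2
  {
    case add_left
    then show ?case by (simp add: l)
  next
    case add_right
    then show ?case by (simp add: l)
  next
    case smult_left
    then show ?case by (simp add: l)
  next
    case smult_right
    then show ?case by (simp add: l)
  next
    case zero
    then show ?case by simp
  next
    case add
    then show ?case by (simp add: l)
  next
    case scal
    then show ?case by (simp add: l)
  }
qed

lemma k_linear_lin_ext_F:
  assumes M: "k_algebra M" and \<beta>: "bilin A B M \<beta>"
  shows "k_linear F M (lin_ext M \<beta>)"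
proof -
  interpret M: k_algebra M by fact
  show ?thesis
    by (intro k_linearI) (auto simp: M.lin_ext_add[OF bilin_fun[OF \<beta>]] M.lin_ext_scal[OF bilin_fun[OF \<beta>]]
      intro: M.lin_ext_closed[OF bilin_fun[OF \<beta>]])
qed

lemma tensor_lift_linear:
  assumes M: "k_algebra M" and \<beta>: "bilin A B M \<beta>"
  shows "k_linear T M (tensor_lift M \<beta>)"
proof -
  have e: "tensor_lift M \<beta> = (\<lambda>T. lin_ext M \<beta> (SOME t. t \<in> T))" by (simp add: fun_eq_iff tensor_lift_lin_ext)
  show ?thesis unfolding e tensor_def
    using Q.k_linear_factor(1)[OF M k_linear_lin_ext_F[OF assms] lin_ext_rel[OF assms]] by simp
qed

lemma tensor_lift_tc:
  assumes M: "k_algebra M" and \<beta>: "bilin A B M \<beta>" and p: "keys p \<subseteq> X"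
  shows "tensor_lift M \<beta> (tc p) = lin_ext M \<beta> p"
  using Q.k_linear_factor(2)[OF M k_linear_lin_ext_F[OF M \<beta>] lin_ext_rel[OF M \<beta>], of p] p
  by (simp add: tensor_lift_lin_ext tensor_class_def)

lemma tensor_lift_pt:
  assumes M: "k_algebra M" and \<beta>: "bilin A B M \<beta>" and "x \<in> carrier A" "y \<in> carrier B"
  shows "tensor_lift M \<beta> (pt x y) = \<beta> (x, y)"
proof -
  interpret M: k_algebra M by fact
  show ?thesis
    using tensor_lift_tc[OF M \<beta>, of "single (x, y) 1"] assms(3,4) bilinD(1)[OF \<beta>]
    by (simp add: pure_tensor_def M.lin_ext_single)
qed

lemma tensor_linear_eqI:
  assumes "k_algebra M" "k_linear T M f" "k_linear T M g"
    "\<And>x y. \<lbrakk>x \<in> carrier A; y \<in> carrier B\<rbrakk> \<Longrightarrow> f (pt x y) = g (pt x y)" "t \<in> carrier T"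
  shows "f t = g t"
  using assms(5)
proof (induction rule: tensor_induct)
  case zero
  then show ?case using k_linear_zero[OF T_alg assms(1)] assms(2,3) by metis
qed (simp_all add: assms k_linearD[OF assms(2)] k_linearD[OF assms(3)])

text \<open>Both sides of the multiplicativity condition are additive in each argument, so induction
  on the two arguments in turn leaves only pure tensors.\<close>

lemma tensor_alg_homI:
  assumes M: "k_algebra M" and f: "k_linear T M f"
    and m: "\<And>x y x' y'. \<lbrakk>x \<in> carrier A; y \<in> carrier B; x' \<in> carrier A; y' \<in> carrier B\<rbrakk> \<Longrightarrow>
      f (pt (x \<otimes>\<^bsub>A\<^esub> x') (y \<otimes>\<^bsub>B\<^esub> y')) = f (pt x y) \<otimes>\<^bsub>M\<^esub> f (pt x' y')"
    and o: "f (pt \<one>\<^bsub>A\<^esub> \<one>\<^bsub>B\<^esub>) = \<one>\<^bsub>M\<^esub>"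
  shows "alg_hom T M f"
proof (rule alg_homI)
  interpret M: k_algebra M by fact
  interpret T: k_algebra T by (rule T_alg)
  note fl = k_linearD[OF f]
  fix s t assume "s \<in> carrier T" and t: "t \<in> carrier T"
  then show "f (s \<otimes>\<^bsub>T\<^esub> t) = f s \<otimes>\<^bsub>M\<^esub> f t"
  proof (induction rule: tensor_induct)
    case zero
    then show ?case using fl k_linear_zero[OF T_alg M f] by simp
  next
    case (pure x y)
    show ?case using t
    proof (induction rule: tensor_induct)
      case zero
      then show ?case using fl pure k_linear_zero[OF T_alg M f] by simp
    qed (simp_all add: pure pt_mult m T.r_distr M.r_distr fl)
  qed (simp_all add: t T.l_distr M.l_distr fl)
qed (use assms in \<open>simp_all add: pt_one\<close>)

lemma tensor_lift_alg_hom: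
  assumes M: "k_algebra M" and \<beta>: "bilin A B M \<beta>"
    and "\<And>x y x' y'. \<lbrakk>x \<in> carrier A; y \<in> carrier B; x' \<in> carrier A; y' \<in> carrier B\<rbrakk> \<Longrightarrow>
      \<beta> (x \<otimes>\<^bsub>A\<^esub> x', y \<otimes>\<^bsub>B\<^esub> y') = \<beta> (x, y) \<otimes>\<^bsub>M\<^esub> \<beta> (x', y')"
    and "\<beta> (\<one>\<^bsub>A\<^esub>, \<one>\<^bsub>B\<^esub>) = \<one>\<^bsub>M\<^esub>"
  shows "alg_hom T M (tensor_lift M \<beta>)"
  by (intro tensor_alg_homI tensor_lift_linear M \<beta>) (simp_all add: tensor_lift_pt[OF M \<beta>] assms)

end

section \<open>Functoriality and associativity of the tensor product\<close>

lemma bilin_map: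
  assumes "k_algebra C" "k_algebra D" "k_linear A C f" "k_linear B D g"
  shows "bilin A B (tensor C D) (\<lambda>(x, y). pure_tensor C D (f x) (g y))"
proof -
  interpret tensor_alg C D using assms by (simp add: tensor_alg_def)
  show ?thesis
    using k_linearD[OF assms(3)] k_linearD[OF assms(4)]
    by (intro bilinI) (auto simp: pt_add_l pt_add_r pt_sm_l pt_sm_r)
qed

lemma tensor_map_linear:
  assumes "k_algebra A" "k_algebra B" "k_algebra C" "k_algebra D" "k_linear A C f" "k_linear B D g"
  shows "k_linear (tensor A B) (tensor C D) (tensor_map C D f g)"
    and "\<lbrakk>x \<in> carrier A; y \<in> carrier B\<rbrakk> \<Longrightarrow>
      tensor_map C D f g (pure_tensor A B x y) = pure_tensor C D (f x) (g y)"
proof -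
  interpret AB: tensor_alg A B using assms by (simp add: tensor_alg_def)
  interpret CD: tensor_alg C D using assms by (simp add: tensor_alg_def)
  note b = CD.T_alg bilin_map[OF assms(3-6)]
  show "k_linear (tensor A B) (tensor C D) (tensor_map C D f g)"
    unfolding tensor_map_def by (rule AB.tensor_lift_linear[OF b])
  show "\<lbrakk>x \<in> carrier A; y \<in> carrier B\<rbrakk> \<Longrightarrow>
      tensor_map C D f g (pure_tensor A B x y) = pure_tensor C D (f x) (g y)"
    unfolding tensor_map_def by (simp add: AB.tensor_lift_pt[OF b])
qed

lemma tensor_map_alg_hom:
  assumes "k_algebra A" "k_algebra B" "k_algebra C" "k_algebra D" "alg_hom A C f" "alg_hom B D g"
  shows "alg_hom (tensor A B) (tensor C D) (tensor_map C D f g)"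
proof -
  interpret AB: tensor_alg A B using assms by (simp add: tensor_alg_def)
  interpret CD: tensor_alg C D using assms by (simp add: tensor_alg_def)
  note t = tensor_map_linear[OF assms(1-4) alg_homD(1)[OF assms(5)] alg_homD(1)[OF assms(6)]]
  show ?thesis using t alg_homD[OF assms(5)] alg_homD[OF assms(6)]
    by (intro AB.tensor_alg_homI CD.T_alg) (auto simp: CD.pt_mult CD.pt_one)
qed

text \<open>Multiplicativity is recorded besides linearity so that the two sides of coassociativity
  become algebra homomorphisms, comparable on generators.\<close>

lemma tensor_assoc_alg_hom:
  assumes "k_algebra A" "k_algebra B" "k_algebra C"
  shows "alg_hom (tensor (tensor A B) C) (tensor A (tensor B C)) (tensor_assoc A B C)"
    and "\<lbrakk>x \<in> carrier A; y \<in> carrier B; z \<in> carrier C\<rbrakk> \<Longrightarrow>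
      tensor_assoc A B C (pure_tensor (tensor A B) C (pure_tensor A B x y) z) =
      pure_tensor A (tensor B C) x (pure_tensor B C y z)"
proof -
  interpret A: k_algebra A by fact
  interpret B: k_algebra B by fact
  interpret C: k_algebra C by fact
  interpret AB: tensor_alg A B using assms by (simp add: tensor_alg_def)
  interpret BC: tensor_alg B C using assms by (simp add: tensor_alg_def)
  interpret ABC: tensor_alg "tensor A B" C using assms AB.T_alg by (simp add: tensor_alg_def)
  interpret M': tensor_alg A "tensor B C" using assms BC.T_alg by (simp add: tensor_alg_def)
  let ?M = "tensor A (tensor B C)"
  let ?\<beta> = "\<lambda>z (x, y). pure_tensor A (tensor B C) x (pure_tensor B C y z)"
  let ?h = "\<lambda>z. tensor_lift ?M (?\<beta> z)"
  note M = M'.T_alg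
  interpret M: k_algebra ?M by (rule M)
  have \<beta>: "bilin A B ?M (?\<beta> z)" if "z \<in> carrier C" for z
    using that by (intro bilinI)
      (auto simp: M'.pt_add_l M'.pt_add_r M'.pt_sm_l M'.pt_sm_r BC.pt_add_l BC.pt_sm_l)
  note h = AB.tensor_lift_linear[OF M \<beta>]
  note hp = AB.tensor_lift_pt[OF M \<beta>]
  \<comment> \<open>For fixed \<open>z\<close> the inner lift is linear in \<open>t\<close>.
    Linearity in \<open>z\<close> is obtained by comparing two linear maps of \<open>t\<close> on
    pure tensors.\<close>
  have hadd: "?h (z \<oplus>\<^bsub>C\<^esub> z') t = ?h z t \<oplus>\<^bsub>?M\<^esub> ?h z' t"
    if z: "z \<in> carrier C" "z' \<in> carrier C" and t: "t \<in> carrier (tensor A B)" for z z' t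
  proof (rule AB.tensor_linear_eqI[OF M h _ _ t])
    show "k_linear (tensor A B) ?M (\<lambda>t. ?h z t \<oplus>\<^bsub>?M\<^esub> ?h z' t)"
      using k_linearD[OF h[OF z(1)]] k_linearD[OF h[OF z(2)]]
      by (intro k_linearI) (auto simp: M.a_ac M.sm_add_r)
  qed (use z in \<open>simp_all add: hp BC.pt_add_r M'.pt_add_r\<close>)
  have hsm: "?h (c \<odot>\<^bsub>C\<^esub> z) t = c \<odot>\<^bsub>?M\<^esub> ?h z t"
    if z: "z \<in> carrier C" and t: "t \<in> carrier (tensor A B)" for c z t
  proof (rule AB.tensor_linear_eqI[OF M h _ _ t])
    show "k_linear (tensor A B) ?M (\<lambda>t. c \<odot>\<^bsub>?M\<^esub> ?h z t)"
      using k_linearD[OF h[OF z]]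
      by (intro k_linearI) (auto simp: M.sm_add_r mult.commute)
  qed (use z in \<open>simp_all add: hp BC.pt_sm_r M'.pt_sm_r\<close>)
  have b: "bilin (tensor A B) C ?M (\<lambda>(u, z). ?h z u)"
    using k_linearD[OF h] by (intro bilinI) (auto simp: hadd hsm)
  have e: "tensor_assoc A B C = tensor_lift ?M (\<lambda>(u, z). ?h z u)"
    by (simp add: tensor_assoc_def)
  have ha: "alg_hom (tensor A B) ?M (?h \<one>\<^bsub>C\<^esub>)"
    by (intro AB.tensor_lift_alg_hom M \<beta>) (auto simp: M'.pt_mult BC.pt_mult M'.pt_one BC.pt_one)
  have hm: "?h (z \<otimes>\<^bsub>C\<^esub> z') (u \<otimes>\<^bsub>tensor A B\<^esub> u') = ?h z u \<otimes>\<^bsub>?M\<^esub> ?h z' u'"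
    if z: "z \<in> carrier C" "z' \<in> carrier C" and u: "u \<in> carrier (tensor A B)" and u': "u' \<in> carrier (tensor A B)"
    for z z' u u'
    using u
  proof (induction rule: AB.tensor_induct)
    note k = k_linearD[OF h[OF z(1)]] k_linearD[OF h[OF z(2)]] k_linearD[OF h[OF C.m_closed[OF z]]]
      k_linear_zero[OF AB.T_alg M h]
    {
      case zero
      then show ?case using z u' k by simp
    next
      case (pure x y)
      show ?case using u'
      proof (induction rule: AB.tensor_induct)
        case zero
        then show ?case using z u' k pure by simp
      qed (use z pure k in \<open>simp_all add: AB.pt_mult hp M'.pt_mult BC.pt_mult ABC.A.r_distr M.r_distr\<close>)
    next
      case (add s t)
      then show ?case using z u' k by (simp add: ABC.A.l_distr M.l_distr)
    }
  qed
  show "alg_hom (tensor (tensor A B) C) ?M (tensor_assoc A B C)"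
    unfolding e
  proof (intro ABC.tensor_lift_alg_hom M b)
    show "(case (\<one>\<^bsub>tensor A B\<^esub>, \<one>\<^bsub>C\<^esub>) of (u, z) \<Rightarrow> ?h z u) = \<one>\<^bsub>?M\<^esub>"
      using alg_homD(6)[OF ha] by simp
  qed (simp add: hm)
  show "\<lbrakk>x \<in> carrier A; y \<in> carrier B; z \<in> carrier C\<rbrakk> \<Longrightarrow>
      tensor_assoc A B C (pure_tensor (tensor A B) C (pure_tensor A B x y) z) =
      pure_tensor A (tensor B C) x (pure_tensor B C y z)"
    unfolding e by (simp add: ABC.tensor_lift_pt[OF M b] hp)
qed

subsection \<open>Dependence on the underlying algebra only\<close>

text \<open>A Hopf algebra record extends its algebra record by three fields which tensor products
  ignore. Truncation forgets these fields, and tensor products over records with equal truncation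
  are equal, not just isomorphic.\<close>

definition same_alg :: "('k::field, 'a, 'y) module_scheme \<Rightarrow> ('k, 'a, 'z) module_scheme \<Rightarrow> bool" where
  "same_alg A A' \<longleftrightarrow> module.truncate A = module.truncate A'"

lemma same_alg_iff: "same_alg A A' \<longleftrightarrow> carrier A = carrier A' \<and> mult A = mult A' \<and> \<one>\<^bsub>A\<^esub> = \<one>\<^bsub>A'\<^esub> \<and>
    \<zero>\<^bsub>A\<^esub> = \<zero>\<^bsub>A'\<^esub> \<and> add A = add A' \<and> smult A = smult A'"
  by (auto simp: same_alg_def module.defs)

lemma tensor_rel_mono:
  assumes "same_alg A A'" "same_alg B B'" "p \<in> tensor_rel A B"
  shows "p \<in> tensor_rel A' B'"
  using assms(3)
  by (induction rule: tensor_rel.induct)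
    (use assms(1,2) in \<open>auto simp: same_alg_iff intro: tensor_rel.intros
      tensor_rel.add_left[of _ A' _ _ B'] tensor_rel.add_right[of _ A' _ B'] tensor_rel.smult_left[of _ A' _ B'] tensor_rel.smult_right[of _ A' _ B']\<close>)

lemma same_alg_sym: "same_alg A B \<Longrightarrow> same_alg B A"
  by (simp add: same_alg_def)

lemma tensor_rel_cong: "same_alg A A' \<Longrightarrow> same_alg B B' \<Longrightarrow> tensor_rel A B = tensor_rel A' B'"
  by (intro equalityI subsetI) (auto intro: tensor_rel_mono same_alg_sym)

lemma tensor_free_cong: "same_alg A A' \<Longrightarrow> same_alg B B' \<Longrightarrow> tensor_free A B = tensor_free A' B'"
  by (auto simp: same_alg_iff tensor_free_def DirProd_def)

lemma tensor_cong: "same_alg A A' \<Longrightarrow> same_alg B B' \<Longrightarrow> tensor A B = tensor A' B'"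
  unfolding tensor_def by (simp add: tensor_rel_cong tensor_free_cong)

lemma tensor_class_cong: "same_alg A A' \<Longrightarrow> same_alg B B' \<Longrightarrow> tensor_class A B = tensor_class A' B'"
  unfolding tensor_class_def[abs_def] by (simp add: tensor_rel_cong tensor_free_cong)

lemma pure_tensor_cong: "same_alg A A' \<Longrightarrow> same_alg B B' \<Longrightarrow> pure_tensor A B = pure_tensor A' B'"
  unfolding pure_tensor_def[abs_def] by (simp add: tensor_class_cong)

lemma k_algebra_cong: 
  assumes "same_alg A A'" "k_algebra A" shows "k_algebra A'"
proof -
  interpret k_algebra A by fact
  have e: "carrier A' = carrier A" "mult A' = mult A" "\<one>\<^bsub>A'\<^esub> = \<one>\<^bsub>A\<^esub>"
    "\<zero>\<^bsub>A'\<^esub> = \<zero>\<^bsub>A\<^esub>" "add A' = add A" "smult A' = smult A"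
    using assms(1) by (auto simp: same_alg_iff)
  have "abelian_group A'"
    by (intro abelian_groupI) (auto simp: e a_ac intro: l_neg bexI[of _ "\<ominus>\<^bsub>A\<^esub> x" for x])
  then show ?thesis
    by (intro k_algebraI) (simp_all add: e m_assoc l_distr r_distr sm_add_l sm_add_r)
qed

subsection \<open>Complements\<close>

lemma vector_space_scal: "vector_space (scal :: 'k::field \<Rightarrow> ('a \<Rightarrow>\<^sub>0 'k) \<Rightarrow> 'a \<Rightarrow>\<^sub>0 'k)"
  by standard (simp_all add: scal_distrib)

context k_algebra
begin

text \<open>\<open>A\<close> is a quotient of the space of finitely supported functions on its
  elements, by the evaluation \<open>ev\<close>. There the preimage \<open>V\<close> of
  \<open>W\<close> has a projection \<open>g\<close>, and \<open>g\<close> descends because the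
  kernel of \<open>ev\<close> lies in \<open>V\<close>, where \<open>g\<close> is the
  identity.\<close>

lemma exists_retraction:
  assumes W: "submodule W base A"
  obtains P where "k_linear A A P" "\<And>x. x \<in> carrier A \<Longrightarrow> P x \<in> W" "\<And>x. x \<in> W \<Longrightarrow> P x = x"
proof -
  \<comment> \<open>The value zero outside the carrier makes \<open>ev\<close> total on the whole
    function space.\<close>
  let ?e = "\<lambda>x. if x \<in> carrier A then x else \<zero>"
  have e: "?e \<in> UNIV \<rightarrow> carrier A" by auto
  define ev where "ev p = lin_ext A ?e p" for p :: "'a \<Rightarrow>\<^sub>0 'k"
  have ev: "ev (p + q) = ev p \<oplus> ev q" "ev (p - q) = ev p \<ominus> ev q" "ev (c \<cdot> p) = c \<odot> ev p" "ev p \<in> carrier A" "ev 0 = \<zero>" for p q c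
    using e by (simp_all add: ev_def lin_ext_add[of _ UNIV] lin_ext_diff[of _ UNIV] lin_ext_scal[of _ UNIV] lin_ext_closed[of _ UNIV])
  have ev1: "x \<in> carrier A \<Longrightarrow> ev (single x c) = c \<odot> x" for x c
    by (simp add: ev_def lin_ext_single)
  define V where "V = {p. ev p \<in> W}"
  interpret vp: vector_space_pair "scal :: 'k \<Rightarrow> ('a \<Rightarrow>\<^sub>0 'k) \<Rightarrow> 'a \<Rightarrow>\<^sub>0 'k" "scal :: 'k \<Rightarrow> ('a \<Rightarrow>\<^sub>0 'k) \<Rightarrow> 'a \<Rightarrow>\<^sub>0 'k"
    by (simp add: vector_space_pair_def vector_space_scal)
  have "vp.vs1.subspace V"
    using W by (auto simp: vp.vs1.subspace_def V_def ev subm_iff)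
  \<comment> \<open>A linear left inverse of the identity restricted to \<open>V\<close> is a
    projection onto \<open>V\<close>.\<close>
  then obtain g where g: "g ` UNIV \<subseteq> V" "Vector_Spaces.linear scal scal g" "\<forall>v\<in>V. g v = v"
    using vp.linear_exists_left_inverse_on[OF vp.vs1.linear_ident, of V] by auto
  have gl: "g (p + q) = g p + g q" "g (c \<cdot> p) = c \<cdot> g p" for p q c
    using g(2) by (auto simp: linear_iff)
  have gd: "g (p - q) = g p - g q" for p q
    using gl(1)[of "p - q" q] by simp
  define P where "P x = ev (g (single x 1))" for x
  have PV: "ev (g p) \<in> W" for p using g(1) by (auto simp: V_def)
  have key: "ev (g p) = ev p" if "ev p \<in> W" for p
    using that g(3) by (auto simp: V_def)
  have W0: "\<zero> \<in> W" "W \<subseteq> carrier A" using W by (auto simp: subm_iff)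
  show ?thesis
  proof (rule that[of P])
    show "k_linear A A P"
    proof (rule k_linearI)
      fix x y assume xy: "x \<in> carrier A" "y \<in> carrier A"
      let ?s = "\<lambda>x. single x (1 :: 'k)"
      \<comment> \<open>The defect of additivity of the basis vectors is in the kernel of
        \<open>ev\<close>; \<open>g\<close> fixes it, so it stays in the kernel.\<close>
      have 0: "ev (?s (x \<oplus> y) - (?s x + ?s y)) = \<zero>" using xy by (simp add: ev ev1 diff_zero_iff)
      have "ev (g (?s (x \<oplus> y) - (?s x + ?s y))) = \<zero>" using key 0 W0 by simp
      then show "P (x \<oplus> y) = P x \<oplus> P y" by (simp add: P_def gd gl(1) ev diff_zero_iff)
    next
      fix c x assume x: "x \<in> carrier A"
      let ?s = "\<lambda>x. single x (1 :: 'k)"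
      have 0: "ev (?s (c \<odot> x) - c \<cdot> ?s x) = \<zero>" using x by (simp add: ev ev1 diff_zero_iff del: scal_simps)
      have "ev (g (?s (c \<odot> x) - c \<cdot> ?s x)) = \<zero>" using key[of "?s (c \<odot> x) - c \<cdot> ?s x"] 0 W0 by simp
      then show "P (c \<odot> x) = c \<odot> P x" by (simp add: P_def gd gl(2) ev diff_zero_iff del: scal_simps)
    qed (simp add: P_def ev)
    show "\<And>x. x \<in> carrier A \<Longrightarrow> P x \<in> W" by (simp add: P_def PV)
    show "\<And>x. x \<in> W \<Longrightarrow> P x = x" using W0 by (simp add: P_def key ev1 subset_iff)
  qed
qed

text \<open>Since \<open>D\<close> and \<open>S\<close> meet in zero, D + S is direct: take
  \<open>e\<close> on the \<open>D\<close>-component, ignore the \<open>S\<close>-component, and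
  extend along a retraction onto D + S.\<close>

lemma exists_functional:
  assumes D: "submodule D base A" and S: "submodule S base A" and DS: "D \<inter> S = {\<zero>}"
    and e: "k_linear A base e"
  obtains f where "k_linear A base f" "\<And>x. x \<in> S \<Longrightarrow> f x = 0" "\<And>x. x \<in> D \<Longrightarrow> f x = e x"
proof -
  define W where "W = {d \<oplus> s |d s. d \<in> D \<and> s \<in> S}"
  have DA: "D \<subseteq> carrier A" and SA: "S \<subseteq> carrier A" using D S by (auto simp: subm_iff)
  have D_diff: "x \<ominus> y \<in> D" if "x \<in> D" "y \<in> D" for x y
    using submoduleE(3,5)[OF D] that by (auto simp: minus_eq)
  have S_diff: "x \<ominus> y \<in> S" if "x \<in> S" "y \<in> S" for x y
    using submoduleE(3,5)[OF S] that by (auto simp: minus_eq)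
  have uniq: "d = d'" if "d \<in> D" "d' \<in> D" "s \<in> S" "s' \<in> S" "d \<oplus> s = d' \<oplus> s'" for d d' s s'
  proof -
    have c: "d \<in> carrier A" "d' \<in> carrier A" "s \<in> carrier A" "s' \<in> carrier A" using that DA SA by auto
    have "d = d' \<oplus> (s' \<ominus> s)"
      using c that(5)[symmetric] by (simp add: minus_eq a_assoc[symmetric]) (simp add: a_assoc r_neg)
    moreover have "d' \<oplus> (s' \<ominus> s) \<ominus> d' = s' \<ominus> s"
      using c by (simp add: minus_eq a_comm[of d'] a_assoc r_neg)
    ultimately have "d \<ominus> d' = s' \<ominus> s" by simp
    then have "d \<ominus> d' \<in> D \<inter> S" using D_diff[of d d'] S_diff[of s' s] that by simp
    then show ?thesis using DS diff_zero_iff c by auto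
  qed
  \<comment> \<open>\<open>uniq\<close> makes the \<open>D\<close>-component unique, so the
    description determines a value on D + S.\<close>
  define \<phi> where "\<phi> w = e (THE d. d \<in> D \<and> (\<exists>s\<in>S. w = d \<oplus> s))" for w
  have \<phi>: "\<phi> (d \<oplus> s) = e d" if "d \<in> D" "s \<in> S" for d s
  proof -
    have "(THE d'. d' \<in> D \<and> (\<exists>s'\<in>S. d \<oplus> s = d' \<oplus> s')) = d"
      by (rule the_equality) (use that uniq in blast)+
    then show ?thesis by (simp add: \<phi>_def)
  qed
  have W_add: "(d \<oplus> s) \<oplus> (d' \<oplus> s') = (d \<oplus> d') \<oplus> (s \<oplus> s')" if "d \<in> D" "d' \<in> D" "s \<in> S" "s' \<in> S" for d d' s s'
  proof -
    have "d \<in> carrier A" "d' \<in> carrier A" "s \<in> carrier A" "s' \<in> carrier A" using that DA SA by auto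
    then show ?thesis by (simp add: a_ac)
  qed
  have W_sm: "c \<odot> (d \<oplus> s) = c \<odot> d \<oplus> c \<odot> s" if "d \<in> D" "s \<in> S" for c d s
    using subsetD[OF DA that(1)] subsetD[OF SA that(2)] by (simp add: sm_add_r)
  note D' = D[unfolded subm_iff] and S' = S[unfolded subm_iff]
  have "submodule W base A" unfolding subm_iff
  proof (intro conjI ballI allI)
    show "W \<subseteq> carrier A" using DA SA by (auto simp: W_def)
    have "\<zero> = \<zero> \<oplus> \<zero>" by simp
    then show "\<zero> \<in> W" unfolding W_def using D' S' by blast
    show "x \<oplus> y \<in> W" if "x \<in> W" "y \<in> W" for x y
      using that D' S' unfolding W_def by clarify (metis W_add)
    show "c \<odot> x \<in> W" if "x \<in> W" for c x
      using that D' S' unfolding W_def by clarify (metis W_sm)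
  qed
  then obtain P where P: "k_linear A A P" "\<And>x. x \<in> carrier A \<Longrightarrow> P x \<in> W" "\<And>x. x \<in> W \<Longrightarrow> P x = x"
    by (rule exists_retraction) auto
  have eD: "e (d \<oplus> d') = e d + e d'" "e (c \<odot> d) = c * e d" if "d \<in> D" "d' \<in> D" for d d' c
    using k_linearD[OF e] that subsetD[OF DA] by simp_all
  have W\<phi>: "\<phi> (x \<oplus> y) = \<phi> x + \<phi> y" if xy: "x \<in> W" "y \<in> W" for x y
  proof -
    obtain d s d' s' where *: "x = d \<oplus> s" "y = d' \<oplus> s'" "d \<in> D" "s \<in> S" "d' \<in> D" "s' \<in> S"
      using xy by (auto simp: W_def)
    then have "x \<oplus> y = (d \<oplus> d') \<oplus> (s \<oplus> s')" by (simp add: W_add)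
    then show ?thesis using * D' S' by (simp add: \<phi> eD)
  qed
  have W\<phi>s: "\<phi> (c \<odot> x) = c * \<phi> x" if x: "x \<in> W" for c x
  proof -
    obtain d s where *: "x = d \<oplus> s" "d \<in> D" "s \<in> S"
      using x by (auto simp: W_def)
    then show ?thesis using D' S' by (simp add: \<phi> eD W_sm)
  qed
  show ?thesis
  proof (rule that[of "\<lambda>x. \<phi> (P x)"])
    show "k_linear A base (\<lambda>x. \<phi> (P x))"
      by (rule k_linearI) (use P W\<phi> W\<phi>s k_linearD[OF P(1)] in auto)
    show "\<phi> (P x) = 0" if "x \<in> S" for x
    proof -
      have x: "x = \<zero> \<oplus> x" using that SA by auto
      then have "x \<in> W" using that D' by (auto simp: W_def)
      moreover have "\<phi> x = e \<zero>" using \<phi>[of \<zero> x] x that D' by simp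
      moreover have "e \<zero> = 0" using k_linear_zero[OF k_algebra_axioms k_algebra_base e] by simp
      ultimately show ?thesis by (simp add: P)
    qed
    show "\<phi> (P x) = e x" if "x \<in> D" for x
    proof -
      have x: "x = x \<oplus> \<zero>" using that DA by auto
      then have "x \<in> W" using that S' unfolding W_def by blast
      moreover have "\<phi> x = e x" using \<phi>[of x \<zero>] x that S' by simp
      ultimately show ?thesis by (simp add: P)
    qed
  qed
qed

section \<open>Linear spans\<close>

definition lin_span :: "'a set \<Rightarrow> 'a set" where
  "lin_span Y = lin_ext A (\<lambda>x. x) ` {p. keys p \<subseteq> Y}"

lemma submodule_sp: "Y \<subseteq> carrier A \<Longrightarrow> submodule (lin_span Y) base A"
proof -
  assume Y: "Y \<subseteq> carrier A"
  then have *: "(\<lambda>x. x) \<in> Y \<rightarrow> carrier A" by auto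
  show ?thesis unfolding subm_iff
  proof (intro conjI ballI allI)
    show "lin_span Y \<subseteq> carrier A" using lin_ext_closed[OF *] by (auto simp: lin_span_def)
    show "\<zero> \<in> lin_span Y" unfolding lin_span_def by (rule image_eqI[of _ _ 0]) auto
    show "x \<oplus> y \<in> lin_span Y" if xy: "x \<in> lin_span Y" "y \<in> lin_span Y" for x y
    proof -
      obtain p q where "x = lin_ext A (\<lambda>x. x) p" "y = lin_ext A (\<lambda>x. x) q" "keys p \<subseteq> Y" "keys q \<subseteq> Y"
        using xy unfolding lin_span_def by blast
      then show ?thesis unfolding lin_span_def by (intro image_eqI[of _ _ "p + q"]) (simp_all add: lin_ext_add[OF *] keys_add_in)
    qed
    show "c \<odot> x \<in> lin_span Y" if x: "x \<in> lin_span Y" for c x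
    proof -
      obtain p where "x = lin_ext A (\<lambda>x. x) p" "keys p \<subseteq> Y"
        using x unfolding lin_span_def by blast
      then show ?thesis unfolding lin_span_def by (intro image_eqI[of _ _ "c \<cdot> p"]) (simp_all add: lin_ext_scal[OF *] keys_scal_in)
    qed
  qed
qed

lemma lin_span_incl: "Y \<subseteq> carrier A \<Longrightarrow> y \<in> Y \<Longrightarrow> y \<in> lin_span Y"
  unfolding lin_span_def by (rule image_eqI[of _ _ "single y 1"]) (auto simp: lin_ext_single subset_iff)

lemma lin_span_mono: "Y \<subseteq> Z \<Longrightarrow> lin_span Y \<subseteq> lin_span Z"
  by (auto simp: lin_span_def)

lemma lin_span_linear_image:
  assumes Y: "Y \<subseteq> carrier A" and f: "k_linear A A f" and W: "submodule W base A"
    and "\<And>y. y \<in> Y \<Longrightarrow> f y \<in> W" and x: "x \<in> lin_span Y"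
  shows "f x \<in> W"
proof -
  obtain p where p: "x = lin_ext A (\<lambda>x. x) p" "keys p \<subseteq> Y" using x by (auto simp: lin_span_def)
  have "f x = lin_ext A (\<lambda>u. f u) p"
    unfolding p(1) by (rule k_linear_lin_ext[OF k_algebra_axioms k_algebra_axioms f _ p(2)]) (use Y in auto)
  also have "\<dots> \<in> W" by (rule lin_ext_mem[OF W]) (use p assms(4) in auto)
  finally show ?thesis .
qed

lemma lin_span_least: "Y \<subseteq> W \<Longrightarrow> submodule W base A \<Longrightarrow> x \<in> lin_span Y \<Longrightarrow> x \<in> W"
  by (rule lin_span_linear_image[where f = "\<lambda>x. x" and Y = Y]) (auto intro!: k_linearI simp: subm_iff)

text \<open>The support of a coefficient function is already finite.\<close>

lemma lin_span_finite:
  assumes "x \<in> lin_span Y"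
  obtains Z where "finite Z" "Z \<subseteq> Y" "x \<in> lin_span Z"
proof -
  obtain p where "keys p \<subseteq> Y" "x = lin_ext A (\<lambda>x. x) p" using assms by (auto simp: lin_span_def)
  then show ?thesis by (intro that[of "keys p"]) (auto simp: lin_span_def)
qed

lemma lin_span_singleton: "y \<in> carrier A \<Longrightarrow> lin_span {y} = range (\<lambda>c. c \<odot> y)"
proof
  assume y: "y \<in> carrier A"
  have "submodule (range (\<lambda>c. c \<odot> y)) base A" unfolding subm_iff
  proof (intro conjI ballI allI)
    show "\<zero> \<in> range (\<lambda>c. c \<odot> y)" by (rule range_eqI[of _ _ 0]) (simp add: y)
    show "a \<oplus> b \<in> range (\<lambda>c. c \<odot> y)" if "a \<in> range (\<lambda>c. c \<odot> y)" "b \<in> range (\<lambda>c. c \<odot> y)" for a b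
      using that y by (auto simp: sm_add_l[symmetric])
  qed (use y in auto)
  moreover have "y \<in> range (\<lambda>c. c \<odot> y)" by (rule range_eqI[of _ _ 1]) (simp add: y)
  ultimately show "lin_span {y} \<subseteq> range (\<lambda>c. c \<odot> y)" using lin_span_least[of "{y}"] by auto
  show "range (\<lambda>c. c \<odot> y) \<subseteq> lin_span {y}"
    using submodule_sp[of "{y}"] lin_span_incl[of "{y}" y] y by (auto simp: subm_iff)
qed

end

subsection \<open>Hopf algebras generated by grouplike and skew primitive elements\<close>

text \<open>\<open>Gr\<close> holds grouplike generators only; it need not be closed under products.
  The formula for the antipode of a skew primitive x is forced: \<Delta> x = x \<otimes> h + g
  \<otimes> x requires S(x) h + S(g) x = 0, and S(h) is the inverse of h.\<close>

locale skew_generated = k_algebra H for H :: "('k::field, 'a) hopf" (structure) +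
  fixes Gr Sk :: "'a set"
  assumes comult_alg_hom: "alg_hom H (tensor H H) (comult H)"
    and counit_alg_hom: "alg_hom H base (counit H)"
    and antipode_lin: "k_linear H H (antipode H)"
    and antipode_mult: "\<lbrakk>x \<in> carrier H; y \<in> carrier H\<rbrakk> \<Longrightarrow> antipode H (x \<otimes> y) = antipode H y \<otimes> antipode H x"
    and antipode_one: "antipode H \<one> = \<one>"
    and Gr_in: "Gr \<subseteq> carrier H" and one_Gr: "\<one> \<in> Gr"
    and Gr_comult: "g \<in> Gr \<Longrightarrow> comult H g = pure_tensor H H g g"
    and Gr_counit: "g \<in> Gr \<Longrightarrow> counit H g = 1"
    and Gr_antipode: "g \<in> Gr \<Longrightarrow> antipode H g \<otimes> g = \<one>" "g \<in> Gr \<Longrightarrow> g \<otimes> antipode H g = \<one>"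
    and Sk_in: "Sk \<subseteq> carrier H"
    and Sk_ex: "x \<in> Sk \<Longrightarrow> \<exists>g\<in>Gr. \<exists>h\<in>Gr.
      comult H x = pure_tensor H H x h \<oplus>\<^bsub>tensor H H\<^esub> pure_tensor H H g x \<and>
      antipode H x = (- 1) \<odot> (antipode H g \<otimes> x \<otimes> antipode H h)"
    and Sk_counit: "x \<in> Sk \<Longrightarrow> counit H x = 0"
    and gen: "carrier H \<subseteq> subalg_generated H (Gr \<union> Sk)"
begin

sublocale HH: tensor_alg H H
  by standard

abbreviation "\<Delta> \<equiv> comult H"
abbreviation "\<epsilon> \<equiv> counit H"
abbreviation "S \<equiv> antipode H"
abbreviation "T \<equiv> tensor H H"
abbreviation "pt \<equiv> pure_tensor H H"

lemmas T_alg = HH.T_alg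
sublocale T: k_algebra T by (rule T_alg)

lemmas \<Delta> = alg_homD[OF comult_alg_hom]
lemmas \<epsilon> = alg_homD[OF counit_alg_hom, simplified]
lemmas S = k_linearD[OF antipode_lin]

lemma GS_in: "Gr \<union> Sk \<subseteq> carrier H"
  using Gr_in Sk_in by auto

lemma gen_induct:
  assumes "subalg H W" "\<And>g. g \<in> Gr \<Longrightarrow> g \<in> W" "\<And>x. x \<in> Sk \<Longrightarrow> x \<in> W" "x \<in> carrier H"
  shows "x \<in> W"
  using subalg_generated_least[of W "Gr \<union> Sk"] gen assms by blast

lemma gen_eqI:
  assumes "k_algebra M" "alg_hom H M f" "alg_hom H M f'" "\<And>g. g \<in> Gr \<Longrightarrow> f g = f' g"
    "\<And>x. x \<in> Sk \<Longrightarrow> f x = f' x" "x \<in> carrier H"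
  shows "f x = f' x"
  by (rule alg_hom_eqI[OF k_algebra_axioms assms(1-3) gen GS_in _ assms(6)]) (use assms in auto)

text \<open>Both sides are algebra homomorphisms in \<open>x\<close>. On a grouplike g both give g
  \<otimes> g \<otimes> g, on a skew primitive x both give x \<otimes> h \<otimes> h + g \<otimes> x
  \<otimes> h + g \<otimes> g \<otimes> x.\<close>

lemma coassociative:
  assumes "x \<in> carrier H"
  shows "tensor_assoc H H H (tensor_map T H \<Delta> id (\<Delta> x)) = tensor_map H T id \<Delta> (\<Delta> x)"
proof -
  note H = k_algebra_axioms
  interpret HT: tensor_alg H T by standard
  interpret TH: tensor_alg T H by standard
  have i: "alg_hom H H id" using alg_hom_id[OF H] by (simp add: id_def)
  note ass = tensor_assoc_alg_hom[OF H H H]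
  note m1 = tensor_map_alg_hom[OF H H T_alg H comult_alg_hom i]
  note m1p = tensor_map_linear(2)[OF H H T_alg H alg_homD(1)[OF comult_alg_hom] alg_homD(1)[OF i]]
  note m2 = tensor_map_alg_hom[OF H H H T_alg i comult_alg_hom]
  note m2p = tensor_map_linear(2)[OF H H H T_alg alg_homD(1)[OF i] alg_homD(1)[OF comult_alg_hom]]
  show ?thesis
  proof (rule gen_eqI[OF HT.T_alg _ _ _ _ assms])
    show "alg_hom H HT.T (\<lambda>x. tensor_assoc H H H (tensor_map T H \<Delta> id (\<Delta> x)))"
      by (rule alg_hom_comp[OF alg_hom_comp[OF comult_alg_hom m1] ass(1)])
    show "alg_hom H HT.T (\<lambda>x. tensor_map H T id \<Delta> (\<Delta> x))"
      by (rule alg_hom_comp[OF comult_alg_hom m2])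
  next
    fix g assume g: "g \<in> Gr"
    then have "g \<in> carrier H" using Gr_in by auto
    then show "tensor_assoc H H H (tensor_map T H \<Delta> id (\<Delta> g)) = tensor_map H T id \<Delta> (\<Delta> g)"
      by (simp add: Gr_comult[OF g] m1p m2p ass)
  next
    fix x assume x: "x \<in> Sk"
    then obtain g h where gh: "g \<in> Gr" "h \<in> Gr" "\<Delta> x = pt x h \<oplus>\<^bsub>T\<^esub> pt g x" using Sk_ex by blast
    have c: "g \<in> carrier H" "h \<in> carrier H" "x \<in> carrier H" using gh x Gr_in Sk_in by auto
    have "\<Delta> x \<in> carrier T" using c by (simp add: \<Delta>)
    then have m: "tensor_map T H \<Delta> id (\<Delta> x) = TH.pt (pt x h) h \<oplus>\<^bsub>TH.T\<^esub> TH.pt (pt g x) h \<oplus>\<^bsub>TH.T\<^esub> TH.pt (pt g g) x"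
      using c by (simp add: gh(3) alg_homD[OF m1] m1p Gr_comult[OF gh(1)] Gr_comult[OF gh(2)] TH.pt_add_l)
    interpret M: k_algebra HT.T by (rule HT.T_alg)
    interpret M1: k_algebra TH.T by (rule TH.T_alg)
    have "tensor_assoc H H H (tensor_map T H \<Delta> id (\<Delta> x)) =
      HT.pt x (pt h h) \<oplus>\<^bsub>HT.T\<^esub> HT.pt g (pt x h) \<oplus>\<^bsub>HT.T\<^esub> HT.pt g (pt g x)"
      unfolding m using c by (simp add: alg_homD[OF ass(1)] ass(2))
    moreover have "tensor_map H T id \<Delta> (\<Delta> x) =
      HT.pt x (pt h h) \<oplus>\<^bsub>HT.T\<^esub> (HT.pt g (pt x h) \<oplus>\<^bsub>HT.T\<^esub> HT.pt g (pt g x))"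
      using c by (simp add: gh(3) alg_homD[OF m2] m2p Gr_comult[OF gh(1)] Gr_comult[OF gh(2)] HT.pt_add_r)
    ultimately show "tensor_assoc H H H (tensor_map T H \<Delta> id (\<Delta> x)) = tensor_map H T id \<Delta> (\<Delta> x)"
      using c by (simp add: M.a_assoc)
  qed
qed

lemma bilin_functional_l: "k_linear H base f \<Longrightarrow> bilin H H H (\<lambda>(y, z). f y \<odot> z)"
  by (intro bilinI) (auto simp: k_linear_def sm_add_l sm_add_r mult_ac)

lemma bilin_functional_r: "k_linear H base f \<Longrightarrow> bilin H H H (\<lambda>(y, z). f z \<odot> y)"
  by (intro bilinI) (auto simp: k_linear_def sm_add_l sm_add_r mult_ac)

lemma counit_l:
  assumes "x \<in> carrier H"
  shows "tensor_lift H (\<lambda>(y, z). \<epsilon> y \<odot> z) (\<Delta> x) = x"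
proof -
  note H = k_algebra_axioms
  note b = bilin_functional_l[OF alg_homD(1)[OF counit_alg_hom]]
  \<comment> \<open>Because \<epsilon> is multiplicative with scalar values, the bilinear map
    \<epsilon>(y) z is multiplicative, so the counit axiom compares two homomorphisms.\<close>
  have l: "alg_hom T H (tensor_lift H (\<lambda>(y, z). \<epsilon> y \<odot> z))"
    by (intro HH.tensor_lift_alg_hom H b) (auto simp: \<epsilon> mult.commute)
  note lp = HH.tensor_lift_pt[OF H b]
  show ?thesis
  proof (rule gen_eqI[OF H alg_hom_comp[OF comult_alg_hom l] alg_hom_id[OF H] _ _ assms])
    fix g assume "g \<in> Gr"
    then show "tensor_lift H (\<lambda>(y, z). \<epsilon> y \<odot> z) (\<Delta> g) = g" using Gr_in by (auto simp: Gr_comult lp Gr_counit)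
  next
    fix x assume x: "x \<in> Sk"
    then obtain g h where gh: "g \<in> Gr" "h \<in> Gr" "\<Delta> x = pt x h \<oplus>\<^bsub>T\<^esub> pt g x" using Sk_ex by blast
    have c: "g \<in> carrier H" "h \<in> carrier H" "x \<in> carrier H" using gh x Gr_in Sk_in by auto
    then show "tensor_lift H (\<lambda>(y, z). \<epsilon> y \<odot> z) (\<Delta> x) = x"
      by (simp add: gh(3) alg_homD[OF l] lp Sk_counit x Gr_counit gh(1))
  qed
qed

lemma counit_r:
  assumes "x \<in> carrier H"
  shows "tensor_lift H (\<lambda>(y, z). \<epsilon> z \<odot> y) (\<Delta> x) = x"
proof -
  note H = k_algebra_axioms
  note b = bilin_functional_r[OF alg_homD(1)[OF counit_alg_hom]]
  have l: "alg_hom T H (tensor_lift H (\<lambda>(y, z). \<epsilon> z \<odot> y))"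
    by (intro HH.tensor_lift_alg_hom H b) (auto simp: \<epsilon> mult.commute)
  note lp = HH.tensor_lift_pt[OF H b]
  show ?thesis
  proof (rule gen_eqI[OF H alg_hom_comp[OF comult_alg_hom l] alg_hom_id[OF H] _ _ assms])
    fix g assume "g \<in> Gr"
    then show "tensor_lift H (\<lambda>(y, z). \<epsilon> z \<odot> y) (\<Delta> g) = g" using Gr_in by (auto simp: Gr_comult lp Gr_counit)
  next
    fix x assume x: "x \<in> Sk"
    then obtain g h where gh: "g \<in> Gr" "h \<in> Gr" "\<Delta> x = pt x h \<oplus>\<^bsub>T\<^esub> pt g x" using Sk_ex by blast
    have c: "g \<in> carrier H" "h \<in> carrier H" "x \<in> carrier H" using gh x Gr_in Sk_in by auto
    then show "tensor_lift H (\<lambda>(y, z). \<epsilon> z \<odot> y) (\<Delta> x) = x"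
      by (simp add: gh(3) alg_homD[OF l] lp Sk_counit x Gr_counit gh(2))
  qed
qed

lemma bilin_S_l: "bilin H H H (\<lambda>(y, z). S y \<otimes> z)"
  by (intro bilinI) (auto simp: S l_distr r_distr)

lemma bilin_S_r: "bilin H H H (\<lambda>(y, z). y \<otimes> S z)"
  by (intro bilinI) (auto simp: S l_distr r_distr)

abbreviation "\<mu>l \<equiv> tensor_lift H (\<lambda>(y, z). S y \<otimes> z)"
abbreviation "\<mu>r \<equiv> tensor_lift H (\<lambda>(y, z). y \<otimes> S z)"

lemmas \<mu>l_lin = HH.tensor_lift_linear[OF k_algebra_axioms bilin_S_l]
lemmas \<mu>r_lin = HH.tensor_lift_linear[OF k_algebra_axioms bilin_S_r]
lemmas \<mu>l_pt = HH.tensor_lift_pt[OF k_algebra_axioms bilin_S_l, simplified]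
lemmas \<mu>r_pt = HH.tensor_lift_pt[OF k_algebra_axioms bilin_S_r, simplified]
lemmas \<mu>l_add = k_linearD[OF \<mu>l_lin]
lemmas \<mu>r_add = k_linearD[OF \<mu>r_lin]
lemmas \<mu>l_zero = k_linear_zero[OF T_alg k_algebra_axioms \<mu>l_lin]
lemmas \<mu>r_zero = k_linear_zero[OF T_alg k_algebra_axioms \<mu>r_lin]

text \<open>The antipode reverses products, so \<open>\<mu>l\<close> is not a homomorphism. On t = x
  \<otimes> y the value is S(x) \<mu>l(s) y, and a scalar in the middle can be pulled out; this
  suffices for closure of the antipode axiom under products.\<close>

lemma \<mu>l_mult:
  assumes c: "s \<in> carrier T" "t \<in> carrier T" and e: "\<mu>l s = c \<odot> \<one>"
  shows "\<mu>l (s \<otimes>\<^bsub>T\<^esub> t) = c \<odot> \<mu>l t"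
  using c(2)
proof (induction rule: HH.tensor_induct)
  case zero
  then show ?case by (simp add: c \<mu>l_zero)
next
  case (pure x y)
  have "\<mu>l (s \<otimes>\<^bsub>T\<^esub> pt x y) = S x \<otimes> \<mu>l s \<otimes> y" using c(1)
  proof (induction rule: HH.tensor_induct)
    case zero
    then show ?case by (simp add: pure S \<mu>l_zero)
  next
    case (pure a b)
    then show ?case using \<open>x \<in> carrier H\<close> \<open>y \<in> carrier H\<close>
      by (simp add: HH.pt_mult \<mu>l_pt antipode_mult S m_assoc)
  next
    case (add s t)
    then show ?case using pure
      by (simp add: T.l_distr \<mu>l_add S l_distr r_distr)
  qed
  then show ?case using pure by (simp add: e S \<mu>l_pt)
next
  case (add s' t')
  then show ?case by (simp add: c T.r_distr \<mu>l_add sm_add_r)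
qed

text \<open>The mirror image: now the value of the right factor \<open>t\<close> ends up in the
  middle, so that one has to be scalar.\<close>

lemma \<mu>r_mult:
  assumes c: "s \<in> carrier T" "t \<in> carrier T" and e: "\<mu>r t = c \<odot> \<one>"
  shows "\<mu>r (s \<otimes>\<^bsub>T\<^esub> t) = c \<odot> \<mu>r s"
  using c(1)
proof (induction rule: HH.tensor_induct)
  case zero
  then show ?case by (simp add: c \<mu>r_zero)
next
  case (pure x y)
  have "\<mu>r (pt x y \<otimes>\<^bsub>T\<^esub> t) = x \<otimes> \<mu>r t \<otimes> S y" using c(2)
  proof (induction rule: HH.tensor_induct)
    case zero
    then show ?case by (simp add: pure S \<mu>r_zero)
  next
    case (pure a b)
    then show ?case using \<open>x \<in> carrier H\<close> \<open>y \<in> carrier H\<close>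
      by (simp add: HH.pt_mult \<mu>r_pt antipode_mult S m_assoc)
  next
    case (add s t)
    then show ?case using pure
      by (simp add: T.r_distr \<mu>r_add S l_distr r_distr)
  qed
  then show ?case using pure by (simp add: e S \<mu>r_pt)
next
  case (add s' t')
  then show ?case by (simp add: c T.l_distr \<mu>r_add sm_add_r)
qed

lemma antipode_convolution:
  assumes "x \<in> carrier H"
  shows "\<mu>l (\<Delta> x) = \<epsilon> x \<odot> \<one>" "\<mu>r (\<Delta> x) = \<epsilon> x \<odot> \<one>"
proof -
  let ?W = "{x \<in> carrier H. \<mu>l (\<Delta> x) = \<epsilon> x \<odot> \<one> \<and> \<mu>r (\<Delta> x) = \<epsilon> x \<odot> \<one>}"
  have "subalg H ?W" unfolding subalg_iff
  proof (intro conjI ballI allI)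
    show "\<one> \<in> ?W" using Gr_comult[OF one_Gr] by (simp add: \<mu>l_pt \<mu>r_pt antipode_one \<epsilon>)
    show "x \<oplus> y \<in> ?W" if "x \<in> ?W" "y \<in> ?W" for x y
      using that by (simp add: \<Delta> \<epsilon> \<mu>l_add \<mu>r_add sm_add_l)
    show "c \<odot> x \<in> ?W" if "x \<in> ?W" for c x
      using that by (simp add: \<Delta> \<epsilon> \<mu>l_add \<mu>r_add)
    show "x \<otimes> y \<in> ?W" if "x \<in> ?W" "y \<in> ?W" for x y
      using that \<mu>l_mult[of "\<Delta> x" "\<Delta> y" "\<epsilon> x"] \<mu>r_mult[of "\<Delta> x" "\<Delta> y" "\<epsilon> y"]
      by (simp add: \<Delta> \<epsilon> mult.commute)
  qed auto
  moreover have "g \<in> ?W" if "g \<in> Gr" for g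
    using that Gr_in by (auto simp: Gr_comult \<mu>l_pt \<mu>r_pt Gr_antipode Gr_counit)
  moreover have "x \<in> ?W" if x: "x \<in> Sk" for x
  proof -
    obtain g h where gh: "g \<in> Gr" "h \<in> Gr" "\<Delta> x = pt x h \<oplus>\<^bsub>T\<^esub> pt g x"
      "S x = (- 1) \<odot> (S g \<otimes> x \<otimes> S h)" using Sk_ex[OF x] by blast
    have c: "g \<in> carrier H" "h \<in> carrier H" "x \<in> carrier H" using gh x Gr_in Sk_in by auto
    \<comment> \<open>With these cancellations the two terms of each convolution are negatives of
      each other, as the counit of a skew primitive requires.\<close>
    have "S g \<otimes> x \<otimes> S h \<otimes> h = S g \<otimes> x" using c by (simp add: S m_assoc Gr_antipode gh)
    moreover have "g \<otimes> (S g \<otimes> x \<otimes> S h) = x \<otimes> S h"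
      using c by (simp add: S m_assoc[symmetric] Gr_antipode gh)
    ultimately show ?thesis
      using c S(1)[OF c(1)] S(1)[OF c(2)]
        l_neg[of "S g \<otimes> x"] r_neg[of "x \<otimes> S h"] uminus_sm[of "S g \<otimes> x"] uminus_sm[of "x \<otimes> S h"]
      by (simp add: gh(3,4) \<mu>l_add \<mu>r_add \<mu>l_pt \<mu>r_pt Sk_counit[OF x])
  qed
  ultimately have "x \<in> ?W" using gen_induct assms by blast
  then show "\<mu>l (\<Delta> x) = \<epsilon> x \<odot> \<one>" "\<mu>r (\<Delta> x) = \<epsilon> x \<odot> \<one>" by auto
qed

theorem hopf_algebra: "hopf_algebra H"
proof -
  have "coalgebra H"
    using comult_alg_hom counit_alg_hom coassociative counit_l counit_r
    by (simp add: coalgebra_def coalgebra_axioms_def alg_hom_def module_axioms)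
  then show ?thesis
    using comult_alg_hom counit_alg_hom antipode_convolution antipode_lin k_algebra_axioms
    by (simp add: hopf_algebra_def hopf_algebra_axioms_def alg_hom_def)
qed

subsection \<open>Pointedness\<close>

text \<open>The index counts skew primitive factors of an expression. It is a relation, since one
  element may be a product in several ways with different counts.\<close>

inductive mon :: "nat \<Rightarrow> 'a \<Rightarrow> bool" where
  one: "mon 0 \<one>"
| grouplike: "\<lbrakk>g \<in> Gr; mon n m\<rbrakk> \<Longrightarrow> mon n (g \<otimes> m)"
| skew: "\<lbrakk>x \<in> Sk; mon n m\<rbrakk> \<Longrightarrow> mon (Suc n) (x \<otimes> m)"

lemma mon_in: "mon n m \<Longrightarrow> m \<in> carrier H"
  by (induction rule: mon.induct) (use Gr_in Sk_in in auto)

lemma mon_0_grouplike: "mon n m \<Longrightarrow> n = 0 \<Longrightarrow> \<Delta> m = pt m m \<and> \<epsilon> m = 1"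
proof (induction rule: mon.induct)
  case one
  then show ?case using Gr_comult[OF one_Gr] by (simp add: \<epsilon>)
next
  case (grouplike g n m)
  then show ?case using Gr_in mon_in by (auto simp: \<Delta> \<epsilon> Gr_comult Gr_counit HH.pt_mult subset_iff)
qed auto

text \<open>The elements whose left multiplication preserves the span form a subalgebra containing
  the generators, hence everything; then apply this to the unit.\<close>

lemma lin_span_mon: 
  assumes "x \<in> carrier H"
  shows "x \<in> lin_span {m. \<exists>n. mon n m}"
proof -
  let ?M = "{m. \<exists>n. mon n m}"
  have MA: "?M \<subseteq> carrier H" using mon_in by auto
  note sM = submodule_sp[OF MA]
  note sM' = sM[unfolded subm_iff]
  let ?W = "{x \<in> carrier H. \<forall>y\<in>lin_span ?M. x \<otimes> y \<in> lin_span ?M}"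
  have "subalg H ?W" unfolding subalg_iff
    using sM' by (auto simp: l_distr m_assoc subset_iff)
  moreover have gens: "x \<in> ?W" if x: "x \<in> carrier H" and xm: "\<And>n m. mon n m \<Longrightarrow> \<exists>n. mon n (x \<otimes> m)" for x
  proof -
    have "x \<otimes> y \<in> lin_span ?M" if y: "y \<in> lin_span ?M" for y
    proof (rule lin_span_linear_image[OF MA _ sM _ y])
      show "k_linear H H (\<lambda>y. x \<otimes> y)" by (rule k_linearI) (use x in \<open>auto simp: r_distr\<close>)
      show "x \<otimes> m \<in> lin_span ?M" if "m \<in> ?M" for m
        using that xm by (auto intro: lin_span_incl[OF MA])
    qed
    then show ?thesis using x by auto
  qed
  moreover have "g \<in> ?W" if "g \<in> Gr" for g
    by (rule gens) (use that Gr_in mon.grouplike in blast)+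
  moreover have "x \<in> ?W" if "x \<in> Sk" for x
    by (rule gens) (use that Sk_in mon.skew in blast)+
  ultimately have "x \<in> ?W" using gen_induct assms by blast
  then have "x \<otimes> \<one> \<in> lin_span ?M" using lin_span_incl[OF MA] mon.one by blast
  then show ?thesis using assms by simp
qed

text \<open>Sums of pure tensors of monomials with total count n. Scalars are absent because
  coproducts of the generators have coefficients 1.\<close>

inductive ts :: "nat \<Rightarrow> (('a \<times> 'a) \<Rightarrow>\<^sub>0 'k) set \<Rightarrow> bool" where
  pure: "\<lbrakk>mon i u; mon j v\<rbrakk> \<Longrightarrow> ts (i + j) (pt u v)"
| add: "\<lbrakk>ts n s; ts n t\<rbrakk> \<Longrightarrow> ts n (s \<oplus>\<^bsub>T\<^esub> t)"

lemma ts_in: "ts n t \<Longrightarrow> t \<in> carrier T"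
  by (induction rule: ts.induct) (auto simp: mon_in)

lemma ts_grouplike: "ts n t \<Longrightarrow> g \<in> Gr \<Longrightarrow> ts n (pt g g \<otimes>\<^bsub>T\<^esub> t)"
proof (induction rule: ts.induct)
  case (pure i u j v)
  then have "g \<in> carrier H" using Gr_in by auto
  then show ?case using pure by (simp add: HH.pt_mult mon_in ts.pure mon.grouplike)
next
  case (add n s t)
  then have "g \<in> carrier H" using Gr_in by auto
  then show ?case using add by (simp add: T.r_distr ts_in ts.add)
qed

lemma ts_skew: "ts n t \<Longrightarrow> x \<in> Sk \<Longrightarrow> g \<in> Gr \<Longrightarrow> h \<in> Gr \<Longrightarrow> ts (Suc n) ((pt x h \<oplus>\<^bsub>T\<^esub> pt g x) \<otimes>\<^bsub>T\<^esub> t)"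
proof (induction rule: ts.induct)
  case (pure i u j v)
  then have c: "g \<in> carrier H" "h \<in> carrier H" "x \<in> carrier H" using Gr_in Sk_in by auto
  have "ts (Suc i + j) (pt (x \<otimes> u) (h \<otimes> v))" "ts (i + Suc j) (pt (g \<otimes> u) (x \<otimes> v))"
    using pure by (blast intro: ts.pure mon.intros)+
  then show ?case using c pure by (simp add: HH.pt_mult mon_in T.l_distr ts.add)
next
  case (add n s t)
  then have "g \<in> carrier H" "h \<in> carrier H" "x \<in> carrier H" using Gr_in Sk_in by auto
  then show ?case using add by (simp add: T.r_distr ts_in ts.add)
qed

text \<open>Each grouplike factor contributes to both legs without changing the count, and each skew
  primitive factor lands in exactly one leg of each term.\<close>

lemma ts_comult: "mon n m \<Longrightarrow> ts n (\<Delta> m)"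
proof (induction rule: mon.induct)
  case one
  show ?case using Gr_comult[OF one_Gr] ts.pure[OF mon.one mon.one] by simp
next
  case (grouplike g n m)
  then have "g \<in> carrier H" using Gr_in by auto
  then show ?case using grouplike by (simp add: \<Delta> mon_in Gr_comult ts_grouplike)
next
  case (skew x n m)
  obtain g h where gh: "g \<in> Gr" "h \<in> Gr" "\<Delta> x = pt x h \<oplus>\<^bsub>T\<^esub> pt g x" using Sk_ex[OF skew(1)] by blast
  have "x \<in> carrier H" using skew Sk_in by auto
  then show ?case using skew ts_skew[OF skew(3,1) gh(1,2)] by (simp add: \<Delta> mon_in gh(3))
qed

text \<open>The strict bound makes \<open>F 0\<close> the span of the empty set, hence zero; this is
  where the descent ends.\<close>

abbreviation "F n \<equiv> lin_span {m. \<exists>i<n. mon i m}"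

lemma F_sub: "submodule (F n) base H"
  by (rule submodule_sp) (auto simp: mon_in)

context
  fixes f assumes f: "k_linear H base f"
begin

abbreviation "lf \<equiv> tensor_lift H (\<lambda>(y, z). f z \<odot> y)"

lemmas lf_lin = HH.tensor_lift_linear[OF k_algebra_axioms bilin_functional_r[OF f]]
lemmas lf_pt = HH.tensor_lift_pt[OF k_algebra_axioms bilin_functional_r[OF f], simplified]

lemma lf_comult_lin: "k_linear H H (\<lambda>x. lf (\<Delta> x))"
  by (rule k_linearI) (auto simp: \<Delta> k_linearD[OF lf_lin])

text \<open>In a term u \<otimes> v of counts i and j, either j = 0 and \<open>f\<close> kills v, or
  i < i + j and a multiple of u remains.\<close>

lemma lf_ts: "ts n t \<Longrightarrow> (\<And>m. mon 0 m \<Longrightarrow> f m = 0) \<Longrightarrow> lf t \<in> F n"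
proof (induction rule: ts.induct)
  case (pure i u j v)
  note F' = F_sub[of "i + j", unfolded subm_iff]
  show ?case
  proof (cases "j = 0")
    case True
    then show ?thesis using pure F' by (simp add: lf_pt mon_in)
  next
    case False
    then have "i < i + j" by simp
    then have "u \<in> F (i + j)" using pure(1) mon_in by (intro lin_span_incl) blast+
    then show ?thesis using pure F' by (simp add: lf_pt mon_in)
  qed
next
  case (add n s t)
  then show ?case using F_sub[of n, unfolded subm_iff] by (simp add: k_linearD[OF lf_lin] ts_in)
qed

lemma lf_F: "x \<in> F (Suc n) \<Longrightarrow> (\<And>m. mon 0 m \<Longrightarrow> f m = 0) \<Longrightarrow> lf (\<Delta> x) \<in> F n"
proof (rule lin_span_linear_image[OF _ lf_comult_lin F_sub])
  fix m assume f0: "\<And>m. mon 0 m \<Longrightarrow> f m = 0" and "m \<in> {m. \<exists>i<Suc n. mon i m}"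
  then obtain i where i: "i < Suc n" "mon i m" by auto
  then have "lf (\<Delta> m) \<in> F i" using lf_ts ts_comult f0 by blast
  moreover have "F i \<subseteq> F n"
  proof (rule lin_span_mono, rule subsetI)
    fix x assume "x \<in> {m. \<exists>j<i. mon j m}"
    then obtain j where "j < i" "mon j x" by auto
    moreover have "j < n" using \<open>j < i\<close> i(1) by simp
    ultimately show "x \<in> {m. \<exists>j<n. mon j m}" by blast
  qed
  ultimately show "lf (\<Delta> m) \<in> F n" by auto
qed (auto simp: mon_in)

text \<open>The coproduct of x has a representative with both legs in \<open>D\<close>, where
  \<open>f\<close> and the counit agree, so the counit axiom applies.\<close>

lemma lf_subcoalgebra:
  assumes D: "subcoalgebra H D" and fD: "\<And>x. x \<in> D \<Longrightarrow> f x = \<epsilon> x" and x: "x \<in> D"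
  shows "lf (\<Delta> x) = x"
proof -
  have D': "D \<subseteq> carrier H" using D by (auto simp: subcoalgebra_def subm_iff)
  obtain t where t: "keys t \<subseteq> D \<times> D" "\<Delta> x = tensor_class H H t"
    using D x by (auto simp: subcoalgebra_def sub_tensor_def)
  have k: "keys t \<subseteq> carrier H \<times> carrier H" using t(1) D' by auto
  note b = bilin_functional_r[OF f] bilin_functional_r[OF alg_homD(1)[OF counit_alg_hom]]
  have "lf (\<Delta> x) = lin_ext H (\<lambda>(y, z). f z \<odot> y) t"
    unfolding t by (rule HH.tensor_lift_tc[OF k_algebra_axioms b(1) k])
  also have "\<dots> = lin_ext H (\<lambda>(y, z). \<epsilon> z \<odot> y) t"
    unfolding lin_ext_def by (rule finsum_cong') (use t D' in \<open>auto simp: fD subset_iff \<epsilon>\<close>)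
  also have "\<dots> = tensor_lift H (\<lambda>(y, z). \<epsilon> z \<odot> y) (\<Delta> x)"
    unfolding t by (rule HH.tensor_lift_tc[OF k_algebra_axioms b(2) k, symmetric])
  also have "\<dots> = x" using counit_r x D' by auto
  finally show ?thesis .
qed

end

lemma grouplike_in_subcoalgebra:
  assumes D: "subcoalgebra H D" and D0: "D \<noteq> {\<zero>}"
  obtains g where "mon 0 g" "g \<in> D" "g \<noteq> \<zero>"
proof -
  have Dm: "submodule D base H" using D by (simp add: subcoalgebra_def)
  note D' = Dm[unfolded subm_iff]
  let ?M0 = "{m. mon 0 m}"
  have M0: "?M0 \<subseteq> carrier H" using mon_in by auto
  have spz: "\<zero> \<in> D \<inter> lin_span Y" if "Y \<subseteq> carrier H" for Y using submodule_sp[OF that] D' by (simp add: subm_iff)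
  have "D \<inter> lin_span ?M0 \<noteq> {\<zero>}"
  proof
    assume e: "D \<inter> lin_span ?M0 = {\<zero>}"
    obtain f where f: "k_linear H base f" "\<And>x. x \<in> lin_span ?M0 \<Longrightarrow> f x = 0" "\<And>x. x \<in> D \<Longrightarrow> f x = \<epsilon> x"
      using exists_functional[OF Dm submodule_sp[OF M0] e alg_homD(1)[OF counit_alg_hom]] by metis
    have f0: "f m = 0" if "mon 0 m" for m using f(2) lin_span_incl[OF M0] that by auto
    have "x = \<zero>" if "x \<in> D" "x \<in> F n" for x n
      using that
    proof (induction n)
      \<comment> \<open>\<open>F 0\<close> is spanned by the empty set, so it is zero.\<close>
      case 0
      then show ?case using lin_span_least[of "{}" "{\<zero>}" x] by (auto simp: subm_iff)
    next
      case (Suc n)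
      have "lf f (\<Delta> x) \<in> F n" by (rule lf_F[OF f(1) Suc.prems(2)]) (rule f0)
      then show ?case using lf_subcoalgebra[OF f(1) D f(3) Suc.prems(1)] Suc by simp
    qed
    moreover have "\<exists>n. x \<in> F n" if x: "x \<in> carrier H" for x
    proof -
      obtain Z where Z: "finite Z" "Z \<subseteq> {m. \<exists>n. mon n m}" "x \<in> lin_span Z" by (rule lin_span_finite[OF lin_span_mon[OF x]])
      then have "\<forall>m\<in>Z. \<exists>n. mon n m" by auto
      \<comment> \<open>One count is fixed for each of the finitely many monomials in
        \<open>Z\<close>; their maximum puts x into a step of the filtration.\<close>
      from bchoice[OF this] obtain d where d: "\<And>m. m \<in> Z \<Longrightarrow> mon (d m) m" by auto
      have "Z \<subseteq> {m. \<exists>i<Suc (Max (d ` Z)). mon i m}"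
      proof
        fix m assume "m \<in> Z"
        then have "d m < Suc (Max (d ` Z))" using Z(1) by (simp add: le_imp_less_Suc)
        then show "m \<in> {m. \<exists>i<Suc (Max (d ` Z)). mon i m}" using d \<open>m \<in> Z\<close> by blast
      qed
      then have "x \<in> F (Suc (Max (d ` Z)))" by (rule subsetD[OF lin_span_mono Z(3)])
      then show ?thesis ..
    qed
    ultimately have "x = \<zero>" if "x \<in> D" for x using that D' by (metis subsetD)
    then have "D \<subseteq> {\<zero>}" by auto
    then show False using D0 D' by auto
  qed
  then obtain x where "x \<in> D" "x \<in> lin_span ?M0" "x \<noteq> \<zero>" using spz[OF M0] by auto
  then obtain Z where Z: "finite Z" "Z \<subseteq> ?M0" "x \<in> lin_span Z" "x \<in> D" "x \<noteq> \<zero>"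
    by (metis lin_span_finite)
  \<comment> \<open>A nonzero element of the intersection uses finitely many grouplike elements, so
    a set \<open>Y\<close> of least cardinality exists.\<close>
  then have "\<exists>n Y. finite Y \<and> Y \<subseteq> ?M0 \<and> D \<inter> lin_span Y \<noteq> {\<zero>} \<and> card Y = n"
    by (intro exI[of _ "card Z"] exI[of _ Z]) auto
  then obtain n where n: "\<exists>Y. finite Y \<and> Y \<subseteq> ?M0 \<and> D \<inter> lin_span Y \<noteq> {\<zero>} \<and> card Y = n"
    and least: "\<And>k. k < n \<Longrightarrow> \<not> (\<exists>Y. finite Y \<and> Y \<subseteq> ?M0 \<and> D \<inter> lin_span Y \<noteq> {\<zero>} \<and> card Y = k)"
    using exists_least_iff[of "\<lambda>n. \<exists>Y. finite Y \<and> Y \<subseteq> ?M0 \<and> D \<inter> lin_span Y \<noteq> {\<zero>} \<and> card Y = n"] by blast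
  then obtain Y where Y: "finite Y" "Y \<subseteq> ?M0" "D \<inter> lin_span Y \<noteq> {\<zero>}" "card Y = n" by blast
  have YH: "Y \<subseteq> carrier H" using Y(2) M0 by auto
  obtain x where x: "x \<in> D" "x \<in> lin_span Y" "x \<noteq> \<zero>" using spz[OF YH] Y(3) by auto
  have "Y \<noteq> {}" using x lin_span_least[of "{}" "{\<zero>}" x] by (auto simp: subm_iff)
  then obtain g where g: "g \<in> Y" by auto
  have gc: "g \<in> carrier H" using g YH by auto
  have YgH: "Y - {g} \<subseteq> carrier H" using YH by auto
  have "D \<inter> lin_span (Y - {g}) = {\<zero>}"
    using least[of "card (Y - {g})"] Y g by (metis Diff_subset card_Diff1_less finite_Diff subset_trans)
  then obtain f where f: "k_linear H base f" "\<And>x. x \<in> lin_span (Y - {g}) \<Longrightarrow> f x = 0" "\<And>x. x \<in> D \<Longrightarrow> f x = \<epsilon> x"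
    using exists_functional[OF Dm submodule_sp[OF YgH] _ alg_homD(1)[OF counit_alg_hom]] by metis
  \<comment> \<open>On a grouplike y the map gives f(y) y. All y other than g are killed, so the
    image of the span of \<open>Y\<close> is contained in the line through g; but x is
    fixed.\<close>
  have "lf f (\<Delta> x) \<in> lin_span {g}"
  proof (rule lin_span_linear_image[OF YH lf_comult_lin[OF f(1)] _ _ x(2)])
    show sg: "submodule (lin_span {g}) base H" using gc by (intro submodule_sp) auto
    fix y assume y: "y \<in> Y"
    then have "\<Delta> y = pt y y" "y \<in> carrier H" using mon_0_grouplike Y(2) YH by auto
    then have "lf f (\<Delta> y) = f y \<odot> y" by (simp add: lf_pt[OF f(1)])
    moreover have "f y \<odot> y \<in> lin_span {g}"
    proof (cases "y = g")
      case True
      then show ?thesis using gc by (simp add: lin_span_singleton)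
    next
      case False
      then have "f y = 0" using f(2) lin_span_incl[OF YgH] y by auto
      then show ?thesis using \<open>y \<in> carrier H\<close> sg by (simp add: subm_iff)
    qed
    ultimately show "lf f (\<Delta> y) \<in> lin_span {g}" by simp
  qed
  then have "x \<in> lin_span {g}" using lf_subcoalgebra[OF f(1) D f(3) x(1)] by simp
  then obtain c where c: "x = c \<odot> g" using gc by (auto simp: lin_span_singleton)
  then have c0: "c \<noteq> 0" and g0: "g \<noteq> \<zero>" using x(3) gc by auto
  have "inverse c \<odot> x \<in> D" using D' x by auto
  then have "g \<in> D" using c c0 gc by simp
  then show ?thesis using that g Y(2) g0 by auto
qed

theorem pointed: "pointed H"
  unfolding pointed_def
proof (intro allI impI)
  fix D assume D: "simple_subcoalgebra H D"
  then have sD: "subcoalgebra H D" "D \<noteq> {\<zero>}" by (auto simp: simple_subcoalgebra_def)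
  obtain g where g: "mon 0 g" "g \<in> D" "g \<noteq> \<zero>" by (rule grouplike_in_subcoalgebra[OF sD])
  have gc: "g \<in> carrier H" using mon_in g by auto
  let ?K = "range (\<lambda>c. c \<odot> g)"
  have K: "submodule ?K base H" using submodule_sp[of "{g}"] gc by (simp add: lin_span_singleton)
  have gK: "g \<in> ?K" by (rule range_eqI[of _ _ 1]) (simp add: gc)
  have "subcoalgebra H ?K" unfolding subcoalgebra_def
  proof (intro conjI K subsetI)
    fix y assume "y \<in> \<Delta> ` ?K"
    then obtain c where "y = \<Delta> (c \<odot> g)" by auto
    then have "y = tensor_class H H (single (g, g) c)"
      using mon_0_grouplike[OF g(1)] gc by (simp add: \<Delta> HH.tc_single)
    then show "y \<in> sub_tensor H H ?K ?K" unfolding sub_tensor_def using gK by auto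
  qed
  moreover have "?K \<subseteq> D" using sD g by (auto simp: subcoalgebra_def subm_iff)
  moreover have "?K \<noteq> {\<zero>}" using gK g by auto
  ultimately have "?K = D" using D unfolding simple_subcoalgebra_def by blast
  then show "one_dimensional H D" unfolding one_dimensional_def using gc g by auto
qed

end

subsection \<open>Hopf subalgebras\<close>

lemma k_algebra_restrict:
  assumes "k_algebra A" "subalg A B"
  shows "k_algebra (A\<lparr>carrier := B\<rparr>)"
proof -
  interpret k_algebra A by fact
  note s = assms(2)[unfolded subalg_iff]
  have m: "submodule B base A" using assms(2) by (simp add: subalg_def)
  have c: "x \<in> B \<Longrightarrow> x \<in> carrier A" for x using s by auto
  have "abelian_group (A\<lparr>carrier := B\<rparr>)"
  proof (rule abelian_groupI)
    fix x assume "x \<in> carrier (A\<lparr>carrier := B\<rparr>)"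
    then show "\<exists>y\<in>carrier (A\<lparr>carrier := B\<rparr>). y \<oplus>\<^bsub>A\<lparr>carrier := B\<rparr>\<^esub> x = \<zero>\<^bsub>A\<lparr>carrier := B\<rparr>\<^esub>"
      using submoduleE(3)[OF m] c by (intro bexI[of _ "\<ominus>\<^bsub>A\<^esub> x"]) (auto simp: l_neg)
  qed (use s m[unfolded subm_iff] c in \<open>auto simp: a_ac\<close>)
  then show ?thesis
    by (rule k_algebraI) (use s c in \<open>auto simp: m_assoc l_distr r_distr sm_add_l sm_add_r\<close>)
qed

text \<open>Over a field \<open>B \<otimes> B \<rightarrow> A \<otimes> A\<close> is injective: a linear retraction \<open>P\<close> of \<open>A\<close> onto \<open>B\<close>
  induces the left inverse \<open>P \<otimes> P\<close>.\<close>

lemma tensor_class_retraction: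
  fixes A :: "('k::field, 'a, 'z) module_scheme"
  assumes A: "k_algebra A" and B: "subalg A B"
  defines "B' \<equiv> A\<lparr>carrier := B\<rparr>"
  obtains \<tau> where "k_linear (tensor A A) (tensor B' B') \<tau>"
    "\<And>t. keys t \<subseteq> B \<times> B \<Longrightarrow> \<tau> (tensor_class A A t) = tensor_class B' B' t"
proof -
  interpret A: k_algebra A by fact
  have B'a: "k_algebra B'" unfolding B'_def by (rule k_algebra_restrict[OF A B])
  interpret AA: tensor_alg A A by (simp add: tensor_alg_def A)
  interpret BB: tensor_alg B' B' by (simp add: tensor_alg_def B'a)
  have BA: "B \<subseteq> carrier A" using B by (simp add: A.subalg_iff)
  obtain P where P: "k_linear A A P" "\<And>x. x \<in> carrier A \<Longrightarrow> P x \<in> B" "\<And>x. x \<in> B \<Longrightarrow> P x = x"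
    using A.exists_retraction[of B] B by (auto simp: subalg_def)
  have PB: "k_linear A B' P"
    by (rule k_linearI) (use P k_linearD[OF P(1)] in \<open>auto simp: B'_def\<close>)
  show ?thesis
  proof (rule that)
    show "k_linear (tensor A A) (tensor B' B') (tensor_map B' B' P P)"
      by (rule tensor_map_linear[OF A A B'a B'a PB PB])
    fix t :: "('a \<times> 'a) \<Rightarrow>\<^sub>0 'k" assume t: "keys t \<subseteq> B \<times> B"
    have tA: "keys t \<subseteq> carrier A \<times> carrier A" using t BA by auto
    have tB: "keys t \<subseteq> carrier B' \<times> carrier B'" using t by (simp add: B'_def)
    interpret TB: k_algebra "tensor B' B'" by (rule BB.T_alg)
    have "tensor_map B' B' P P (tensor_class A A t) = lin_ext (tensor B' B') (\<lambda>(x, y). pure_tensor B' B' (P x) (P y)) t"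
      unfolding tensor_map_def by (rule AA.tensor_lift_tc[OF BB.T_alg bilin_map[OF B'a B'a PB PB] tA])
    also have "\<dots> = lin_ext (tensor B' B') (\<lambda>(x, y). pure_tensor B' B' x y) t"
    proof -
      have "a \<in> B \<and> b \<in> B \<and> a \<in> carrier B' \<and> b \<in> carrier B'" if "(a, b) \<in> keys t" for a b
        using subsetD[OF t that] subsetD[OF tB that] by auto
      then show ?thesis unfolding lin_ext_def by (intro TB.finsum_cong') (auto simp: P(3))
    qed
    also have "\<dots> = tensor_class B' B' t" by (rule BB.tc_lin_ext[OF tB, symmetric])
    finally show "tensor_map B' B' P P (tensor_class A A t) = tensor_class B' B' t" .
  qed
qed

lemma (in tensor_alg) subalg_sub_tensor:
  assumes "subalg A Y" "subalg B Z"
  shows "subalg T (sub_tensor A B Y Z)"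
proof -
  interpret T: k_algebra T by (rule T_alg)
  note Y = assms(1)[unfolded A.subalg_iff] and Z = assms(2)[unfolded B.subalg_iff]
  have YZ: "Y \<times> Z \<subseteq> X" using Y Z by auto
  have k: "keys p \<subseteq> X" if "keys p \<subseteq> Y \<times> Z" for p :: "('a \<times> 'b) \<Rightarrow>\<^sub>0 'k"
    using that YZ by (rule subset_trans)
  have m: "keys (p \<star> q) \<subseteq> Y \<times> Z" if "keys p \<subseteq> Y \<times> Z" "keys q \<subseteq> Y \<times> Z" for p q
  proof -
    have "keys (\<Sum>u\<in>keys p. \<Sum>v\<in>keys q. single (u \<otimes>\<^bsub>A \<times>\<times> B\<^esub> v)
                    (lookup p u * lookup q v)) \<subseteq> Y \<times> Z"
    proof (intro keys_sum_in keys_single_in)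
      fix u v assume "u \<in> keys p" "v \<in> keys q"
      then have "u \<in> Y \<times> Z" "v \<in> Y \<times> Z" using that by blast+
      then show "u \<otimes>\<^bsub>A \<times>\<times> B\<^esub> v \<in> Y \<times> Z" using Y Z by (auto simp: DirProd_def)
    qed
    then show ?thesis by (simp add: tensor_free_def)
  qed
  show ?thesis unfolding T.subalg_iff sub_tensor_def
  proof (intro conjI ballI allI)
    show "tc ` {t. keys t \<subseteq> Y \<times> Z} \<subseteq> carrier T" using k by (auto simp: tc_simps)
    show "\<one>\<^bsub>T\<^esub> \<in> tc ` {t. keys t \<subseteq> Y \<times> Z}"
      unfolding pt_one pure_tensor_def using Y Z by (intro imageI) auto
    fix x c assume "x \<in> tc ` {t. keys t \<subseteq> Y \<times> Z}"
    then obtain p where p: "x = tc p" "keys p \<subseteq> Y \<times> Z" by auto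
    then have "c \<odot>\<^bsub>T\<^esub> x = tc (c \<cdot> p)" using k by (simp add: tc_simps)
    then show "c \<odot>\<^bsub>T\<^esub> x \<in> tc ` {t. keys t \<subseteq> Y \<times> Z}" using p keys_scal_in by blast
    fix y assume "y \<in> tc ` {t. keys t \<subseteq> Y \<times> Z}"
    then obtain q where q: "y = tc q" "keys q \<subseteq> Y \<times> Z" by auto
    have "x \<oplus>\<^bsub>T\<^esub> y = tc (p + q)" "x \<otimes>\<^bsub>T\<^esub> y = tc (p \<star> q)" using p q k by (simp_all add: tc_simps)
    then show "x \<oplus>\<^bsub>T\<^esub> y \<in> tc ` {t. keys t \<subseteq> Y \<times> Z}" "x \<otimes>\<^bsub>T\<^esub> y \<in> tc ` {t. keys t \<subseteq> Y \<times> Z}"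
      using keys_add_in[OF p(2) q(2)] m[OF p(2) q(2)] by auto
  qed
qed

lemma sub_tensor_pure: "x \<in> Y \<Longrightarrow> y \<in> Z \<Longrightarrow> pure_tensor A B x y \<in> sub_tensor A B Y Z"
  unfolding sub_tensor_def pure_tensor_def by (intro imageI) auto

section \<open>Hopf subalgebras generated by part of the generators\<close>

context skew_generated
begin

context
  fixes Gr' Sk' :: "'a set"
  assumes Gr': "Gr' \<subseteq> Gr" "\<one> \<in> Gr'" "\<And>g. g \<in> Gr' \<Longrightarrow> S g \<in> Gr'"
    and Sk': "Sk' \<subseteq> Sk" "\<And>x. x \<in> Sk' \<Longrightarrow> \<exists>g\<in>Gr'. \<exists>h\<in>Gr'.
      \<Delta> x = pt x h \<oplus>\<^bsub>T\<^esub> pt g x \<and> S x = (- 1) \<odot> (S g \<otimes> x \<otimes> S h)"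
begin

abbreviation "B \<equiv> subalg_generated H (Gr' \<union> Sk')"

lemma subalg_B: "subalg H B"
  by (rule subalg_subalg_generated) (use Gr' Sk' GS_in in auto)

lemma gen_in_B: "x \<in> Gr' \<Longrightarrow> x \<in> B" "x \<in> Sk' \<Longrightarrow> x \<in> B"
  using subalg_generated_incl[of "Gr' \<union> Sk'"] by auto

lemma B_induct:
  assumes "subalg H W" "\<And>g. g \<in> Gr' \<Longrightarrow> g \<in> W" "\<And>x. x \<in> Sk' \<Longrightarrow> x \<in> W" "x \<in> B"
  shows "x \<in> W"
  using subalg_generated_least[of W "Gr' \<union> Sk'"] assms by blast

lemmas B_simps = subalg_B[unfolded subalg_iff]

lemma B_in: "x \<in> B \<Longrightarrow> x \<in> carrier H"
  using B_simps by blast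

text \<open>The image of B \<otimes> B is a subalgebra of the tensor square, so its preimage under
  \<Delta> is a subalgebra, and it contains the generators.\<close>

lemma comult_B: "x \<in> B \<Longrightarrow> \<Delta> x \<in> sub_tensor H H B B"
proof -
  assume x: "x \<in> B"
  let ?W = "{x \<in> carrier H. \<Delta> x \<in> sub_tensor H H B B}"
  have sB: "subalg T (sub_tensor H H B B)" by (rule HH.subalg_sub_tensor[OF subalg_B subalg_B])
  have "x \<in> ?W"
  proof (rule B_induct[OF subalg_preimage[OF comult_alg_hom T_alg sB] _ _ x])
    fix g assume g: "g \<in> Gr'"
    then have "\<Delta> g = pt g g" using Gr_comult Gr' by auto
    then show "g \<in> ?W" using g gen_in_B by (auto simp: B_in intro: sub_tensor_pure)
  next
    fix x assume x: "x \<in> Sk'"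
    then obtain g h where gh: "g \<in> Gr'" "h \<in> Gr'" "\<Delta> x = pt x h \<oplus>\<^bsub>T\<^esub> pt g x" using Sk' by blast
    have "pt x h \<in> sub_tensor H H B B" "pt g x \<in> sub_tensor H H B B"
      using gh x gen_in_B by (auto intro: sub_tensor_pure)
    then show "x \<in> ?W" using gh(3) sB x gen_in_B by (simp add: B_in T.subalg_iff)
  qed
  then show ?thesis by simp
qed

lemma antipode_B: "x \<in> B \<Longrightarrow> S x \<in> B"
proof -
  assume x: "x \<in> B"
  let ?W = "{x \<in> carrier H. S x \<in> B}"
  have W: "subalg H ?W" unfolding subalg_iff
    using B_simps by (simp add: S antipode_one antipode_mult)
  have "x \<in> ?W"
  proof (rule B_induct[OF W _ _ x])
    fix g assume g: "g \<in> Gr'"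
    then show "g \<in> ?W" using Gr' gen_in_B by (auto simp: B_in)
  next
    fix x assume x: "x \<in> Sk'"
    then obtain g h where gh: "g \<in> Gr'" "h \<in> Gr'" "S x = (- 1) \<odot> (S g \<otimes> x \<otimes> S h)" using Sk' by blast
    then have "S g \<in> B" "S h \<in> B" "x \<in> B" using x Gr' gen_in_B by auto
    then show "x \<in> ?W" using gh(3) B_simps by (simp add: B_in)
  qed
  then show ?thesis by simp
qed

lemma hopf_subalgebra_B: "hopf_subalgebra H B"
  using subalg_B comult_B antipode_B by (auto simp: hopf_subalgebra_def)

abbreviation "C \<equiv> hopf_restrict H B"

lemma C_simps [simp]: "carrier C = B" "mult C = mult H" "\<one>\<^bsub>C\<^esub> = \<one>" "\<zero>\<^bsub>C\<^esub> = \<zero>" "add C = add H"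
  "smult C = smult H" "counit C = counit H" "antipode C = antipode H"
  by (simp_all add: hopf_restrict_def)

text \<open>Expressing the chosen coproduct of \<open>C\<close> as \<tau> after \<Delta> makes it
  linear; multiplicativity needs a separate argument, as \<tau> comes from a merely linear
  retraction.\<close>

lemma skew_generated_restrict: "skew_generated C Gr' Sk'"
proof -
  let ?B' = "H\<lparr>carrier := B\<rparr>"
  have sC: "same_alg ?B' C" by (simp add: same_alg_iff)
  have B'a: "k_algebra ?B'" by (rule k_algebra_restrict[OF k_algebra_axioms subalg_B])
  have Ca: "k_algebra C" by (rule k_algebra_cong[OF sC B'a])
  interpret C: k_algebra C by (rule Ca)
  interpret CC: tensor_alg C C by (simp add: tensor_alg_def Ca)
  note cong = tensor_cong[OF sC sC] tensor_class_cong[OF sC sC] pure_tensor_cong[OF sC sC]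
  obtain \<tau> where \<tau>: "k_linear T CC.T \<tau>"
    "\<And>t. keys t \<subseteq> B \<times> B \<Longrightarrow> \<tau> (tensor_class H H t) = CC.tc t"
    using tensor_class_retraction[OF k_algebra_axioms subalg_B] unfolding cong by metis
  \<comment> \<open>Whichever representative is chosen, \<tau> sends its class in the large tensor
    square to its class in the small one, so the choice drops out.\<close>
  have comult: "comult C x = \<tau> (\<Delta> x)" if x: "x \<in> B" for x
  proof -
    let ?t = "SOME t. keys t \<subseteq> B \<times> B \<and> tensor_class H H t = \<Delta> x"
    have "\<exists>t. keys t \<subseteq> B \<times> B \<and> tensor_class H H t = \<Delta> x"
      using comult_B[OF x] by (auto simp: sub_tensor_def)
    from someI_ex[OF this] have t: "keys ?t \<subseteq> B \<times> B" "tensor_class H H ?t = \<Delta> x" by auto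
    have "comult C x = tensor_class ?B' ?B' ?t" by (simp add: hopf_restrict_def)
    also have "\<dots> = CC.tc ?t" by (simp only: cong)
    also have "\<dots> = \<tau> (\<Delta> x)" using \<tau>(2)[OF t(1)] t(2) by simp
    finally show ?thesis .
  qed
  have \<tau>p: "\<tau> (pt x y) = CC.pt x y" if "x \<in> B" "y \<in> B" for x y
    using \<tau>(2)[of "single (x, y) 1"] that by (simp add: pure_tensor_def)
  \<comment> \<open>The product formula on representatives does not involve the carrier.\<close>
  have fm: "p \<otimes>\<^bsub>tensor_free C C\<^esub> q = p \<otimes>\<^bsub>tensor_free H H\<^esub> q" for p q
    by (simp add: tensor_free_def DirProd_def)
  \<comment> \<open>On classes with representatives supported in B x B, products can be formed with
    representatives, where the two tensor squares agree.\<close>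
  have \<tau>m: "\<tau> (s \<otimes>\<^bsub>T\<^esub> t) = \<tau> s \<otimes>\<^bsub>CC.T\<^esub> \<tau> t" if s: "s \<in> sub_tensor H H B B" and t: "t \<in> sub_tensor H H B B" for s t
  proof -
    obtain p q where pq: "s = tensor_class H H p" "t = tensor_class H H q"
      "keys p \<subseteq> B \<times> B" "keys q \<subseteq> B \<times> B"
      using s t unfolding sub_tensor_def by blast
    have k: "keys p \<subseteq> carrier H \<times> carrier H" "keys q \<subseteq> carrier H \<times> carrier H"
      using pq(3,4) B_in by auto
    have kC: "keys p \<subseteq> carrier C \<times> carrier C" "keys q \<subseteq> carrier C \<times> carrier C"
      using pq(3,4) by auto
    have kk: "keys (p \<otimes>\<^bsub>tensor_free H H\<^esub> q) \<subseteq> B \<times> B"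
      using CC.fm_keys[OF kC] by (simp add: fm)
    show ?thesis
      unfolding pq(1,2) HH.tc_simps(3)[OF k, symmetric] \<tau>(2)[OF kk] \<tau>(2)[OF pq(3)] \<tau>(2)[OF pq(4)]
        CC.tc_simps(3)[OF kC, symmetric] fm ..
  qed
  show ?thesis
  proof unfold_locales
    show "alg_hom C CC.T (comult C)"
    proof (intro alg_homI k_linearI)
      show "comult C x \<in> carrier CC.T" if "x \<in> carrier C" for x
        using that by (simp add: comult k_linearD[OF \<tau>(1)] \<Delta> B_in)
      show "comult C (x \<oplus>\<^bsub>C\<^esub> y) = comult C x \<oplus>\<^bsub>CC.T\<^esub> comult C y" if "x \<in> carrier C" "y \<in> carrier C" for x y
        using that B_simps by (simp add: comult k_linearD[OF \<tau>(1)] \<Delta> B_in)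
      show "comult C (c \<odot>\<^bsub>C\<^esub> x) = c \<odot>\<^bsub>CC.T\<^esub> comult C x" if "x \<in> carrier C" for c x
        using that B_simps by (simp add: comult k_linearD[OF \<tau>(1)] \<Delta> B_in)
      show "comult C (x \<otimes>\<^bsub>C\<^esub> y) = comult C x \<otimes>\<^bsub>CC.T\<^esub> comult C y" if "x \<in> carrier C" "y \<in> carrier C" for x y
        using that B_simps by (simp add: comult \<Delta> B_in \<tau>m comult_B)
      show "comult C \<one>\<^bsub>C\<^esub> = \<one>\<^bsub>CC.T\<^esub>"
        using B_simps CC.pt_one Gr_comult[OF one_Gr] by (simp add: comult \<tau>p)
    qed
    show "alg_hom C base (counit C)"
      by (intro alg_homI k_linearI) (auto simp: \<epsilon> B_in)
    show "k_linear C C (antipode C)"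
      by (rule k_linearI) (auto simp: S B_in antipode_B)
    show "antipode C (x \<otimes>\<^bsub>C\<^esub> y) = antipode C y \<otimes>\<^bsub>C\<^esub> antipode C x" if "x \<in> carrier C" "y \<in> carrier C" for x y
      using that by (simp add: antipode_mult B_in)
    show "antipode C \<one>\<^bsub>C\<^esub> = \<one>\<^bsub>C\<^esub>" by (simp add: antipode_one)
    show "Gr' \<subseteq> carrier C" "Sk' \<subseteq> carrier C" using gen_in_B by auto
    show "\<one>\<^bsub>C\<^esub> \<in> Gr'" using Gr' by simp
    show "comult C g = CC.pt g g" "counit C g = 1" "antipode C g \<otimes>\<^bsub>C\<^esub> g = \<one>\<^bsub>C\<^esub>" "g \<otimes>\<^bsub>C\<^esub> antipode C g = \<one>\<^bsub>C\<^esub>"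
      if "g \<in> Gr'" for g
    proof -
      have g: "g \<in> Gr" "g \<in> B" using that Gr' gen_in_B by auto
      show "comult C g = CC.pt g g" using g by (simp add: comult Gr_comult \<tau>p)
    qed (use that Gr' in \<open>auto simp: Gr_counit Gr_antipode\<close>)
    show "counit C x = 0" if "x \<in> Sk'" for x using that Sk' Sk_counit by auto
    show "\<exists>g\<in>Gr'. \<exists>h\<in>Gr'. comult C x = CC.pt x h \<oplus>\<^bsub>CC.T\<^esub> CC.pt g x \<and>
        antipode C x = (- 1) \<odot>\<^bsub>C\<^esub> (antipode C g \<otimes>\<^bsub>C\<^esub> x \<otimes>\<^bsub>C\<^esub> antipode C h)" if x: "x \<in> Sk'" for x
    proof -
      obtain g h where gh: "g \<in> Gr'" "h \<in> Gr'" "\<Delta> x = pt x h \<oplus>\<^bsub>T\<^esub> pt g x"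
        "S x = (- 1) \<odot> (S g \<otimes> x \<otimes> S h)" using Sk'(2)[OF x] by blast
      have b: "g \<in> B" "h \<in> B" "x \<in> B" using gh x gen_in_B by auto
      then have "comult C x = CC.pt x h \<oplus>\<^bsub>CC.T\<^esub> CC.pt g x"
        by (simp add: comult gh(3) k_linearD[OF \<tau>(1)] B_in \<tau>p)
      then show ?thesis using gh by auto
    qed
    show "carrier C \<subseteq> subalg_generated C (Gr' \<union> Sk')"
    proof -
      have "B \<subseteq> W" if "subalg C W" "Gr' \<union> Sk' \<subseteq> W" for W
      proof -
        \<comment> \<open>A subalgebra of \<open>C\<close> is one of \<open>H\<close> inside
          \<open>B\<close>, so generation in \<open>H\<close> gives generation in
          \<open>C\<close>.\<close>
        have "subalg H W" using that(1) B_in by (auto simp: subalg_iff C.subalg_iff)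
        then show ?thesis using subalg_generated_least that(2) by blast
      qed
      then show ?thesis by (simp only: C_simps subalg_generated_def[of C]) blast
    qed
  qed
qed

end

end

subsection \<open>Iterated \<open>q\<close>-commutators\<close>

definition qcomm :: "('k::field, 'a, 'z) module_scheme \<Rightarrow> 'k \<Rightarrow> 'a \<Rightarrow> 'a \<Rightarrow> 'a" where
  "qcomm A c x y = x \<otimes>\<^bsub>A\<^esub> y \<oplus>\<^bsub>A\<^esub> (- c) \<odot>\<^bsub>A\<^esub> (y \<otimes>\<^bsub>A\<^esub> x)"

primrec qcomms :: "('k::field, 'a, 'z) module_scheme \<Rightarrow> 'k list \<Rightarrow> 'a \<Rightarrow> 'a \<Rightarrow> 'a" where
  "qcomms A [] x y = y"
| "qcomms A (c # cs) x y = qcomm A c x (qcomms A cs x y)"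

text \<open>Descending order: \<open>qcomms\<close> applies the head of its list last, so u 0
  belongs to the innermost commutator.\<close>

primrec lam :: "(nat \<Rightarrow> 'k) \<Rightarrow> nat \<Rightarrow> 'k list" where
  "lam u 0 = []"
| "lam u (Suc n) = u n # lam u n"

text \<open>For lists of length \<open>n\<close> the two descriptions of \<open>cs\<close> amount to \<open>p p' q\<^sup>n\<^sup>-\<^sup>1 = 1\<close>, which is what
  makes the \<open>n\<close>-fold \<open>q\<close>-commutator of two skew primitive elements skew primitive.\<close>

definition serre_list :: "'k::field \<Rightarrow> 'k \<Rightarrow> 'k \<Rightarrow> 'k list \<Rightarrow> bool" where
  "serre_list q p p' cs \<longleftrightarrow> q \<noteq> 0 \<and> p \<noteq> 0 \<and> p' \<noteq> 0 \<and>
     cs = lam (\<lambda>k. p * q ^ k) (length cs) \<and> rev cs = lam (\<lambda>k. inverse (p' * q ^ k)) (length cs)"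

lemma alg_hom_br: 
  assumes "k_algebra A" "alg_hom A B f" "x \<in> carrier A" "y \<in> carrier A"
  shows "f (qcomm A c x y) = qcomm B c (f x) (f y)"
proof -
  interpret k_algebra A by fact
  show ?thesis using assms(3,4) by (simp add: qcomm_def alg_homD[OF assms(2)])
qed

lemma alg_hom_opposite: "alg_hom A B f \<Longrightarrow> alg_hom (opposite A) (opposite B) f"
  by (auto intro!: alg_homI k_linearI simp: alg_homD)

context k_algebra
begin

lemma qcomm_in [simp, intro]: "\<lbrakk>x \<in> carrier A; y \<in> carrier A\<rbrakk> \<Longrightarrow> qcomm A c x y \<in> carrier A"
  by (simp add: qcomm_def)

lemma qcomms_in [simp, intro]: "\<lbrakk>x \<in> carrier A; y \<in> carrier A\<rbrakk> \<Longrightarrow> qcomms A cs x y \<in> carrier A"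
  by (induction cs) auto

lemma qcomm_add: "\<lbrakk>x \<in> carrier A; y \<in> carrier A; z \<in> carrier A\<rbrakk> \<Longrightarrow> qcomm A c x (y \<oplus> z) = qcomm A c x y \<oplus> qcomm A c x z"
  by (simp add: qcomm_def l_distr r_distr sm_add_r a_ac)

lemma qcomms_add: "\<lbrakk>x \<in> carrier A; y \<in> carrier A; z \<in> carrier A\<rbrakk> \<Longrightarrow> qcomms A cs x (y \<oplus> z) = qcomms A cs x y \<oplus> qcomms A cs x z"
  by (induction cs) (auto simp: qcomm_add)

lemma qcomm_sm: "\<lbrakk>x \<in> carrier A; y \<in> carrier A\<rbrakk> \<Longrightarrow> qcomm A c x (d \<odot> y) = d \<odot> qcomm A c x y"
  by (simp add: qcomm_def sm_add_r mult.commute)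

lemma qcomms_sm: "\<lbrakk>x \<in> carrier A; y \<in> carrier A\<rbrakk> \<Longrightarrow> qcomms A cs x (d \<odot> y) = d \<odot> qcomms A cs x y"
  by (induction cs) (auto simp: qcomm_sm)

lemma qcomm_zero [simp]: "x \<in> carrier A \<Longrightarrow> qcomm A c x \<zero> = \<zero>"
  by (simp add: qcomm_def)

lemma qcomm_add_l: "\<lbrakk>x \<in> carrier A; y \<in> carrier A; z \<in> carrier A\<rbrakk> \<Longrightarrow> qcomm A c (x \<oplus> y) z = qcomm A c x z \<oplus> qcomm A c y z"
  by (simp add: qcomm_def l_distr r_distr sm_add_r a_ac)

lemma qcomm_null: "\<lbrakk>x \<in> carrier A; y \<in> carrier A; x \<otimes> y = c \<odot> (y \<otimes> x)\<rbrakk> \<Longrightarrow> qcomm A c x y = \<zero>"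
  by (simp add: qcomm_def sm_uminus_l r_neg)

text \<open>A q-commutator by x is left multiplication minus a multiple of right multiplication.
  Left and right multiplications by x commute, hence so do these operators; the expanded form is
  symmetric in c and d.\<close>

lemma qcomm_commute:
  assumes "x \<in> carrier A" "y \<in> carrier A"
  shows "qcomm A c x (qcomm A d x y) = qcomm A d x (qcomm A c x y)"
proof -
  have "qcomm A c x (qcomm A d x y) = (x \<otimes> x \<otimes> y \<oplus> (c * d) \<odot> (y \<otimes> x \<otimes> x)) \<oplus> ((- d) \<odot> (x \<otimes> y \<otimes> x) \<oplus> (- c) \<odot> (x \<otimes> y \<otimes> x))" for c d
    using assms by (simp add: qcomm_def l_distr r_distr sm_add_r m_assoc a_ac)
  from this[of c d] this[of d c] show ?thesis using assms by (simp add: mult.commute a_comm)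
qed

lemma qcomms_commute: "\<lbrakk>x \<in> carrier A; y \<in> carrier A\<rbrakk> \<Longrightarrow> qcomms A cs x (qcomm A c x y) = qcomm A c x (qcomms A cs x y)"
  by (induction cs) (auto simp: qcomm_commute)

lemma qcomms_append: "qcomms A (cs @ ds) x y = qcomms A cs x (qcomms A ds x y)"
  by (induction cs) auto

lemma qcomms_rev: "\<lbrakk>x \<in> carrier A; y \<in> carrier A\<rbrakk> \<Longrightarrow> qcomms A (rev cs) x y = qcomms A cs x y"
  by (induction cs) (auto simp: qcomms_append qcomms_commute)

text \<open>Moving b past x y or past y x costs the same scalar q p, so it costs that scalar for any
  combination of the two.\<close>

lemma qcomm_br_l:
  assumes "x \<in> carrier A" "y \<in> carrier A" "b \<in> carrier A"
    and "b \<otimes> x = q \<odot> (x \<otimes> b)" "b \<otimes> y = p \<odot> (y \<otimes> b)"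
  shows "b \<otimes> qcomm A c x y = (q * p) \<odot> (qcomm A c x y \<otimes> b)"
proof -
  have "b \<otimes> (x \<otimes> y) = (q * p) \<odot> (x \<otimes> y \<otimes> b)"
    using assms by (simp add: m_assoc[symmetric]) (simp add: m_assoc)
  moreover have "b \<otimes> (y \<otimes> x) = (q * p) \<odot> (y \<otimes> x \<otimes> b)"
    using assms by (simp add: m_assoc[symmetric]) (simp add: m_assoc mult.commute)
  ultimately show ?thesis using assms(1-3) by (simp add: qcomm_def r_distr l_distr sm_add_r mult_ac)
qed

lemma qcomm_br_r:
  assumes "x \<in> carrier A" "y \<in> carrier A" "b \<in> carrier A"
    and "x \<otimes> b = q \<odot> (b \<otimes> x)" "y \<otimes> b = p \<odot> (b \<otimes> y)"
  shows "qcomm A c x y \<otimes> b = (q * p) \<odot> (b \<otimes> qcomm A c x y)"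
proof -
  have "x \<otimes> y \<otimes> b = (q * p) \<odot> (b \<otimes> (x \<otimes> y))"
    using assms by (simp add: m_assoc) (simp add: m_assoc[symmetric] mult.commute)
  moreover have "y \<otimes> x \<otimes> b = (q * p) \<odot> (b \<otimes> (y \<otimes> x))"
    using assms by (simp add: m_assoc) (simp add: m_assoc[symmetric])
  ultimately show ?thesis using assms(1-3) by (simp add: qcomm_def r_distr l_distr sm_add_r mult_ac)
qed

text \<open>The \<open>q\<close>-commutators by \<open>a + b\<close> of \<open>c\<close> lose their \<open>b\<close>-part when applied in one order, those
  of \<open>d\<close> lose their \<open>a\<close>-part when applied in the opposite order; and the order is irrelevant.\<close>

lemma qcomms_sum_c:
  assumes "a \<in> carrier A" "b \<in> carrier A" "c \<in> carrier A"
    and "b \<otimes> a = q \<odot> (a \<otimes> b)" "b \<otimes> c = p \<odot> (c \<otimes> b)"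
  defines "cs \<equiv> lam (\<lambda>k. p * q ^ k)"
  shows "qcomms A (cs n) (a \<oplus> b) c = qcomms A (cs n) a c \<and>
    b \<otimes> qcomms A (cs n) a c = (p * q ^ n) \<odot> (qcomms A (cs n) a c \<otimes> b)"
proof (induction n)
  case 0
  then show ?case using assms by (simp add: cs_def)
next
  case (Suc n)
  let ?z = "qcomms A (cs n) a c"
  have z: "?z \<in> carrier A" using assms by simp
  have e: "cs (Suc n) = (p * q ^ n) # cs n" by (simp add: cs_def)
  \<comment> \<open>The scalar with which b moves past the n-th commutator equals the n-th scalar of
    the list, so the q-commutator by b vanishes.\<close>
  have "qcomm A (p * q ^ n) (a \<oplus> b) ?z = qcomm A (p * q ^ n) a ?z"
    using qcomm_add_l[OF assms(1,2) z] qcomm_null[OF assms(2) z] Suc assms by simp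
  moreover have "b \<otimes> qcomm A (p * q ^ n) a ?z = (q * (p * q ^ n)) \<odot> (qcomm A (p * q ^ n) a ?z \<otimes> b)"
    by (rule qcomm_br_l) (use Suc assms z in auto)
  ultimately show ?case using Suc by (simp add: e mult_ac)
qed

lemma qcomms_sum_d:
  assumes "a \<in> carrier A" "b \<in> carrier A" "d \<in> carrier A"
    and "b \<otimes> a = q \<odot> (a \<otimes> b)" "d \<otimes> a = p \<odot> (a \<otimes> d)" "p \<noteq> 0" "q \<noteq> 0"
  defines "cs \<equiv> lam (\<lambda>k. inverse (p * q ^ k))"
  shows "qcomms A (cs n) (a \<oplus> b) d = qcomms A (cs n) b d \<and>
    qcomms A (cs n) b d \<otimes> a = (p * q ^ n) \<odot> (a \<otimes> qcomms A (cs n) b d)"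
proof (induction n)
  case 0
  then show ?case using assms by (simp add: cs_def)
next
  case (Suc n)
  let ?z = "qcomms A (cs n) b d" and ?c = "inverse (p * q ^ n)"
  have z: "?z \<in> carrier A" using assms by simp
  have e: "cs (Suc n) = ?c # cs n" by (simp add: cs_def)
  \<comment> \<open>Here a moves past the commutator from the other side, so the scalar that
    annihilates is the inverse of p q^n.\<close>
  have "?c * (p * q ^ n) = 1" by (rule left_inverse) (use assms in simp)
  then have "?c \<odot> (?z \<otimes> a) = a \<otimes> ?z"
    using Suc assms z by (simp del: inverse_mult_distrib)
  then have "qcomm A ?c (a \<oplus> b) ?z = qcomm A ?c b ?z"
    using qcomm_add_l[OF assms(1,2) z] qcomm_null[OF assms(1) z] assms z by simp
  moreover have "qcomm A ?c b ?z \<otimes> a = (q * (p * q ^ n)) \<odot> (a \<otimes> qcomm A ?c b ?z)"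
    by (rule qcomm_br_r) (use Suc assms z in auto)
  ultimately show ?case using Suc by (simp add: e mult_ac)
qed

lemma serre_sum:
  assumes c: "a \<in> carrier A" "b \<in> carrier A" "c \<in> carrier A" "d \<in> carrier A"
    and q: "b \<otimes> a = q \<odot> (a \<otimes> b)" "b \<otimes> c = p \<odot> (c \<otimes> b)" "d \<otimes> a = p' \<odot> (a \<otimes> d)"
    and l: "serre_list q p p' cs"
  shows "qcomms A cs (a \<oplus> b) (c \<oplus> d) = qcomms A cs a c \<oplus> qcomms A cs b d"
proof -
  have "qcomms A cs (a \<oplus> b) c = qcomms A cs a c"
    using qcomms_sum_c[OF c(1-3) q(1,2), of "length cs"] l unfolding serre_list_def by metis
  moreover have "qcomms A (rev cs) (a \<oplus> b) d = qcomms A (rev cs) b d"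
    using qcomms_sum_d[OF c(1,2,4) q(1,3), of "length cs"] l unfolding serre_list_def by metis
  ultimately show ?thesis using c by (simp add: qcomms_add qcomms_rev)
qed

end

text \<open>Moving \<open>k\<close> and \<open>k'\<close> to the left turns the \<open>q\<close>-commutators in the opposite algebra into those in \<open>A\<close>,
  with their scalars in reversed order.\<close>

lemma serre_opposite:
  fixes A :: "('k::field, 'a) module" (structure)
  assumes A: "k_algebra A" and c: "x \<in> carrier A" "y \<in> carrier A" "k \<in> carrier A" "k' \<in> carrier A" 
    and k: "k \<otimes> k' = k' \<otimes> k" "x \<otimes> k = t \<odot> (k \<otimes> x)" "y \<otimes> k = u \<odot> (k \<otimes> y)" "x \<otimes> k' = v \<odot> (k' \<otimes> x)"
    and uv: "u \<noteq> 0" "v \<noteq> 0" "u * p' = v * p"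
    and l: "serre_list q p p' cs" and z: "qcomms A cs x y = \<zero>"
  shows "qcomms (opposite A) cs (k \<otimes> x) (k' \<otimes> y) = \<zero>"
proof -
  interpret k_algebra A by (rule A)
  let ?b = "\<lambda>n. qcomms A (lam (\<lambda>k. inverse (p' * q ^ k)) n) x y"
  have q0: "q \<noteq> 0" "p \<noteq> 0" "p' \<noteq> 0" using l by (auto simp: serre_list_def)
  \<comment> \<open>\<open>K\<close> collects all factors k and k' moved to the left so far;
    \<open>?b\<close> is the commutator in \<open>A\<close> built from the reversed list. The
    commutation rules for \<open>K\<close> and \<open>?b\<close> let the next step proceed.\<close>
  have "\<exists>c K. K \<in> carrier A \<and> K \<otimes> k = k \<otimes> K \<and> x \<otimes> K = (v * t ^ n) \<odot> (K \<otimes> x) \<and>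
      ?b n \<otimes> k = (u * t ^ n) \<odot> (k \<otimes> ?b n) \<and>
      qcomms (opposite A) (lam (\<lambda>k. p * q ^ k) n) (k \<otimes> x) (k' \<otimes> y) = c \<odot> (K \<otimes> ?b n)" for n
  proof (induction n)
    case 0
    then show ?case using c k by (intro exI[of _ 1] exI[of _ k']) simp
  next
    case (Suc n)
    then obtain d K where IH: "K \<in> carrier A" "K \<otimes> k = k \<otimes> K" "x \<otimes> K = (v * t ^ n) \<odot> (K \<otimes> x)"
      "?b n \<otimes> k = (u * t ^ n) \<odot> (k \<otimes> ?b n)"
      "qcomms (opposite A) (lam (\<lambda>k. p * q ^ k) n) (k \<otimes> x) (k' \<otimes> y) = d \<odot> (K \<otimes> ?b n)" by blast
    interpret O: k_algebra "opposite A" by (rule k_algebra_opposite[OF A])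
    define b where "b = ?b n"
    let ?l = "p * q ^ n" and ?m = "inverse (p' * q ^ n)"
    have bc: "b \<in> carrier A" using c by (simp add: b_def)
    note IH' = IH[folded b_def]
    have 1: "(K \<otimes> b) \<otimes> (k \<otimes> x) = (u * t ^ n) \<odot> (K \<otimes> k \<otimes> (b \<otimes> x))"
    proof -
      have "(K \<otimes> b) \<otimes> (k \<otimes> x) = K \<otimes> (b \<otimes> k) \<otimes> x" using IH'(1) bc c by (simp add: m_assoc)
      then show ?thesis using IH'(1) bc c unfolding IH'(4) by (simp add: m_assoc)
    qed
    have 2: "(k \<otimes> x) \<otimes> (K \<otimes> b) = (v * t ^ n) \<odot> (K \<otimes> k \<otimes> (x \<otimes> b))"
    proof -
      have "(k \<otimes> x) \<otimes> (K \<otimes> b) = k \<otimes> (x \<otimes> K) \<otimes> b" using IH'(1) bc c by (simp add: m_assoc)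
      then show ?thesis using IH'(1) bc c unfolding IH'(3) IH'(2) by (simp add: m_assoc)
    qed
    \<comment> \<open>This matching of scalars, from u p' = v p, turns u t^n b x - l v t^n x b into
      a multiple of the q-commutator x b - m b x in \<open>A\<close>.\<close>
    have 3: "u * t ^ n = ?l * (v * t ^ n) * ?m" using uv q0 by (simp add: field_simps)
    have "qcomm (opposite A) ?l (k \<otimes> x) (K \<otimes> b) = (- (?l * (v * t ^ n))) \<odot> (K \<otimes> k \<otimes> qcomm A ?m x b)"
      unfolding qcomm_def opposite_simps 1 2 3
      using IH'(1) bc c by (simp add: r_distr sm_add_r a_comm mult.assoc)
    moreover have "qcomm (opposite A) ?l (k \<otimes> x) (d \<odot> (K \<otimes> b)) = d \<odot> qcomm (opposite A) ?l (k \<otimes> x) (K \<otimes> b)"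
      using O.qcomm_sm[of "k \<otimes> x" "K \<otimes> b" ?l d] IH'(1) bc c by simp
    ultimately have "qcomms (opposite A) (lam (\<lambda>k. p * q ^ k) (Suc n)) (k \<otimes> x) (k' \<otimes> y) =
        (d * (- (?l * (v * t ^ n)))) \<odot> (K \<otimes> k \<otimes> ?b (Suc n))"
      using IH bc c by (simp add: b_def)
    moreover have "K \<otimes> k \<otimes> k = k \<otimes> (K \<otimes> k)" using IH(1) c by (subst (1) IH(2)) (simp add: m_assoc)
    moreover have "x \<otimes> (K \<otimes> k) = (v * t ^ Suc n) \<odot> (K \<otimes> k \<otimes> x)"
    proof -
      have "x \<otimes> (K \<otimes> k) = (v * t ^ n) \<odot> (K \<otimes> (x \<otimes> k))" using IH(1,3) c by (simp add: m_assoc[symmetric])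
      then show ?thesis using IH(1) c unfolding k(2) by (simp add: m_assoc mult_ac)
    qed
    moreover have "qcomm A ?m x b \<otimes> k = (t * (u * t ^ n)) \<odot> (k \<otimes> qcomm A ?m x b)"
      by (rule qcomm_br_r[OF c(1) bc c(3) k(2) IH'(4)])
    then have "?b (Suc n) \<otimes> k = (u * t ^ Suc n) \<odot> (k \<otimes> ?b (Suc n))"
      by (simp add: b_def mult_ac)
    ultimately show ?case using IH(1) c by (blast intro: m_closed)
  qed
  from this[of "length cs"] obtain d K where "K \<in> carrier A" "qcomms (opposite A) cs (k \<otimes> x) (k' \<otimes> y) = d \<odot> (K \<otimes> qcomms A (rev cs) x y)"
    using l unfolding serre_list_def by metis
  then show ?thesis using c z by (simp add: qcomms_rev)
qed

section \<open>Serre relations in tensor squares and opposite algebras\<close>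

context tensor_alg
begin

text \<open>The second legs commute, so both terms of each commutator have the same second leg and
  the commutator acts on the first leg alone.\<close>

lemma qcomms_pt_l:
  assumes "x \<in> carrier A" "y \<in> carrier A" "w \<in> carrier B" "v \<in> carrier B" "w \<otimes>\<^bsub>B\<^esub> v = v \<otimes>\<^bsub>B\<^esub> w"
  shows "\<exists>k\<in>carrier B. w \<otimes>\<^bsub>B\<^esub> k = k \<otimes>\<^bsub>B\<^esub> w \<and> qcomms T cs (pt x w) (pt y v) = pt (qcomms A cs x y) k"
proof (induction cs)
  case (Cons c cs)
  then obtain k where k: "k \<in> carrier B" "w \<otimes>\<^bsub>B\<^esub> k = k \<otimes>\<^bsub>B\<^esub> w" "qcomms T cs (pt x w) (pt y v) = pt (qcomms A cs x y) k" by blast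
  have "qcomms T (c # cs) (pt x w) (pt y v) = pt (qcomms A (c # cs) x y) (k \<otimes>\<^bsub>B\<^esub> w)"
    using k(1,2) assms by (simp add: qcomm_def k(3) pt_mult pt_add_l pt_sm_l)
  then show ?case using k assms by (intro bexI[of _ "k \<otimes>\<^bsub>B\<^esub> w"]) (auto simp: B.m_assoc[symmetric])
qed (use assms in auto)

lemma qcomms_pt_r:
  assumes "x \<in> carrier B" "y \<in> carrier B" "w \<in> carrier A" "v \<in> carrier A" "w \<otimes>\<^bsub>A\<^esub> v = v \<otimes>\<^bsub>A\<^esub> w"
  shows "\<exists>k\<in>carrier A. w \<otimes>\<^bsub>A\<^esub> k = k \<otimes>\<^bsub>A\<^esub> w \<and> qcomms T cs (pt w x) (pt v y) = pt k (qcomms B cs x y)"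
proof (induction cs)
  case (Cons c cs)
  then obtain k where k: "k \<in> carrier A" "w \<otimes>\<^bsub>A\<^esub> k = k \<otimes>\<^bsub>A\<^esub> w" "qcomms T cs (pt w x) (pt v y) = pt k (qcomms B cs x y)" by blast
  have "qcomms T (c # cs) (pt w x) (pt v y) = pt (k \<otimes>\<^bsub>A\<^esub> w) (qcomms B (c # cs) x y)"
    using k(1,2) assms by (simp add: qcomm_def k(3) pt_mult pt_add_r pt_sm_r)
  then show ?case using k assms by (intro bexI[of _ "k \<otimes>\<^bsub>A\<^esub> w"]) (auto simp: A.m_assoc[symmetric])
qed (use assms in auto)

end

text \<open>By \<open>serre_sum\<close> the mixed terms cancel; of the two pure commutators each has
  one leg equal to the given vanishing commutator. Both g and h are kept general so that coproducts
  of either shape, e or f, fit.\<close>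

lemma serre_tensor:
  fixes A :: "('k::field, 'a, 'z) module_scheme" (structure)
  assumes A: "k_algebra A"
    and c: "x \<in> carrier A" "y \<in> carrier A" "g \<in> carrier A" "g' \<in> carrier A" "h \<in> carrier A" "h' \<in> carrier A"
    and gh: "g \<otimes> g' = g' \<otimes> g" "h \<otimes> h' = h' \<otimes> h"
  defines "a \<equiv> pure_tensor A A x h" and "b \<equiv> pure_tensor A A g x" and "c \<equiv> pure_tensor A A y h'" and "d \<equiv> pure_tensor A A g' y"
  assumes q: "b \<otimes>\<^bsub>tensor A A\<^esub> a = q \<odot>\<^bsub>tensor A A\<^esub> (a \<otimes>\<^bsub>tensor A A\<^esub> b)" "b \<otimes>\<^bsub>tensor A A\<^esub> c = p \<odot>\<^bsub>tensor A A\<^esub> (c \<otimes>\<^bsub>tensor A A\<^esub> b)"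
      "d \<otimes>\<^bsub>tensor A A\<^esub> a = p' \<odot>\<^bsub>tensor A A\<^esub> (a \<otimes>\<^bsub>tensor A A\<^esub> d)"
    and l: "serre_list q p p' cs" and z: "qcomms A cs x y = \<zero>"
  shows "qcomms (tensor A A) cs (a \<oplus>\<^bsub>tensor A A\<^esub> b) (c \<oplus>\<^bsub>tensor A A\<^esub> d) = \<zero>\<^bsub>tensor A A\<^esub>"
proof -
  interpret AA: tensor_alg A A by (simp add: tensor_alg_def A)
  interpret T: k_algebra AA.T by (rule AA.T_alg)
  have "qcomms AA.T cs a c = \<zero>\<^bsub>AA.T\<^esub>" "qcomms AA.T cs b d = \<zero>\<^bsub>AA.T\<^esub>"
    using AA.qcomms_pt_l[OF c(1,2,5,6) gh(2), of cs] AA.qcomms_pt_r[OF c(1,2,3,4) gh(1), of cs]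
    unfolding a_def b_def c_def d_def z by auto
  moreover have "a \<in> carrier AA.T" "b \<in> carrier AA.T" "c \<in> carrier AA.T" "d \<in> carrier AA.T"
    using c unfolding a_def b_def c_def d_def by auto
  ultimately show ?thesis using T.serre_sum[OF _ _ _ _ q l] by simp
qed

text \<open>The bilinearity relations do not mention the product, so the underlying spaces coincide
  and only the multiplication is reversed. As an equality of records it transfers the case of the
  e's to the f's.\<close>

lemma tensor_opposite: 
  assumes "k_algebra (A :: ('k::field, 'a) module)" "k_algebra (B :: ('k, 'b) module)"
  shows "tensor (opposite A) (opposite B) = opposite (tensor A B)"
    and "pure_tensor (opposite A) (opposite B) = pure_tensor A B"
proof -
  let ?F = "tensor_free A B" and ?F' = "tensor_free (opposite A) (opposite B)"
  have r: "tensor_rel (opposite A) (opposite B) = tensor_rel A B"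
  proof -
    have "p \<in> tensor_rel (opposite A) (opposite B)" if "p \<in> tensor_rel A B"
      for A :: "('k, 'a) module" and B :: "('k, 'b) module" and p
      using that
    proof (induction rule: tensor_rel.induct)
      case (add_left x x' y)
      then show ?case using tensor_rel.add_left[of x "opposite A" x' y "opposite B"] by simp
    next
      case (add_right x y y')
      then show ?case using tensor_rel.add_right[of x "opposite A" y "opposite B" y'] by simp
    next
      case (smult_left x y c)
      then show ?case using tensor_rel.smult_left[of x "opposite A" y "opposite B" c] by simp
    next
      case (smult_right x y c)
      then show ?case using tensor_rel.smult_right[of x "opposite A" y "opposite B" c] by simp
    qed (auto intro: tensor_rel.intros)
    from this[of _ A B] this[of _ "opposite A" "opposite B"] show ?thesis by auto
  qed
  have m: "p \<otimes>\<^bsub>?F'\<^esub> q = q \<otimes>\<^bsub>?F\<^esub> p" for p q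
  proof -
    have "u \<otimes>\<^bsub>opposite A \<times>\<times> opposite B\<^esub> v = v \<otimes>\<^bsub>A \<times>\<times> B\<^esub> u" for u v
      by (cases u; cases v) simp
    then show ?thesis by (simp add: tensor_free_def mult.commute sum.swap[of _ "keys q"])
  qed
  have cos: "(+>\<^bsub>?F'\<^esub>) = (+>\<^bsub>?F\<^esub>)"
    by (intro ext) (simp add: a_r_coset_def')
  show "tensor (opposite A) (opposite B) = opposite (tensor A B)"
  proof (rule module.equality)
    show "mult (tensor (opposite A) (opposite B)) = mult (opposite (tensor A B))"
    proof (intro ext)
      fix X Y
      have "X \<otimes>\<^bsub>quot_alg ?F' (tensor_rel A B)\<^esub> Y = Y \<otimes>\<^bsub>quot_alg ?F (tensor_rel A B)\<^esub> X"
        by (simp only: quot_alg_simps rcoset_mult_def cos m) (rule SUP_commute)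
      then show "X \<otimes>\<^bsub>tensor (opposite A) (opposite B)\<^esub> Y = X \<otimes>\<^bsub>opposite (tensor A B)\<^esub> Y"
        by (simp add: tensor_def r)
    qed
  qed (unfold tensor_def r, simp_all add: quot_alg_simps cos A_RCOSETS_def' set_add_def' opposite_def[of "quot_alg _ _"] fun_eq_iff)
  show "pure_tensor (opposite A) (opposite B) = pure_tensor A B"
    by (intro ext) (simp add: pure_tensor_def tensor_class_def r cos)
qed

subsection \<open>The free algebra\<close>

lemma free_alg_simps [simp]:
  "carrier free_alg = UNIV" "x \<otimes>\<^bsub>free_alg\<^esub> y = x * y" "\<one>\<^bsub>free_alg\<^esub> = 1" "\<zero>\<^bsub>free_alg\<^esub> = 0"
  "x \<oplus>\<^bsub>free_alg\<^esub> y = x + y" "c \<odot>\<^bsub>free_alg\<^esub> x = c \<cdot> x"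
  by (simp_all add: free_alg_def)

lemma scal_mult_l [simp]: "(c \<cdot> p) * q = c \<cdot> (p * q)" for p q :: "'k::field free"
  by (simp add: scal_def mult_map_scale_conv_mult mult.assoc)

lemma scal_mult_r [simp]: "p * (c \<cdot> q) = c \<cdot> (p * q)" for p q :: "'k::field free"
proof -
  have "keys p \<subseteq> UNIV" by simp
  \<comment> \<open>Scalar multiplication is multiplication by a constant at the empty word, which
    is central.\<close>
  then have "p * single 0 c = single 0 c * p"
    by (induction rule: keys_induct) (simp_all add: mult_single distrib_left distrib_right mult.commute)
  then show ?thesis
    unfolding scal_def mult_map_scale_conv_mult by (metis mult.assoc)
qed

lemma k_algebra_free_alg: "k_algebra (free_alg :: ('k::field, 'k free) module)"
proof (rule k_algebraI)
  show "abelian_group (free_alg :: ('k, 'k free) module)"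
    by (rule abelian_groupI) (auto simp: add_ac intro: exI[of _ "- x" for x])
qed (simp_all add: mult.assoc distrib_left distrib_right scal_distrib)

lemma free_alg_minus [simp]: "\<ominus>\<^bsub>free_alg\<^esub> x = - x"
proof -
  interpret k_algebra free_alg by (rule k_algebra_free_alg)
  show ?thesis by (rule minus_equality) auto
qed

lemma letters_zero [simp]: "letters 0 = []"
  by (simp add: zero_word_def)

abbreviation word_val :: "('k::field, 'a, 'z) module_scheme \<Rightarrow> (gen \<Rightarrow> 'a) \<Rightarrow> word \<Rightarrow> 'a" where
  "word_val A \<phi> w \<equiv> foldr (\<lambda>g a. \<phi> g \<otimes>\<^bsub>A\<^esub> a) (letters w) \<one>\<^bsub>A\<^esub>"

lemma (in k_algebra) word_val_in: "(\<And>g. \<phi> g \<in> carrier A) \<Longrightarrow> word_val A \<phi> w \<in> carrier A"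
proof -
  assume *: "\<And>g. \<phi> g \<in> carrier A"
  have "foldr (\<lambda>g a. \<phi> g \<otimes> a) ws \<one> \<in> carrier A" for ws by (induction ws) (auto simp: *)
  then show ?thesis .
qed

lemma (in k_algebra) word_val_add:
  assumes *: "\<And>g. \<phi> g \<in> carrier A"
  shows "word_val A \<phi> (v + w) = word_val A \<phi> v \<otimes> word_val A \<phi> w"
proof -
  have i: "foldr (\<lambda>g a. \<phi> g \<otimes> a) ws \<one> \<in> carrier A" for ws by (induction ws) (auto simp: *)
  have "foldr (\<lambda>g a. \<phi> g \<otimes> a) (vs @ ws) \<one> = foldr (\<lambda>g a. \<phi> g \<otimes> a) vs \<one> \<otimes> foldr (\<lambda>g a. \<phi> g \<otimes> a) ws \<one>" for vs ws
  proof (induction vs)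
    case Nil
    then show ?case using i[of ws] by simp
  next
    case (Cons g vs)
    then show ?case using i[of vs] i[of ws] by (simp add: * m_assoc del: foldr_append)
  qed
  then show ?thesis by (simp add: plus_word_def)
qed

lemma free_lift_alg_hom:
  fixes A :: "('k::field, 'a, 'z) module_scheme" (structure)
  assumes A: "k_algebra A" and \<phi>: "\<And>g. \<phi> g \<in> carrier A"
  shows "alg_hom free_alg A (free_lift A \<phi>)"
proof -
  interpret k_algebra A by (rule A)
  have b: "word_val A \<phi> \<in> UNIV \<rightarrow> carrier A" using word_val_in \<phi> by blast
  have bi: "word_val A \<phi> w \<in> carrier A" for w using word_val_in \<phi> by blast
  note l = lin_ext_add[OF b] lin_ext_scal[OF b] lin_ext_closed[OF b]
  show ?thesis unfolding free_lift_lin_ext[abs_def]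
  proof (intro alg_homI k_linearI)
    fix p q :: "'k free"
    have "keys p \<subseteq> UNIV" "keys q \<subseteq> UNIV" by auto
    then show "lin_ext A (word_val A \<phi>) (p \<otimes>\<^bsub>free_alg\<^esub> q) = lin_ext A (word_val A \<phi>) p \<otimes> lin_ext A (word_val A \<phi>) q"
    proof (induction arbitrary: q rule: keys_induct)
      case (single v c)
      show ?case using single(2)
      proof (induction rule: keys_induct)
        case (single w d)
        show ?case using bi by (simp add: mult_single lin_ext_single word_val_add \<phi> mult.commute)
      qed (simp_all add: lin_ext_single bi distrib_left l r_distr)
    qed (simp_all add: distrib_right l l_distr)
    show "lin_ext A (word_val A \<phi>) \<one>\<^bsub>free_alg\<^esub> = \<one>"
      using lin_ext_single[of "word_val A \<phi>" 0 1] by simp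
  qed (simp_all add: l)
qed

lemma free_lift_G:
  assumes A: "k_algebra A" and \<phi>: "\<And>g. \<phi> g \<in> carrier A"
  shows "free_lift A \<phi> (G g) = \<phi> g"
proof -
  interpret k_algebra A by (rule A)
  show ?thesis using lin_ext_single[of "word_val A \<phi>" "Word [g]" 1] \<phi>
    by (simp add: free_lift_lin_ext G_def)
qed

lemma subalg_free_alg:
  assumes W: "subalg (free_alg :: ('k::field, 'k free) module) W" and G: "\<And>g. G g \<in> W"
  shows "p \<in> W"
proof -
  interpret k_algebra "free_alg :: ('k, 'k free) module" by (rule k_algebra_free_alg)
  note W' = W[unfolded subalg_iff, simplified]
  have w: "single w 1 \<in> W" for w
  proof -
    have "single (Word ws) 1 \<in> W" for ws
    proof (induction ws)
      case Nil
      have "(1 :: 'k free) = single (Word []) 1" by (simp flip: single_one add: zero_word_def)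
      then show ?case using W' by simp
    next
      case (Cons g ws)
      have "single (Word (g # ws)) (1::'k) = G g * single (Word ws) 1"
        by (simp add: G_def mult_single plus_word_def)
      then show ?case using Cons W' G by simp
    qed
    then show ?thesis by (metis word.exhaust)
  qed
  have "keys p \<subseteq> UNIV" by simp
  then show ?thesis
  proof (induction rule: keys_induct)
    case zero
    have "0 \<cdot> (1 :: 'k free) \<in> W" using W' by blast
    then show ?case by simp
  next
    case (single u c)
    then show ?case using w W' single_scal[of u c] by metis
  qed (use W' in auto)
qed

lemma alg_hom_kernel_ideal:
  assumes "k_algebra A" "k_algebra B" "alg_hom A B f"
  shows "ideal {x \<in> carrier A. f x = \<zero>\<^bsub>B\<^esub>} A"
proof -
  interpret A: k_algebra A by fact
  interpret B: k_algebra B by fact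
  note f = alg_homD[OF assms(3)]
  have "submodule {x \<in> carrier A. f x = \<zero>\<^bsub>B\<^esub>} base A"
    unfolding A.subm_iff using f k_linear_zero[OF assms(1,2) f(1)] by auto
  then have "subgroup {x \<in> carrier A. f x = \<zero>\<^bsub>B\<^esub>} (add_monoid A)" by (simp add: submodule_def)
  then show ?thesis by (intro idealI A.ring_axioms) (auto simp: f)
qed

subsection \<open>Realizations of the defining relations\<close>

text \<open>Here p = s^3 and q = r/s for the first list, p = r^(-3) and q = (r/s)^3 for the second,
  listed as p q^k with k descending to 0.\<close>

abbreviation "serre_list1 r s \<equiv> [r^3, r^2 * s, r * s^2, s^3]"
abbreviation "serre_list2 r s \<equiv> [inverse (s^3), inverse (r^3)]"

lemma serre_list1: 
  assumes "r \<noteq> 0" "s \<noteq> 0"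
  shows "serre_list (pairing r s I1 I1) (pairing r s I2 I1) (pairing r s I1 I2) (serre_list1 r s)"
  using assms by (simp add: serre_list_def numeral_eq_Suc field_simps)

lemma serre_list2: 
  assumes "r \<noteq> 0" "s \<noteq> 0"
  shows "serre_list (pairing r s I2 I2) (pairing r s I1 I2) (pairing r s I2 I1) (serre_list2 r s)"
  using assms by (simp add: serre_list_def numeral_eq_Suc field_simps)

lemma scal_uminus_l: "(- c) \<cdot> p = - (c \<cdot> p)"
  by (rule poly_mapping_eqI) simp

text \<open>Expanding commuting operators of the form left minus scalar times right multiplication
  gives the elementary symmetric polynomials of the scalars; in the opposite algebra left and right
  exchange roles.\<close>

lemma qcomms_free:
  fixes x y :: "'k::field free"
  defines "M \<equiv> \<lambda>i j. x ^ i * y * x ^ j"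
  shows "qcomms free_alg [b, a] x y = M 2 0 - (b + a) \<cdot> M 1 1 + (b * a) \<cdot> M 0 2"
    "qcomms (opposite free_alg) [b, a] x y = M 0 2 - (b + a) \<cdot> M 1 1 + (b * a) \<cdot> M 2 0"
    "qcomms free_alg [d, c, b, a] x y = M 4 0 - (a + b + c + d) \<cdot> M 3 1
    + (a * b + a * c + a * d + b * c + b * d + c * d) \<cdot> M 2 2
    - (a * b * c + a * b * d + a * c * d + b * c * d) \<cdot> M 1 3 + (a * b * c * d) \<cdot> M 0 4"
    "qcomms (opposite free_alg) [d, c, b, a] x y = M 0 4 - (a + b + c + d) \<cdot> M 1 3
    + (a * b + a * c + a * d + b * c + b * d + c * d) \<cdot> M 2 2
    - (a * b * c + a * b * d + a * c * d + b * c * d) \<cdot> M 3 1 + (a * b * c * d) \<cdot> M 4 0"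
proof -
  \<comment> \<open>With y written as M 0 0 every multiplication by x is a shift of an index, and
    comparing coefficients leaves identities in the field.\<close>
  have M: "x * M i j = M (Suc i) j" "M i j * x = M i (Suc j)" "y = M 0 0" for i j
    by (simp_all add: M_def mult.assoc power_commutes)
  have f: "qcomm free_alg c x z = x * z - c \<cdot> (z * x)" "qcomm (opposite free_alg) c x z = z * x - c \<cdot> (x * z)" for c z
    by (simp_all add: qcomm_def scal_uminus_l)
  note e = qcomms.simps f M(1,2) left_diff_distrib right_diff_distrib scal_mult_l scal_mult_r scal_distrib(2) scal_simps(5)
  note l = lookup_add lookup_minus lookup_scal numeral_eq_Suc pred_numeral_simps BitM.simps One_nat_def algebra_simps
  show "qcomms free_alg [b, a] x y = M 2 0 - (b + a) \<cdot> M 1 1 + (b * a) \<cdot> M 0 2"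
    by (subst M(3), simp only: e, rule poly_mapping_eqI) (simp add: l)
  show "qcomms (opposite free_alg) [b, a] x y = M 0 2 - (b + a) \<cdot> M 1 1 + (b * a) \<cdot> M 2 0"
    by (subst M(3), simp only: e, rule poly_mapping_eqI) (simp add: l)
  show "qcomms free_alg [d, c, b, a] x y = M 4 0 - (a + b + c + d) \<cdot> M 3 1
    + (a * b + a * c + a * d + b * c + b * d + c * d) \<cdot> M 2 2
    - (a * b * c + a * b * d + a * c * d + b * c * d) \<cdot> M 1 3 + (a * b * c * d) \<cdot> M 0 4"
    by (subst M(3), simp only: e, rule poly_mapping_eqI) (simp add: l)
  show "qcomms (opposite free_alg) [d, c, b, a] x y = M 0 4 - (a + b + c + d) \<cdot> M 1 3
    + (a * b + a * c + a * d + b * c + b * d + c * d) \<cdot> M 2 2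
    - (a * b * c + a * b * d + a * c * d + b * c * d) \<cdot> M 3 1 + (a * b * c * d) \<cdot> M 4 0"
    by (subst M(3), simp only: e, rule poly_mapping_eqI) (simp add: l)
qed

lemma rels_serre:
  "rels_G5 r s = {qcomms free_alg (serre_list2 r s) (G (gE I2)) (G (gE I1)), qcomms free_alg (serre_list1 r s) (G (gE I1)) (G (gE I2))}"
  "rels_G6 r s = {qcomms (opposite free_alg) (serre_list2 r s) (G (gF I2)) (G (gF I1)),
     qcomms (opposite free_alg) (serre_list1 r s) (G (gF I1)) (G (gF I2))}"
proof -
  have 2: "inverse (r ^ 3) + inverse (s ^ 3) = inverse (s^3) + inverse (r^3)" "inverse ((r * s) ^ 3) = inverse (s^3) * inverse (r^3)"
    by (simp_all add: power_mult_distrib)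
  \<comment> \<open>The coefficients of the quartic relation are the elementary symmetric
    polynomials of r^3, r^2 s, r s^2, s^3.\<close>
  have 4: "(r + s) * (r^2 + s^2) = s^3 + r * s^2 + r^2 * s + r^3"
    "r * s * (r^2 + s^2) * (r^2 + r*s + s^2) = s^3 * (r * s^2) + s^3 * (r^2 * s) + s^3 * r^3 + r * s^2 * (r^2 * s) + r * s^2 * r^3 + r^2 * s * r^3"
    "(r*s)^3 * (r + s) * (r^2 + s^2) = s^3 * (r * s^2) * (r^2 * s) + s^3 * (r * s^2) * r^3 + s^3 * (r^2 * s) * r^3 + r * s^2 * (r^2 * s) * r^3"
    "(r*s)^6 = s^3 * (r * s^2) * (r^2 * s) * r^3"
    by (simp_all add: algebra_simps eval_nat_numeral)
  show "rels_G5 r s = {qcomms free_alg (serre_list2 r s) (G (gE I2)) (G (gE I1)), qcomms free_alg (serre_list1 r s) (G (gE I1)) (G (gE I2))}"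
    unfolding rels_G5_def Let_def 2 4 qcomms_free by simp
  show "rels_G6 r s = {qcomms (opposite free_alg) (serre_list2 r s) (G (gF I2)) (G (gF I1)),
     qcomms (opposite free_alg) (serre_list1 r s) (G (gF I1)) (G (gF I2))}"
    unfolding rels_G6_def Let_def 2 4 qcomms_free by simp
qed


text \<open>Values in \<open>A\<close> for the generators that satisfy the relations. Conjugations
  are written as commutation rules and Serre relations as vanishing iterated q-commutators, the
  forms that pass to opposite algebras and tensor squares.\<close>

locale G2_rep = k_algebra A for A :: "('k::field, 'a) module" (structure) +
  fixes \<phi> :: "gen \<Rightarrow> 'a" and r s :: 'k
  assumes r0: "r \<noteq> 0" and s0: "s \<noteq> 0"
    and \<phi>_in [simp]: "\<phi> g \<in> carrier A"
    and toral_comm: "\<lbrakk>g \<in> toral; h \<in> toral\<rbrakk> \<Longrightarrow> \<phi> g \<otimes> \<phi> h = \<phi> h \<otimes> \<phi> g"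
    and W_inv: "\<phi> (gW i) \<otimes> \<phi> (gWinv i) = \<one>" and W'_inv: "\<phi> (gW' i) \<otimes> \<phi> (gW'inv i) = \<one>"
    and WE: "\<phi> (gW j) \<otimes> \<phi> (gE i) = pairing r s i j \<odot> (\<phi> (gE i) \<otimes> \<phi> (gW j))"
    and WF: "\<phi> (gW j) \<otimes> \<phi> (gF i) = inverse (pairing r s i j) \<odot> (\<phi> (gF i) \<otimes> \<phi> (gW j))"
    and W'E: "\<phi> (gW' j) \<otimes> \<phi> (gE i) = inverse (pairing r s j i) \<odot> (\<phi> (gE i) \<otimes> \<phi> (gW' j))"
    and W'F: "\<phi> (gW' j) \<otimes> \<phi> (gF i) = pairing r s j i \<odot> (\<phi> (gF i) \<otimes> \<phi> (gW' j))"
    and EF: "\<phi> (gE i) \<otimes> \<phi> (gF j) = \<phi> (gF j) \<otimes> \<phi> (gE i) \<oplus>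
      (if i = j then inverse (param r i - param s i) else 0) \<odot> (\<phi> (gW i) \<oplus> (- 1) \<odot> \<phi> (gW' i))"
    and serre_E1: "qcomms A (serre_list1 r s) (\<phi> (gE I1)) (\<phi> (gE I2)) = \<zero>"
    and serre_E2: "qcomms A (serre_list2 r s) (\<phi> (gE I2)) (\<phi> (gE I1)) = \<zero>"
    and serre_F1: "qcomms (opposite A) (serre_list1 r s) (\<phi> (gF I1)) (\<phi> (gF I2)) = \<zero>"
    and serre_F2: "qcomms (opposite A) (serre_list2 r s) (\<phi> (gF I2)) (\<phi> (gF I1)) = \<zero>"

lemma toral_simps [simp]: "gW i \<in> toral" "gWinv i \<in> toral" "gW' i \<in> toral" "gW'inv i \<in> toral"
  "gE i \<notin> toral" "gF i \<notin> toral"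
  by (auto simp: toral_def)

lemma toral_cases [consumes 1]:
  assumes "g \<in> toral"
  obtains i where "g = gW i" | i where "g = gWinv i" | i where "g = gW' i" | i where "g = gW'inv i"
  using assms by (auto simp: toral_def)

definition G2_rels :: "'k::field \<Rightarrow> 'k \<Rightarrow> 'k free set" where
  "G2_rels r s = rels_G1 \<union> rels_G2 r s \<union> rels_G3 r s \<union> rels_G4 r s \<union> rels_G5 r s \<union> rels_G6 r s"

lemma pairing_nz: "r \<noteq> 0 \<Longrightarrow> s \<noteq> 0 \<Longrightarrow> pairing r s i j \<noteq> 0"
  by (cases i; cases j) auto

context
  fixes A :: "('k::field, 'a) module" (structure) and h :: "'k free \<Rightarrow> 'a" and r s :: 'k
  assumes A: "k_algebra A" and h: "alg_hom free_alg A h" and rs0: "r \<noteq> 0" "s \<noteq> 0"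
begin

interpretation k_algebra A by (rule A)

private lemma h_simps:
  "h p \<in> carrier A" "h (p + q) = h p \<oplus> h q" "h (p * q) = h p \<otimes> h q" "h (c \<cdot> p) = c \<odot> h p" "h 1 = \<one>"
  "h (p - q) = h p \<ominus> h q"
proof -
  note a = alg_homD[OF h]
  show "h p \<in> carrier A" "h (p + q) = h p \<oplus> h q" "h (p * q) = h p \<otimes> h q" "h (c \<cdot> p) = c \<odot> h p" "h 1 = \<one>"
    using a(2-6)[simplified] by auto
  have "h (p + (- 1) \<cdot> q) = h p \<oplus> (- 1) \<odot> h q" using a(2-6)[simplified] by simp
  then show "h (p - q) = h p \<ominus> h q"
    using a(2)[simplified] by (simp add: scal_uminus_l minus_eq uminus_sm)
qed

private lemma h_brs: "h (qcomms free_alg cs x y) = qcomms A cs (h x) (h y)"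
proof (induction cs)
  case (Cons c cs)
  then show ?case using alg_hom_br[OF k_algebra_free_alg h] by simp
qed simp

private lemma h_brs_opp: "h (qcomms (opposite free_alg) cs x y) = qcomms (opposite A) cs (h x) (h y)"
proof (induction cs)
  case (Cons c cs)
  then show ?case using alg_hom_br[OF k_algebra_opposite[OF k_algebra_free_alg] alg_hom_opposite[OF h]] by simp
qed simp

lemma rels_zero_imp_G2_rep:
  assumes z: "\<And>p. p \<in> G2_rels r s \<Longrightarrow> h p = \<zero>"
  shows "G2_rep A (\<lambda>g. h (G g)) r s"
proof -
  have G1: "h (G g * G g') = h (G g' * G g)" if "g \<in> toral" "g' \<in> toral" for g g'
  proof -
    have "G g * G g' - G g' * G g \<in> G2_rels r s" using that by (auto simp: G2_rels_def rels_G1_def)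
    from z[OF this] show ?thesis by (simp add: h_simps(6)) (simp add: diff_zero_iff h_simps)
  qed
  have inv: "h (G (gW i)) \<otimes> h (G (gWinv i)) = \<one>" "h (G (gW' i)) \<otimes> h (G (gW'inv i)) = \<one>" for i
  proof -
    have "G (gW i) * G (gWinv i) - 1 \<in> G2_rels r s" "G (gW' i) * G (gW'inv i) - 1 \<in> G2_rels r s"
      by (auto simp: G2_rels_def rels_G1_def)
    from this[THEN z] show "h (G (gW i)) \<otimes> h (G (gWinv i)) = \<one>" "h (G (gW' i)) \<otimes> h (G (gW'inv i)) = \<one>"
      by (simp_all add: h_simps diff_zero_iff)
  qed
  have key: "h (G g) \<otimes> h (G x) = c \<odot> (h (G x) \<otimes> h (G g))"
    if m: "G g * G x * G gi - c \<cdot> G x \<in> G2_rels r s" and i: "h (G g) \<otimes> h (G gi) = \<one>" and t: "g \<in> toral" "gi \<in> toral" for g x gi c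
  proof -
    have "h (G g) \<otimes> h (G x) \<otimes> h (G gi) = c \<odot> h (G x)"
      using z[OF m] by (simp add: h_simps diff_zero_iff)
    \<comment> \<open>Only a right inverse is imposed by the relations; commutativity of the toral
      generators makes it two-sided, so it can be cancelled.\<close>
    moreover have "h (G gi) \<otimes> h (G g) = \<one>" using G1[OF t] i by (simp add: h_simps)
    then have "h (G g) \<otimes> h (G x) \<otimes> h (G gi) \<otimes> h (G g) = h (G g) \<otimes> h (G x)" by (simp add: h_simps m_assoc)
    ultimately show ?thesis by (simp add: h_simps)
  qed
  show ?thesis
  proof unfold_locales
    fix i j
    show "h (G (gE i)) \<otimes> h (G (gF j)) = h (G (gF j)) \<otimes> h (G (gE i)) \<oplus>
      (if i = j then inverse (param r i - param s i) else 0) \<odot> (h (G (gW i)) \<oplus> (- 1) \<odot> h (G (gW' i)))"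
    proof -
      let ?k = "if i = j then inverse (param r i - param s i) else 0"
      have "G (gE i) * G (gF j) - G (gF j) * G (gE i) - ?k \<cdot> (G (gW i) - G (gW' i)) \<in> G2_rels r s"
        by (cases "i = j") (auto simp: G2_rels_def rels_G4_def)
      from z[OF this] have "h (G (gE i) * G (gF j) - (G (gF j) * G (gE i) + ?k \<cdot> (G (gW i) - G (gW' i)))) = \<zero>"
        by (simp add: diff_diff_add)
      then have "h (G (gE i)) \<otimes> h (G (gF j)) = h (G (gF j)) \<otimes> h (G (gE i)) \<oplus> ?k \<odot> (h (G (gW i)) \<ominus> h (G (gW' i)))"
        unfolding h_simps(2-6) by (subst (asm) diff_zero_iff) (simp_all add: h_simps(1))
      then show ?thesis by (simp only: minus_eq uminus_sm h_simps(1))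
    qed
    show "h (G (gW j)) \<otimes> h (G (gE i)) = pairing r s i j \<odot> (h (G (gE i)) \<otimes> h (G (gW j)))"
      by (rule key[OF _ inv(1)]) (auto simp: G2_rels_def rels_G2_def)
    show "h (G (gW j)) \<otimes> h (G (gF i)) = inverse (pairing r s i j) \<odot> (h (G (gF i)) \<otimes> h (G (gW j)))"
      by (rule key[OF _ inv(1)]) (auto simp: G2_rels_def rels_G2_def)
    show "h (G (gW' j)) \<otimes> h (G (gE i)) = inverse (pairing r s j i) \<odot> (h (G (gE i)) \<otimes> h (G (gW' j)))"
      by (rule key[OF _ inv(2)]) (auto simp: G2_rels_def rels_G3_def)
    show "h (G (gW' j)) \<otimes> h (G (gF i)) = pairing r s j i \<odot> (h (G (gF i)) \<otimes> h (G (gW' j)))"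
      by (rule key[OF _ inv(2)]) (auto simp: G2_rels_def rels_G3_def)
  qed (use rs0 inv G1 z in \<open>auto simp: h_simps(1,3) G2_rels_def rels_serre h_brs[symmetric] h_brs_opp[symmetric] simp del: qcomms.simps\<close>)
qed

lemma G2_rep_imp_rels_zero:
  assumes "G2_rep A (\<lambda>g. h (G g)) r s" and p: "p \<in> G2_rels r s"
  shows "h p = \<zero>"
proof -
  interpret R: G2_rep A "\<lambda>g. h (G g)" r s by fact
  have z: "x \<ominus> y = \<zero>" if "x \<in> carrier A" "x = y" for x y
    using that diff_zero_iff by simp
  have key: "h (G g * G x * G gi - c \<cdot> G x) = \<zero>"
    if "h (G g) \<otimes> h (G x) = c \<odot> (h (G x) \<otimes> h (G g))" "h (G g) \<otimes> h (G gi) = \<one>" for g x gi c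
  proof -
    have "h (G g) \<otimes> h (G x) \<otimes> h (G gi) = c \<odot> h (G x)"
      unfolding that(1) using that(2) by (simp add: h_simps m_assoc)
    then show ?thesis by (simp add: h_simps z)
  qed
  consider "p \<in> rels_G1" | "p \<in> rels_G2 r s" | "p \<in> rels_G3 r s" | "p \<in> rels_G4 r s" | "p \<in> rels_G5 r s" | "p \<in> rels_G6 r s"
    using p by (auto simp: G2_rels_def)
  then show ?thesis
  proof cases
    case 1
    then show ?thesis by (auto simp: rels_G1_def h_simps R.W_inv R.W'_inv intro!: z R.toral_comm)
  next
    case 2
    then show ?thesis by (auto simp: rels_G2_def intro!: key R.WE R.WF R.W_inv)
  next
    case 3
    then show ?thesis by (auto simp: rels_G3_def intro!: key R.W'E R.W'F R.W'_inv)
  next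
    case 4
    then obtain i j where e: "p = G (gE i) * G (gF j) - G (gF j) * G (gE i)
        - (if i = j then inverse (param r i - param s i) \<cdot> (G (gW i) - G (gW' i)) else 0)" by (auto simp: rels_G4_def)
    let ?k = "if i = j then inverse (param r i - param s i) else 0"
    have "p = G (gE i) * G (gF j) - (G (gF j) * G (gE i) + ?k \<cdot> (G (gW i) - G (gW' i)))"
      by (simp add: e diff_diff_add)
    then have "h p = h (G (gE i)) \<otimes> h (G (gF j)) \<ominus> (h (G (gF j)) \<otimes> h (G (gE i)) \<oplus> ?k \<odot> (h (G (gW i)) \<oplus> (- 1) \<odot> h (G (gW' i))))"
      by (simp only: h_simps(2-6)) (simp only: minus_eq uminus_sm h_simps(1))
    then show ?thesis using R.EF[of i j] by (simp only:) (intro z; simp add: h_simps)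
  next
    case 5
    then show ?thesis using R.serre_E1 R.serre_E2 by (auto simp: rels_serre h_brs simp del: qcomms.simps)
  next
    case 6
    then show ?thesis using R.serre_F1 R.serre_F2 by (auto simp: rels_serre h_brs_opp simp del: qcomms.simps)
  qed
qed

end

section \<open>The universal property of U\<close>

lemma G2_rep_free_lift_zero:
  fixes A :: "('k::field, 'a) module"
  assumes "G2_rep A \<phi> r s" "p \<in> U_ideal r s"
  shows "free_lift A \<phi> p = \<zero>\<^bsub>A\<^esub>"
proof -
  interpret R: G2_rep A \<phi> r s by fact
  interpret F: k_algebra "free_alg :: ('k, 'k free) module" by (rule k_algebra_free_alg)
  note A = R.k_algebra_axioms
  have l: "alg_hom free_alg A (free_lift A \<phi>)" by (rule free_lift_alg_hom[OF A]) simp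
  have "(\<lambda>g. free_lift A \<phi> (G g)) = \<phi>" by (rule ext, rule free_lift_G[OF A]) simp
  then have "free_lift A \<phi> p = \<zero>\<^bsub>A\<^esub>" if "p \<in> G2_rels r s" for p
    using G2_rep_imp_rels_zero[OF A l R.r0 R.s0 _ that] assms(1) by simp
  then have "Idl\<^bsub>free_alg\<^esub> (G2_rels r s) \<subseteq> {x \<in> carrier free_alg. free_lift A \<phi> x = \<zero>\<^bsub>A\<^esub>}"
    by (intro F.genideal_minimal alg_hom_kernel_ideal[OF k_algebra_free_alg A l]) auto
  then show ?thesis using assms(2) by (auto simp: U_ideal_def G2_rels_def)
qed

lemma quot_algebra_U: "quot_algebra (free_alg :: ('k::field, 'k free) module) (U_ideal r s)"
proof -
  interpret F: k_algebra "free_alg :: ('k, 'k free) module" by (rule k_algebra_free_alg)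
  have "ideal (U_ideal r s) free_alg" unfolding U_ideal_def by (rule F.genideal_ideal) simp
  then show ?thesis by (simp add: quot_algebra_def k_algebra_free_alg)
qed

lemma U_proj_alg_hom: "alg_hom free_alg (U_alg r s) (U_proj r s)"
proof -
  interpret quot_algebra free_alg "U_ideal r s" by (rule quot_algebra_U)
  show ?thesis using alg_hom_\<pi> by (simp add: U_alg_def U_proj_def[abs_def])
qed

lemma k_algebra_U: "k_algebra (U_alg r s)"
  using quot_algebra.k_algebra_Q[OF quot_algebra_U] by (simp add: U_alg_def)

lemma G2_rep_U:
  assumes "r \<noteq> 0" "s \<noteq> 0"
  shows "G2_rep (U_alg r s) (\<lambda>g. U_proj r s (G g)) r s"
proof (rule rels_zero_imp_G2_rep[OF k_algebra_U U_proj_alg_hom assms])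
  fix p assume "p \<in> G2_rels r s"
  interpret Q: quot_algebra free_alg "U_ideal r s" by (rule quot_algebra_U)
  have "p \<in> U_ideal r s"
    using Q.genideal_self[of "G2_rels r s"] \<open>p \<in> G2_rels r s\<close> by (auto simp: U_ideal_def G2_rels_def)
  then show "U_proj r s p = \<zero>\<^bsub>U_alg r s\<^esub>"
    using Q.\<pi>_zero_iff[of p] by (simp add: U_alg_def U_proj_def)
qed

text \<open>Instantiated with the tensor square, the ground field and the opposite algebra, this
  produces coproduct, counit and antipode in the very form in which \<open>U_hopf\<close> defines
  them.\<close>

lemma U_alg_hom_factor:
  assumes "G2_rep A \<phi> r s"
  shows "alg_hom (U_alg r s) A (\<lambda>X. free_lift A \<phi> (SOME p. p \<in> X))"
    and "free_lift A \<phi> (SOME p. p \<in> U_proj r s (G g)) = \<phi> g"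
proof -
  interpret R: G2_rep A \<phi> r s by fact
  interpret Q: quot_algebra free_alg "U_ideal r s" by (rule quot_algebra_U)
  note A = R.k_algebra_axioms
  have l: "alg_hom free_alg A (free_lift A \<phi>)" by (rule free_lift_alg_hom[OF A]) simp
  note z = G2_rep_free_lift_zero[OF assms]
  show "alg_hom (U_alg r s) A (\<lambda>X. free_lift A \<phi> (SOME p. p \<in> X))"
    unfolding U_alg_def by (rule Q.alg_hom_factor[OF A l z])
  show "free_lift A \<phi> (SOME p. p \<in> U_proj r s (G g)) = \<phi> g"
    using Q.k_linear_factor(2)[OF A alg_homD(1)[OF l] z, of "G g"] free_lift_G[OF A, of \<phi> g]
    by (simp add: U_proj_def)
qed

text \<open>The formulas are stated over any algebra with chosen generators, so that they serve for
  U and for its restricted quotient.\<close>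

fun comult_gen :: "('k::field, 'a) module \<Rightarrow> (gen \<Rightarrow> 'a) \<Rightarrow> gen \<Rightarrow> (('a \<times> 'a) \<Rightarrow>\<^sub>0 'k) set" where
  "comult_gen A \<phi> (gE i) = pure_tensor A A (\<phi> (gE i)) \<one>\<^bsub>A\<^esub> \<oplus>\<^bsub>tensor A A\<^esub> pure_tensor A A (\<phi> (gW i)) (\<phi> (gE i))"
| "comult_gen A \<phi> (gF i) = pure_tensor A A \<one>\<^bsub>A\<^esub> (\<phi> (gF i)) \<oplus>\<^bsub>tensor A A\<^esub> pure_tensor A A (\<phi> (gF i)) (\<phi> (gW' i))"
| "comult_gen A \<phi> g = pure_tensor A A (\<phi> g) (\<phi> g)"

fun antipode_gen :: "('k::field, 'a) module \<Rightarrow> (gen \<Rightarrow> 'a) \<Rightarrow> gen \<Rightarrow> 'a" where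
  "antipode_gen A \<phi> (gE i) = (- 1) \<odot>\<^bsub>A\<^esub> (\<phi> (gWinv i) \<otimes>\<^bsub>A\<^esub> \<phi> (gE i))"
| "antipode_gen A \<phi> (gF i) = (- 1) \<odot>\<^bsub>A\<^esub> (\<phi> (gF i) \<otimes>\<^bsub>A\<^esub> \<phi> (gW'inv i))"
| "antipode_gen A \<phi> (gW i) = \<phi> (gWinv i)"
| "antipode_gen A \<phi> (gWinv i) = \<phi> (gW i)"
| "antipode_gen A \<phi> (gW' i) = \<phi> (gW'inv i)"
| "antipode_gen A \<phi> (gW'inv i) = \<phi> (gW' i)"

lemma (in k_algebra) qcomms_zero [simp]: "x \<in> carrier A \<Longrightarrow> qcomms A cs x \<zero> = \<zero>"
  by (induction cs) auto

text \<open>Removes the sign -1 that the antipode puts on e and f.\<close>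

lemma (in k_algebra) qcomms_sm_l:
  "\<lbrakk>x \<in> carrier A; y \<in> carrier A\<rbrakk> \<Longrightarrow> qcomms A cs (c \<odot> x) y = c ^ length cs \<odot> qcomms A cs x y"
proof (induction cs)
  case (Cons d cs)
  have "qcomm A d (c \<odot> x) z = c \<odot> qcomm A d x z" if "z \<in> carrier A" for z
    using that Cons(2) by (simp add: qcomm_def sm_add_r mult.commute)
  then show ?case using Cons by (simp add: qcomm_sm mult.commute)
qed simp

lemma G2_rep_base:
  fixes r s :: "'k::field"
  assumes "r \<noteq> 0" "s \<noteq> 0"
  shows "G2_rep (base :: ('k, 'k) module) U_counit_gen r s"
proof -
  interpret k_algebra "base :: ('k, 'k) module" by (rule k_algebra_base)
  interpret O: k_algebra "opposite (base :: ('k, 'k) module)" by (rule k_algebra_opposite[OF k_algebra_base])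
  have "qcomms base cs (0::'k) 0 = 0" "qcomms (opposite base) cs (0::'k) 0 = 0" for cs
    using qcomms_zero[of 0 cs] O.qcomms_zero[of 0 cs] by auto
  then show ?thesis
    by unfold_locales (use assms in \<open>auto simp: simp del: qcomms.simps\<close>)
qed

section \<open>Antipode and coproduct respect the relations\<close>

context G2_rep
begin

abbreviation "\<sigma> \<equiv> antipode_gen A \<phi>"
abbreviation "\<delta> \<equiv> comult_gen A \<phi>"


lemma inv_W: "\<phi> (gWinv i) \<otimes> \<phi> (gW i) = \<one>" "\<phi> (gW'inv i) \<otimes> \<phi> (gW' i) = \<one>"
  using toral_comm[of "gW i" "gWinv i"] toral_comm[of "gW' i" "gW'inv i"] W_inv W'_inv by auto

lemma inv_commute:
  assumes "w \<otimes> x = c \<odot> (x \<otimes> w)" "w \<otimes> v = \<one>" "v \<otimes> w = \<one>" "c \<noteq> 0"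
    "w \<in> carrier A" "v \<in> carrier A" "x \<in> carrier A"
  shows "x \<otimes> v = c \<odot> (v \<otimes> x)" "v \<otimes> x = inverse c \<odot> (x \<otimes> v)"
proof -
  have "x \<otimes> v = v \<otimes> w \<otimes> x \<otimes> v" using assms(3,5-7) by simp
  also have "\<dots> = v \<otimes> (w \<otimes> x) \<otimes> v" using assms(5-7) by (simp add: m_assoc)
  also have "\<dots> = c \<odot> (v \<otimes> x \<otimes> (w \<otimes> v))" unfolding assms(1) using assms(5-7) by (simp add: m_assoc)
  finally show "x \<otimes> v = c \<odot> (v \<otimes> x)" using assms by simp
  then show "v \<otimes> x = inverse c \<odot> (x \<otimes> v)" using assms(4-7) by simp
qed

lemmas pnz = pairing_nz[OF r0 s0]

lemma EWinv: "\<phi> (gE i) \<otimes> \<phi> (gWinv j) = pairing r s i j \<odot> (\<phi> (gWinv j) \<otimes> \<phi> (gE i))"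
  by (rule inv_commute(1)[OF WE W_inv inv_W(1) pnz]) auto

lemma FWinv: "\<phi> (gF i) \<otimes> \<phi> (gWinv j) = inverse (pairing r s i j) \<odot> (\<phi> (gWinv j) \<otimes> \<phi> (gF i))"
  by (rule inv_commute(1)[OF WF W_inv inv_W(1)]) (auto simp: pnz)

lemma EW'inv: "\<phi> (gE i) \<otimes> \<phi> (gW'inv j) = inverse (pairing r s j i) \<odot> (\<phi> (gW'inv j) \<otimes> \<phi> (gE i))"
  by (rule inv_commute(1)[OF W'E W'_inv inv_W(2)]) (auto simp: pnz)

lemma W'invE: "\<phi> (gW'inv j) \<otimes> \<phi> (gE i) = pairing r s j i \<odot> (\<phi> (gE i) \<otimes> \<phi> (gW'inv j))"
  using inv_commute(2)[OF W'E W'_inv inv_W(2)] pnz by simp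

lemma FW'inv: "\<phi> (gF i) \<otimes> \<phi> (gW'inv j) = pairing r s j i \<odot> (\<phi> (gW'inv j) \<otimes> \<phi> (gF i))"
  by (rule inv_commute(1)[OF W'F W'_inv inv_W(2) pnz]) auto

lemma W'invF: "\<phi> (gW'inv j) \<otimes> \<phi> (gF i) = inverse (pairing r s j i) \<odot> (\<phi> (gF i) \<otimes> \<phi> (gW'inv j))"
  by (rule inv_commute(2)[OF W'F W'_inv inv_W(2) pnz]) auto

lemma antipode_gen_in: "\<sigma> g \<in> carrier A"
  by (cases g) auto

lemma antipode_gen_toral: "g \<in> toral \<Longrightarrow> \<exists>g'\<in>toral. \<sigma> g = \<phi> g'"
  by (erule toral_cases) force+

text \<open>Moving f past the inverse of \<omega> and the inverse of \<omega>' past e costs mutually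
  inverse scalars.\<close>

lemma antipode_EF:
  "\<phi> (gF j) \<otimes> \<phi> (gW'inv j) \<otimes> (\<phi> (gWinv i) \<otimes> \<phi> (gE i)) = \<phi> (gWinv i) \<otimes> (\<phi> (gF j) \<otimes> \<phi> (gE i)) \<otimes> \<phi> (gW'inv j)"
proof -
  let ?p = "pairing r s j i"
  have "\<phi> (gF j) \<otimes> \<phi> (gW'inv j) \<otimes> (\<phi> (gWinv i) \<otimes> \<phi> (gE i)) =
     \<phi> (gF j) \<otimes> (\<phi> (gW'inv j) \<otimes> \<phi> (gWinv i)) \<otimes> \<phi> (gE i)" by (simp add: m_assoc)
  also have "\<phi> (gW'inv j) \<otimes> \<phi> (gWinv i) = \<phi> (gWinv i) \<otimes> \<phi> (gW'inv j)" by (rule toral_comm) auto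
  also have "\<phi> (gF j) \<otimes> (\<phi> (gWinv i) \<otimes> \<phi> (gW'inv j)) \<otimes> \<phi> (gE i) =
    (\<phi> (gF j) \<otimes> \<phi> (gWinv i)) \<otimes> (\<phi> (gW'inv j) \<otimes> \<phi> (gE i))" by (simp add: m_assoc)
  also have "\<dots> = (inverse ?p * ?p) \<odot> (\<phi> (gWinv i) \<otimes> \<phi> (gF j) \<otimes> (\<phi> (gE i) \<otimes> \<phi> (gW'inv j)))"
    unfolding FWinv W'invE by (simp add: mult.commute)
  also have "inverse ?p * ?p = 1" by (rule left_inverse[OF pnz])
  finally show ?thesis by (simp add: m_assoc)
qed

lemma G2_rep_opposite: "G2_rep (opposite A) (\<sigma>) r s"
proof -
  interpret O: k_algebra "opposite A" by (rule k_algebra_opposite[OF k_algebra_axioms])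
  have 1: "qcomms (opposite A) cs (\<sigma> (gE i)) (\<sigma> (gE j)) = \<zero>"
    if "qcomms A cs (\<phi> (gE i)) (\<phi> (gE j)) = \<zero>" "serre_list (pairing r s i i) (pairing r s j i) (pairing r s i j) cs" for cs i j
  proof -
    have "qcomms (opposite A) cs (\<phi> (gWinv i) \<otimes> \<phi> (gE i)) (\<phi> (gWinv j) \<otimes> \<phi> (gE j)) = \<zero>"
      by (rule serre_opposite[OF k_algebra_axioms _ _ _ _ _ EWinv EWinv EWinv pnz pnz _ that(2,1)])
        (auto intro: toral_comm)
    then show ?thesis
      using O.qcomms_sm_l[of "\<phi> (gWinv i) \<otimes> \<phi> (gE i)" "(- 1) \<odot> (\<phi> (gWinv j) \<otimes> \<phi> (gE j))" cs "- 1"]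
        O.qcomms_sm[of "\<phi> (gWinv i) \<otimes> \<phi> (gE i)" "\<phi> (gWinv j) \<otimes> \<phi> (gE j)" cs "- 1"] by simp
  qed
  \<comment> \<open>For the f's the relations live in the opposite algebra already, so
    \<open>serre_opposite\<close> is applied there and leads back to \<open>A\<close>; the pairing
    scalars appear inverted.\<close>
  have 2: "qcomms A cs (\<sigma> (gF i)) (\<sigma> (gF j)) = \<zero>"
    if "qcomms (opposite A) cs (\<phi> (gF i)) (\<phi> (gF j)) = \<zero>" "serre_list (pairing r s i i) (pairing r s j i) (pairing r s i j) cs" for cs i j
  proof -
    have "qcomms (opposite (opposite A)) cs (\<phi> (gW'inv i) \<otimes>\<^bsub>opposite A\<^esub> \<phi> (gF i)) (\<phi> (gW'inv j) \<otimes>\<^bsub>opposite A\<^esub> \<phi> (gF j)) = \<zero>\<^bsub>opposite A\<^esub>"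
      by (rule serre_opposite[where t = "inverse (pairing r s i i)" and u = "inverse (pairing r s i j)"
          and v = "inverse (pairing r s j i)", OF O.k_algebra_axioms _ _ _ _ _ _ _ _ _ _ _ that(2)])
        (auto simp: pnz W'invF that intro: toral_comm)
    then show ?thesis
      using qcomms_sm_l[of "\<phi> (gF i) \<otimes> \<phi> (gW'inv i)" "(- 1) \<odot> (\<phi> (gF j) \<otimes> \<phi> (gW'inv j))" cs "- 1"]
        qcomms_sm[of "\<phi> (gF i) \<otimes> \<phi> (gW'inv i)" "\<phi> (gF j) \<otimes> \<phi> (gW'inv j)" cs "- 1"] by simp
  qed
  show ?thesis
  proof unfold_locales
    fix i j
    let ?k = "if i = j then inverse (param r i - param s i) else 0"
    have "\<sigma> (gF j) \<otimes> \<sigma> (gE i) = \<phi> (gWinv i) \<otimes> (\<phi> (gF j) \<otimes> \<phi> (gE i)) \<otimes> \<phi> (gW'inv j)"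
      using antipode_EF by simp
    moreover have "\<sigma> (gE i) \<otimes> \<sigma> (gF j) = \<phi> (gWinv i) \<otimes> (\<phi> (gE i) \<otimes> \<phi> (gF j)) \<otimes> \<phi> (gW'inv j)"
      by (simp add: m_assoc)
    \<comment> \<open>Multiplying \<omega> - \<omega>' by the inverse of \<omega> on the left and
      that of \<omega>' on the right gives the difference of the inverses with the opposite sign.
      The reversed multiplication absorbs this sign.\<close>
    moreover have "\<phi> (gWinv i) \<otimes> (\<phi> (gE i) \<otimes> \<phi> (gF j)) \<otimes> \<phi> (gW'inv j) =
      \<phi> (gWinv i) \<otimes> (\<phi> (gF j) \<otimes> \<phi> (gE i)) \<otimes> \<phi> (gW'inv j) \<oplus> ?k \<odot> (\<phi> (gW'inv j) \<oplus> (- 1) \<odot> \<phi> (gWinv i))"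
    proof (cases "i = j")
      case True
      have "\<phi> (gWinv i) \<otimes> (\<phi> (gW i) \<oplus> (- 1) \<odot> \<phi> (gW' i)) \<otimes> \<phi> (gW'inv i) = \<phi> (gW'inv i) \<oplus> (- 1) \<odot> \<phi> (gWinv i)"
        by (simp add: r_distr l_distr inv_W m_assoc W'_inv)
      then show ?thesis using True by (simp add: EF r_distr l_distr del: sm_sm)
    qed (simp add: EF)
    ultimately show "\<sigma> (gE i) \<otimes>\<^bsub>opposite A\<^esub> \<sigma> (gF j) =
      \<sigma> (gF j) \<otimes>\<^bsub>opposite A\<^esub> \<sigma> (gE i) \<oplus>\<^bsub>opposite A\<^esub>
      ?k \<odot>\<^bsub>opposite A\<^esub> (\<sigma> (gW i) \<oplus>\<^bsub>opposite A\<^esub> (- 1) \<odot>\<^bsub>opposite A\<^esub> \<sigma> (gW' i))"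
    proof -
      let ?X = "\<phi> (gWinv i) \<otimes> (\<phi> (gF j) \<otimes> \<phi> (gE i)) \<otimes> \<phi> (gW'inv j)"
      assume e: "\<sigma> (gF j) \<otimes> \<sigma> (gE i) = ?X"
        "\<sigma> (gE i) \<otimes> \<sigma> (gF j) = \<phi> (gWinv i) \<otimes> (\<phi> (gE i) \<otimes> \<phi> (gF j)) \<otimes> \<phi> (gW'inv j)"
        "\<phi> (gWinv i) \<otimes> (\<phi> (gE i) \<otimes> \<phi> (gF j)) \<otimes> \<phi> (gW'inv j) = ?X \<oplus> ?k \<odot> (\<phi> (gW'inv j) \<oplus> (- 1) \<odot> \<phi> (gWinv i))"
      have "?k \<odot> (\<phi> (gW'inv j) \<oplus> (- 1) \<odot> \<phi> (gWinv i)) \<oplus> ?k \<odot> (\<phi> (gWinv i) \<oplus> (- 1) \<odot> \<phi> (gW'inv i)) = \<zero>"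
      proof (cases "i = j")
        case True
        have "x \<oplus> (- 1) \<odot> y \<oplus> (y \<oplus> (- 1) \<odot> x) = \<zero>" if "x \<in> carrier A" "y \<in> carrier A" for x y
          using that by (simp add: uminus_sm[symmetric] a_ac r_neg r_neg1 r_neg2)
        then show ?thesis using True by (simp add: sm_add_r[symmetric] del: sm_sm)
      qed simp
      then have "?X = ?X \<oplus> ?k \<odot> (\<phi> (gW'inv j) \<oplus> (- 1) \<odot> \<phi> (gWinv i)) \<oplus> ?k \<odot> (\<phi> (gWinv i) \<oplus> (- 1) \<odot> \<phi> (gW'inv i))"
        by (simp add: a_assoc del: sm_sm)
      then show ?thesis unfolding opposite_simps e by simp
    qed
  next
    fix i j
    show "\<sigma> (gW j) \<otimes>\<^bsub>opposite A\<^esub> \<sigma> (gE i) = pairing r s i j \<odot>\<^bsub>opposite A\<^esub> (\<sigma> (gE i) \<otimes>\<^bsub>opposite A\<^esub> \<sigma> (gW j))"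
    proof -
      have "\<phi> (gWinv i) \<otimes> \<phi> (gE i) \<otimes> \<phi> (gWinv j) = pairing r s i j \<odot> (\<phi> (gWinv i) \<otimes> \<phi> (gWinv j) \<otimes> \<phi> (gE i))"
        by (simp add: m_assoc EWinv)
      also have "\<phi> (gWinv i) \<otimes> \<phi> (gWinv j) = \<phi> (gWinv j) \<otimes> \<phi> (gWinv i)" by (rule toral_comm) auto
      finally show ?thesis by (simp add: m_assoc)
    qed
    show "\<sigma> (gW j) \<otimes>\<^bsub>opposite A\<^esub> \<sigma> (gF i) = inverse (pairing r s i j) \<odot>\<^bsub>opposite A\<^esub> (\<sigma> (gF i) \<otimes>\<^bsub>opposite A\<^esub> \<sigma> (gW j))"
    proof -
      have "\<phi> (gF i) \<otimes> \<phi> (gW'inv i) \<otimes> \<phi> (gWinv j) = \<phi> (gF i) \<otimes> (\<phi> (gW'inv i) \<otimes> \<phi> (gWinv j))"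
        by (simp add: m_assoc)
      also have "\<phi> (gW'inv i) \<otimes> \<phi> (gWinv j) = \<phi> (gWinv j) \<otimes> \<phi> (gW'inv i)" by (rule toral_comm) auto
      finally show ?thesis by (simp add: m_assoc[symmetric] FWinv mult.commute)
    qed
    show "\<sigma> (gW' j) \<otimes>\<^bsub>opposite A\<^esub> \<sigma> (gE i) = inverse (pairing r s j i) \<odot>\<^bsub>opposite A\<^esub> (\<sigma> (gE i) \<otimes>\<^bsub>opposite A\<^esub> \<sigma> (gW' j))"
    proof -
      have "\<phi> (gWinv i) \<otimes> \<phi> (gE i) \<otimes> \<phi> (gW'inv j) = inverse (pairing r s j i) \<odot> (\<phi> (gWinv i) \<otimes> \<phi> (gW'inv j) \<otimes> \<phi> (gE i))"
        by (simp add: m_assoc EW'inv)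
      also have "\<phi> (gWinv i) \<otimes> \<phi> (gW'inv j) = \<phi> (gW'inv j) \<otimes> \<phi> (gWinv i)" by (rule toral_comm) auto
      finally show ?thesis by (simp add: m_assoc)
    qed
    show "\<sigma> (gW' j) \<otimes>\<^bsub>opposite A\<^esub> \<sigma> (gF i) = pairing r s j i \<odot>\<^bsub>opposite A\<^esub> (\<sigma> (gF i) \<otimes>\<^bsub>opposite A\<^esub> \<sigma> (gW' j))"
    proof -
      have "\<phi> (gF i) \<otimes> \<phi> (gW'inv i) \<otimes> \<phi> (gW'inv j) = \<phi> (gF i) \<otimes> (\<phi> (gW'inv i) \<otimes> \<phi> (gW'inv j))"
        by (simp add: m_assoc)
      also have "\<phi> (gW'inv i) \<otimes> \<phi> (gW'inv j) = \<phi> (gW'inv j) \<otimes> \<phi> (gW'inv i)" by (rule toral_comm) auto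
      also have "\<phi> (gF i) \<otimes> (\<phi> (gW'inv j) \<otimes> \<phi> (gW'inv i)) = (\<phi> (gF i) \<otimes> \<phi> (gW'inv j)) \<otimes> \<phi> (gW'inv i)"
        by (simp add: m_assoc)
      also have "\<dots> = pairing r s j i \<odot> (\<phi> (gW'inv j) \<otimes> (\<phi> (gF i) \<otimes> \<phi> (gW'inv i)))"
        by (subst FW'inv) (simp add: m_assoc)
      finally show ?thesis by (simp add: mult.commute)
    qed
  next
    fix g h assume "g \<in> toral" "h \<in> toral"
    then show "\<sigma> g \<otimes>\<^bsub>opposite A\<^esub> \<sigma> h = \<sigma> h \<otimes>\<^bsub>opposite A\<^esub> \<sigma> g"
      using antipode_gen_toral[of g] antipode_gen_toral[of h] toral_comm by auto
  next
    show "qcomms (opposite A) (serre_list1 r s) (\<sigma> (gE I1)) (\<sigma> (gE I2)) = \<zero>\<^bsub>opposite A\<^esub>"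
      using 1[OF serre_E1 serre_list1[OF r0 s0]] by simp
    show "qcomms (opposite A) (serre_list2 r s) (\<sigma> (gE I2)) (\<sigma> (gE I1)) = \<zero>\<^bsub>opposite A\<^esub>"
      using 1[OF serre_E2 serre_list2[OF r0 s0]] by simp
    show "qcomms (opposite (opposite A)) (serre_list1 r s) (\<sigma> (gF I1)) (\<sigma> (gF I2)) = \<zero>\<^bsub>opposite A\<^esub>"
      using 2[OF serre_F1 serre_list1[OF r0 s0]] by simp
    show "qcomms (opposite (opposite A)) (serre_list2 r s) (\<sigma> (gF I2)) (\<sigma> (gF I1)) = \<zero>\<^bsub>opposite A\<^esub>"
      using 2[OF serre_F2 serre_list2[OF r0 s0]] by simp
  qed (auto simp: r0 s0 antipode_gen_in W_inv W'_inv)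
qed

interpretation AA: tensor_alg A A by standard
interpretation T: k_algebra AA.T by (rule AA.T_alg)

lemma comult_gen_in: "\<delta> g \<in> carrier AA.T"
  by (cases g) auto

lemma comult_gen_toral: "g \<in> toral \<Longrightarrow> \<delta> g = AA.pt (\<phi> g) (\<phi> g)"
  by (erule toral_cases) auto

lemma comult_EF: "\<delta> (gE i) \<otimes>\<^bsub>AA.T\<^esub> \<delta> (gF j) =
    \<delta> (gF j) \<otimes>\<^bsub>AA.T\<^esub> \<delta> (gE i) \<oplus>\<^bsub>AA.T\<^esub>
      (if i = j then inverse (param r i - param s i) else 0) \<odot>\<^bsub>AA.T\<^esub>
      (\<delta> (gW i) \<oplus>\<^bsub>AA.T\<^esub> (- 1) \<odot>\<^bsub>AA.T\<^esub> \<delta> (gW' i))"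
proof -
  let ?k = "if i = j then inverse (param r i - param s i) else 0"
  let ?E = "\<phi> (gE i)" and ?F = "\<phi> (gF j)" and ?W = "\<phi> (gW i)" and ?W' = "\<phi> (gW' j)"
  define K where "K = ?k \<odot> (?W \<oplus> (- 1) \<odot> \<phi> (gW' i))"
  have K: "K \<in> carrier A" by (simp add: K_def)
  \<comment> \<open>Reordering either leg costs the same pairing scalar, so the mixed terms of the
    two products agree.\<close>
  have "AA.pt (?F \<otimes> ?W) (?W' \<otimes> ?E) = AA.pt (?W \<otimes> ?F) (?E \<otimes> ?W')"
    unfolding WF W'E by (simp add: AA.pt_sm_l AA.pt_sm_r)
  then have 1: "\<delta> (gF j) \<otimes>\<^bsub>AA.T\<^esub> \<delta> (gE i) =
    (AA.pt ?E ?F \<oplus>\<^bsub>AA.T\<^esub> AA.pt ?W (?F \<otimes> ?E)) \<oplus>\<^bsub>AA.T\<^esub> (AA.pt (?F \<otimes> ?E) ?W' \<oplus>\<^bsub>AA.T\<^esub> AA.pt (?W \<otimes> ?F) (?E \<otimes> ?W'))"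
    by (simp add: T.l_distr T.r_distr AA.pt_mult T.a_ac)
  have "\<delta> (gE i) \<otimes>\<^bsub>AA.T\<^esub> \<delta> (gF j) =
    (AA.pt ?E ?F \<oplus>\<^bsub>AA.T\<^esub> AA.pt ?W (?E \<otimes> ?F)) \<oplus>\<^bsub>AA.T\<^esub> (AA.pt (?E \<otimes> ?F) ?W' \<oplus>\<^bsub>AA.T\<^esub> AA.pt (?W \<otimes> ?F) (?E \<otimes> ?W'))"
    by (simp add: T.l_distr T.r_distr AA.pt_mult T.a_ac)
  also have "?E \<otimes> ?F = ?F \<otimes> ?E \<oplus> K" by (simp add: EF K_def)
  also have "(AA.pt ?E ?F \<oplus>\<^bsub>AA.T\<^esub> AA.pt ?W (?F \<otimes> ?E \<oplus> K)) \<oplus>\<^bsub>AA.T\<^esub> (AA.pt (?F \<otimes> ?E \<oplus> K) ?W' \<oplus>\<^bsub>AA.T\<^esub> AA.pt (?W \<otimes> ?F) (?E \<otimes> ?W'))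
    = ((AA.pt ?E ?F \<oplus>\<^bsub>AA.T\<^esub> AA.pt ?W (?F \<otimes> ?E)) \<oplus>\<^bsub>AA.T\<^esub> (AA.pt (?F \<otimes> ?E) ?W' \<oplus>\<^bsub>AA.T\<^esub> AA.pt (?W \<otimes> ?F) (?E \<otimes> ?W')))
     \<oplus>\<^bsub>AA.T\<^esub> (AA.pt ?W K \<oplus>\<^bsub>AA.T\<^esub> AA.pt K ?W')"
    using K by (simp add: AA.pt_add_l AA.pt_add_r T.a_ac)
  also have "AA.pt ?W K \<oplus>\<^bsub>AA.T\<^esub> AA.pt K ?W' = ?k \<odot>\<^bsub>AA.T\<^esub> (AA.pt ?W ?W \<oplus>\<^bsub>AA.T\<^esub> (- 1) \<odot>\<^bsub>AA.T\<^esub> AA.pt (\<phi> (gW' i)) (\<phi> (gW' i)))"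
  proof (cases "i = j")
    case True
    \<comment> \<open>The telescoping \<omega> \<otimes> (\<omega> - \<omega>') + (\<omega> -
      \<omega>') \<otimes> \<omega>' = \<omega> \<otimes> \<omega> - \<omega>' \<otimes>
      \<omega>'.\<close>
    have "(x \<oplus>\<^bsub>AA.T\<^esub> (- 1) \<odot>\<^bsub>AA.T\<^esub> y) \<oplus>\<^bsub>AA.T\<^esub> (y \<oplus>\<^bsub>AA.T\<^esub> (- 1) \<odot>\<^bsub>AA.T\<^esub> z) = x \<oplus>\<^bsub>AA.T\<^esub> (- 1) \<odot>\<^bsub>AA.T\<^esub> z"
      if "x \<in> carrier AA.T" "y \<in> carrier AA.T" "z \<in> carrier AA.T" for x y z
      using that by (simp add: T.uminus_sm[symmetric] T.a_assoc T.r_neg1)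
    then show ?thesis using True
      by (simp add: K_def AA.pt_sm_l AA.pt_sm_r AA.pt_add_l AA.pt_add_r T.sm_add_r[symmetric] del: sm_sm T.sm_sm)
  qed (simp add: K_def)
  finally show ?thesis unfolding 1 by simp
qed

lemma G2_rep_tensor: "G2_rep AA.T (\<delta>) r s"
proof -
  have 1: "qcomms AA.T cs (\<delta> (gE i)) (\<delta> (gE j)) = \<zero>\<^bsub>AA.T\<^esub>"
    if "qcomms A cs (\<phi> (gE i)) (\<phi> (gE j)) = \<zero>" "serre_list (pairing r s i i) (pairing r s j i) (pairing r s i j) cs" for cs i j
    unfolding comult_gen.simps
    by (rule serre_tensor[OF k_algebra_axioms _ _ _ _ _ _ _ _ _ _ _ that(2,1)])
      (auto simp: AA.pt_mult WE AA.pt_sm_l intro: toral_comm)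
  have 2: "qcomms (opposite AA.T) cs (\<delta> (gF i)) (\<delta> (gF j)) = \<zero>\<^bsub>AA.T\<^esub>"
    if z: "qcomms (opposite A) cs (\<phi> (gF i)) (\<phi> (gF j)) = \<zero>" and l: "serre_list (pairing r s i i) (pairing r s j i) (pairing r s i j) cs" for cs i j
  proof -
    note o = tensor_opposite[OF k_algebra_axioms k_algebra_axioms]
    \<comment> \<open>With its summands exchanged, the coproduct of f has the shape required by
      \<open>serre_tensor\<close>, with h = \<omega>' and g = 1, to be used over the opposite
      algebra.\<close>
    have F: "\<delta> (gF i) = AA.pt (\<phi> (gF i)) (\<phi> (gW' i)) \<oplus>\<^bsub>AA.T\<^esub> AA.pt \<one> (\<phi> (gF i))" for i
      by (simp add: T.a_comm)
    have "qcomms (tensor (opposite A) (opposite A)) cs (pure_tensor (opposite A) (opposite A) (\<phi> (gF i)) (\<phi> (gW' i)) \<oplus>\<^bsub>tensor (opposite A) (opposite A)\<^esub> pure_tensor (opposite A) (opposite A) \<one> (\<phi> (gF i)))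
      (pure_tensor (opposite A) (opposite A) (\<phi> (gF j)) (\<phi> (gW' j)) \<oplus>\<^bsub>tensor (opposite A) (opposite A)\<^esub> pure_tensor (opposite A) (opposite A) \<one> (\<phi> (gF j))) = \<zero>\<^bsub>tensor (opposite A) (opposite A)\<^esub>"
      by (rule serre_tensor[OF k_algebra_opposite[OF k_algebra_axioms] _ _ _ _ _ _ _ _ _ _ _ l])
        (auto simp: o z AA.pt_mult W'F AA.pt_sm_r intro: toral_comm)
    then show ?thesis unfolding F by (simp add: o)
  qed
  show ?thesis
  proof unfold_locales
    fix g h assume "g \<in> toral" "h \<in> toral"
    then show "\<delta> g \<otimes>\<^bsub>AA.T\<^esub> \<delta> h = \<delta> h \<otimes>\<^bsub>AA.T\<^esub> \<delta> g"
      by (simp add: comult_gen_toral AA.pt_mult toral_comm)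
  next
    show "qcomms AA.T (serre_list1 r s) (\<delta> (gE I1)) (\<delta> (gE I2)) = \<zero>\<^bsub>AA.T\<^esub>"
      by (rule 1[OF serre_E1 serre_list1[OF r0 s0]])
    show "qcomms AA.T (serre_list2 r s) (\<delta> (gE I2)) (\<delta> (gE I1)) = \<zero>\<^bsub>AA.T\<^esub>"
      by (rule 1[OF serre_E2 serre_list2[OF r0 s0]])
    show "qcomms (opposite AA.T) (serre_list1 r s) (\<delta> (gF I1)) (\<delta> (gF I2)) = \<zero>\<^bsub>AA.T\<^esub>"
      by (rule 2[OF serre_F1 serre_list1[OF r0 s0]])
    show "qcomms (opposite AA.T) (serre_list2 r s) (\<delta> (gF I2)) (\<delta> (gF I1)) = \<zero>\<^bsub>AA.T\<^esub>"
      by (rule 2[OF serre_F2 serre_list2[OF r0 s0]])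
  next
    fix i j
    have c: "\<phi> (gW j) \<otimes> \<phi> (gW i) = \<phi> (gW i) \<otimes> \<phi> (gW j)" "\<phi> (gW' j) \<otimes> \<phi> (gW i) = \<phi> (gW i) \<otimes> \<phi> (gW' j)"
      "\<phi> (gW j) \<otimes> \<phi> (gW' i) = \<phi> (gW' i) \<otimes> \<phi> (gW j)" "\<phi> (gW' j) \<otimes> \<phi> (gW' i) = \<phi> (gW' i) \<otimes> \<phi> (gW' j)"
      by (auto intro: toral_comm)
    show "\<delta> (gW j) \<otimes>\<^bsub>AA.T\<^esub> \<delta> (gE i) = pairing r s i j \<odot>\<^bsub>AA.T\<^esub> (\<delta> (gE i) \<otimes>\<^bsub>AA.T\<^esub> \<delta> (gW j))"
      by (simp add: T.l_distr T.r_distr AA.pt_mult WE c AA.pt_sm_l AA.pt_sm_r T.sm_add_r)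
    show "\<delta> (gW j) \<otimes>\<^bsub>AA.T\<^esub> \<delta> (gF i) = inverse (pairing r s i j) \<odot>\<^bsub>AA.T\<^esub> (\<delta> (gF i) \<otimes>\<^bsub>AA.T\<^esub> \<delta> (gW j))"
      by (simp add: T.l_distr T.r_distr AA.pt_mult WF c AA.pt_sm_l AA.pt_sm_r T.sm_add_r)
    show "\<delta> (gW' j) \<otimes>\<^bsub>AA.T\<^esub> \<delta> (gE i) = inverse (pairing r s j i) \<odot>\<^bsub>AA.T\<^esub> (\<delta> (gE i) \<otimes>\<^bsub>AA.T\<^esub> \<delta> (gW' j))"
      by (simp add: T.l_distr T.r_distr AA.pt_mult W'E c AA.pt_sm_l AA.pt_sm_r T.sm_add_r)
    show "\<delta> (gW' j) \<otimes>\<^bsub>AA.T\<^esub> \<delta> (gF i) = pairing r s j i \<odot>\<^bsub>AA.T\<^esub> (\<delta> (gF i) \<otimes>\<^bsub>AA.T\<^esub> \<delta> (gW' j))"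
      by (simp add: T.l_distr T.r_distr AA.pt_mult W'F c AA.pt_sm_l AA.pt_sm_r T.sm_add_r)
  next
    fix i j
    show "\<delta> (gE i) \<otimes>\<^bsub>AA.T\<^esub> \<delta> (gF j) =
      \<delta> (gF j) \<otimes>\<^bsub>AA.T\<^esub> \<delta> (gE i) \<oplus>\<^bsub>AA.T\<^esub>
      (if i = j then inverse (param r i - param s i) else 0) \<odot>\<^bsub>AA.T\<^esub>
      (\<delta> (gW i) \<oplus>\<^bsub>AA.T\<^esub> (- 1) \<odot>\<^bsub>AA.T\<^esub> \<delta> (gW' i))"
      by (rule comult_EF)
  qed (simp_all only: r0 s0 comult_gen_in comult_gen.simps AA.pt_mult W_inv W'_inv AA.pt_one \<phi>_in not_False_eq_True simp_thms)
qed

end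

subsection \<open>The restricted quantum group\<close>

lemma alg_hom_cong: "same_alg A A' \<Longrightarrow> same_alg B B' \<Longrightarrow> alg_hom A B f \<longleftrightarrow> alg_hom A' B' f"
  by (simp add: same_alg_iff alg_hom_def k_linear_def ring_hom_def)

lemma same_alg_refl [simp]: "same_alg A A"
  by (simp add: same_alg_def)

lemma U_hopf_simps:
  "same_alg (U_alg r s) (U_hopf r s)"
  "comult (U_hopf r s) X = free_lift (tensor (U_alg r s) (U_alg r s)) (U_comult_gen r s) (SOME p. p \<in> X)"
  "counit (U_hopf r s) X = free_lift base U_counit_gen (SOME p. p \<in> X)"
  "antipode (U_hopf r s) X = free_lift (opposite (U_alg r s)) (U_antipode_gen r s) (SOME p. p \<in> X)"
  by (simp_all add: U_hopf_def Let_def module.defs hopf.defs same_alg_iff)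

lemma quot_hopf_simps:
  "same_alg (quot_alg H I) (quot_hopf H I)"
  "comult (quot_hopf H I) X = tensor_map (quot_alg H I) (quot_alg H I) (\<lambda>x. I +>\<^bsub>H\<^esub> x) (\<lambda>x. I +>\<^bsub>H\<^esub> x) (comult H (SOME x. x \<in> X))"
  "counit (quot_hopf H I) X = counit H (SOME x. x \<in> X)"
  "antipode (quot_hopf H I) X = I +>\<^bsub>H\<^esub> antipode H (SOME x. x \<in> X)"
  by (simp_all add: quot_hopf_def Let_def module.defs hopf.defs same_alg_iff)

lemma U_comult_gen_eq: "U_comult_gen r s = comult_gen (U_alg r s) (\<lambda>g. U_proj r s (G g))"
proof
  fix g show "U_comult_gen r s g = comult_gen (U_alg r s) (\<lambda>g. U_proj r s (G g)) g"
    by (cases g) (simp_all add: Let_def)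
qed

lemma U_antipode_gen_eq: "U_antipode_gen r s = antipode_gen (U_alg r s) (\<lambda>g. U_proj r s (G g))"
proof
  have "- p = (- 1) \<cdot> p" for p :: "'a free" by (simp add: scal_uminus_l)
  then have "U_proj r s (- (p * q)) = (- 1) \<odot>\<^bsub>U_alg r s\<^esub> (U_proj r s p \<otimes>\<^bsub>U_alg r s\<^esub> U_proj r s q)" for p q
    using alg_homD(4,5)[OF U_proj_alg_hom[of r s]] by simp
  then show "U_antipode_gen r s g = antipode_gen (U_alg r s) (\<lambda>g. U_proj r s (G g)) g" for g
    by (cases g) simp_all
qed

locale restricted_G2 =
  fixes r s :: "'k::field" and l :: nat
  assumes r0: "r \<noteq> 0" and s0: "s \<noteq> 0"
    and hI: "hopf_ideal (U_hopf r s) (restricted_ideal r s l)"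
begin

abbreviation "U \<equiv> U_alg r s"
abbreviation "UH \<equiv> U_hopf r s"
abbreviation "I \<equiv> restricted_ideal r s l"
abbreviation "u \<equiv> u_hopf r s l"
abbreviation "\<gamma> g \<equiv> U_proj r s (G g)"
abbreviation "ug \<equiv> u_gen r s l"

lemma same: "same_alg U UH"
  by (rule U_hopf_simps(1))

interpretation R: G2_rep U \<gamma> r s
  by (rule G2_rep_U[OF r0 s0])

lemma k_algebra_UH: "k_algebra UH"
  by (rule k_algebra_cong[OF same k_algebra_U])

sublocale QU: quot_algebra UH I
  using hI k_algebra_UH by (simp add: quot_algebra_def hopf_ideal_def)

lemma coset_eq: "I +>\<^bsub>U\<^esub> x = I +>\<^bsub>UH\<^esub> x"
  using same by (simp add: a_r_coset_def' same_alg_iff)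

abbreviation "Q \<equiv> quot_alg UH I"
abbreviation "\<pi> x \<equiv> I +>\<^bsub>UH\<^esub> x"

lemmas Q_alg = QU.k_algebra_Q
lemmas \<pi>_hom = QU.alg_hom_\<pi>

sublocale QA: k_algebra Q by (rule Q_alg)
sublocale QQ: tensor_alg Q Q by standard
sublocale UU: tensor_alg UH UH by standard

lemma same_u: "same_alg Q u"
  unfolding u_hopf_def by (rule quot_hopf_simps(1))

lemma ug_eq: "ug g = \<pi> (\<gamma> g)"
  by (simp add: u_gen_def coset_eq)

lemma \<gamma>_in: "\<gamma> g \<in> carrier UH"
  by (metis R.\<phi>_in same same_alg_iff)

lemma ug_in: "ug g \<in> carrier Q"
  by (simp add: ug_eq \<gamma>_in)

section \<open>The structure maps of U and their descent to the restricted quotient\<close>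

lemma comult_U_hom: "alg_hom UH (tensor UH UH) (comult UH)"
proof -
  have e: "tensor UH UH = tensor U U" using tensor_cong[OF same same] by simp
  have "alg_hom U (tensor U U) (comult UH)"
    unfolding U_hopf_simps(2-4)[abs_def] U_comult_gen_eq by (rule U_alg_hom_factor(1)[OF R.G2_rep_tensor])
  then show ?thesis unfolding e using alg_hom_cong[OF same same_alg_refl] by blast
qed

lemma comult_U_gen: "comult UH (\<gamma> g) = comult_gen U \<gamma> g"
  unfolding U_hopf_simps(2-4) U_comult_gen_eq by (rule U_alg_hom_factor(2)[OF R.G2_rep_tensor])

lemma counit_U_hom: "alg_hom UH base (counit UH)"
proof -
  have "alg_hom U base (counit UH)"
    unfolding U_hopf_simps(2-4)[abs_def] by (rule U_alg_hom_factor(1)[OF G2_rep_base[OF r0 s0]])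
  then show ?thesis using alg_hom_cong[OF same same_alg_refl] by blast
qed

lemma counit_U_gen: "counit UH (\<gamma> g) = U_counit_gen g"
  unfolding U_hopf_simps(2-4) by (rule U_alg_hom_factor(2)[OF G2_rep_base[OF r0 s0]])

lemma antipode_U_hom: "alg_hom UH (opposite U) (antipode UH)"
proof -
  have "alg_hom U (opposite U) (antipode UH)"
    unfolding U_hopf_simps(2-4)[abs_def] U_antipode_gen_eq by (rule U_alg_hom_factor(1)[OF R.G2_rep_opposite])
  then show ?thesis using alg_hom_cong[OF same same_alg_refl] by blast
qed

lemma antipode_U_gen: "antipode UH (\<gamma> g) = antipode_gen U \<gamma> g"
  unfolding U_hopf_simps(2-4) U_antipode_gen_eq by (rule U_alg_hom_factor(2)[OF R.G2_rep_opposite])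

abbreviation "\<pi>\<pi> \<equiv> tensor_map Q Q (\<lambda>x. \<pi> x) (\<lambda>x. \<pi> x)"

lemma \<pi>\<pi>_hom: "alg_hom (tensor UH UH) (tensor Q Q) \<pi>\<pi>"
  by (rule tensor_map_alg_hom[OF k_algebra_UH k_algebra_UH Q_alg Q_alg \<pi>_hom \<pi>_hom])

lemmas \<pi>\<pi>_pt = tensor_map_linear(2)[OF k_algebra_UH k_algebra_UH Q_alg Q_alg alg_homD(1)[OF \<pi>_hom] alg_homD(1)[OF \<pi>_hom]]

text \<open>Every pure tensor in a representative has a leg in \<open>I\<close>, which becomes zero
  in the quotient.\<close>

lemma \<pi>\<pi>_sub_tensor:
  assumes t: "t \<in> sub_tensor UH UH X Y" and X: "X \<subseteq> carrier UH" and Y: "Y \<subseteq> carrier UH" and XY: "X \<subseteq> I \<or> Y \<subseteq> I"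
  shows "t \<in> carrier (tensor UH UH)" "\<pi>\<pi> t = \<zero>\<^bsub>tensor Q Q\<^esub>"
proof -
  obtain p where p: "t = tensor_class UH UH p" "keys p \<subseteq> X \<times> Y"
    using t unfolding sub_tensor_def by blast
  have k: "keys p \<subseteq> carrier UH \<times> carrier UH" using p(2) X Y by blast
  show "t \<in> carrier (tensor UH UH)" using k by (simp add: p UU.tc_simps)
  have b: "bilin UH UH (tensor Q Q) (\<lambda>(x, y). pure_tensor Q Q (\<pi> x) (\<pi> y))"
    by (rule bilin_map[OF Q_alg Q_alg alg_homD(1)[OF \<pi>_hom] alg_homD(1)[OF \<pi>_hom]])
  interpret TQ: k_algebra "tensor Q Q" by (rule QQ.T_alg)
  have z: "\<pi> x = \<zero>\<^bsub>Q\<^esub>" if "x \<in> I" for x using that QU.\<pi>_zero_iff QU.Icarr by blast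
  have "\<pi>\<pi> t = lin_ext (tensor Q Q) (\<lambda>(x, y). pure_tensor Q Q (\<pi> x) (\<pi> y)) p"
    unfolding p(1) tensor_map_def by (rule UU.tensor_lift_tc[OF QQ.T_alg b k])
  also have "\<dots> \<in> {\<zero>\<^bsub>tensor Q Q\<^esub>}"
  proof (rule TQ.lin_ext_mem)
    show "submodule {\<zero>\<^bsub>tensor Q Q\<^esub>} base (tensor Q Q)" by (simp add: TQ.subm_iff)
    fix v assume "v \<in> keys p"
    then have v: "v \<in> X \<times> Y" "v \<in> carrier UH \<times> carrier UH" using p(2) k by blast+
    then show "(case v of (x, y) \<Rightarrow> pure_tensor Q Q (\<pi> x) (\<pi> y)) \<in> {\<zero>\<^bsub>tensor Q Q\<^esub>}"
      using XY z by (cases v) (auto simp: subset_iff)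
  qed
  finally show "\<pi>\<pi> t = \<zero>\<^bsub>tensor Q Q\<^esub>" by simp
qed

text \<open>The coproduct condition on a Hopf ideal splits \<Delta> x into a part with left leg in
  \<open>I\<close> and a part with right leg in \<open>I\<close>; both die.\<close>

lemma comult_I: "x \<in> I \<Longrightarrow> \<pi>\<pi> (comult UH x) = \<zero>\<^bsub>tensor Q Q\<^esub>"
proof -
  assume x: "x \<in> I"
  have Ic: "I \<subseteq> carrier UH" using QU.Icarr by blast
  have "comult UH x \<in> sub_tensor UH UH I (carrier UH) <+>\<^bsub>tensor UH UH\<^esub> sub_tensor UH UH (carrier UH) I"
    using hI x by (auto simp: hopf_ideal_def)
  then obtain t t' where t: "comult UH x = t \<oplus>\<^bsub>tensor UH UH\<^esub> t'"
    "t \<in> sub_tensor UH UH I (carrier UH)" "t' \<in> sub_tensor UH UH (carrier UH) I"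
    by (auto simp: set_add_def')
  interpret TQ: k_algebra "tensor Q Q" by (rule QQ.T_alg)
  show ?thesis
    using \<pi>\<pi>_sub_tensor[OF t(2) Ic] \<pi>\<pi>_sub_tensor[OF t(3) _ Ic]
    by (simp add: t(1) alg_homD[OF \<pi>\<pi>_hom])
qed

lemmas comult_hom = alg_hom_comp[OF comult_U_hom \<pi>\<pi>_hom]

lemma comult_u_hom: "alg_hom u (tensor u u) (comult u)"
proof -
  have "alg_hom Q (tensor Q Q) (comult u)"
    unfolding u_hopf_def quot_hopf_simps(2-4)[abs_def] by (rule QU.alg_hom_factor[OF QQ.T_alg comult_hom comult_I])
  then show ?thesis using alg_hom_cong[OF same_u same_alg_refl] tensor_cong[OF same_u same_u] by metis
qed

lemma comult_ug: "comult u (ug g) = comult_gen Q ug g"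
proof -
  have "comult u (ug g) = \<pi>\<pi> (comult UH (\<gamma> g))"
    unfolding u_hopf_def quot_hopf_simps(2-4) ug_eq
    by (rule QU.k_linear_factor(2)[OF QQ.T_alg alg_homD(1)[OF comult_hom] comult_I \<gamma>_in])
  also have "\<dots> = comult_gen Q ug g"
  proof -
    have e: "pure_tensor U U = pure_tensor UH UH" "tensor U U = tensor UH UH" "\<one>\<^bsub>U\<^esub> = \<one>\<^bsub>UH\<^esub>"
      using pure_tensor_cong[OF same same] tensor_cong[OF same same] same by (auto simp: same_alg_iff)
    have o: "\<pi> \<one>\<^bsub>UH\<^esub> = \<one>\<^bsub>Q\<^esub>" by (rule alg_homD(6)[OF \<pi>_hom])
    show ?thesis unfolding comult_U_gen
      by (cases g) (simp_all add: e \<gamma>_in \<pi>\<pi>_pt alg_homD[OF \<pi>\<pi>_hom] ug_eq o)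
  qed
  finally show ?thesis .
qed

lemma counit_u_hom: "alg_hom u base (counit u)"
proof -
  have "alg_hom Q base (counit u)"
    unfolding u_hopf_def quot_hopf_simps(2-4)[abs_def]
    by (rule QU.alg_hom_factor[OF k_algebra_base counit_U_hom]) (use hI in \<open>auto simp: hopf_ideal_def\<close>)
  then show ?thesis using alg_hom_cong[OF same_u same_alg_refl] by blast
qed

lemma counit_ug: "counit u (ug g) = U_counit_gen g"
proof -
  have "counit u (ug g) = counit UH (\<gamma> g)"
    unfolding u_hopf_def quot_hopf_simps(2-4) ug_eq
    by (rule QU.k_linear_factor(2)[OF k_algebra_base alg_homD(1)[OF counit_U_hom] _ \<gamma>_in]) (use hI in \<open>auto simp: hopf_ideal_def\<close>)
  then show ?thesis by (simp add: counit_U_gen)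
qed

lemma antipode_\<pi>_hom: "alg_hom UH (opposite Q) (\<lambda>x. \<pi> (antipode UH x))"
proof -
  have "alg_hom U Q (\<lambda>x. \<pi> x)" using \<pi>_hom alg_hom_cong[OF same same_alg_refl] by blast
  then show ?thesis by (rule alg_hom_comp[OF antipode_U_hom alg_hom_opposite])
qed

lemma antipode_I: "x \<in> I \<Longrightarrow> \<pi> (antipode UH x) = \<zero>\<^bsub>opposite Q\<^esub>"
proof -
  assume "x \<in> I"
  then have "antipode UH x \<in> I" using hI by (auto simp: hopf_ideal_def)
  then show ?thesis using QU.\<pi>_zero_iff QU.Icarr by auto
qed

lemma antipode_u_hom: "alg_hom Q (opposite Q) (antipode u)"
  unfolding u_hopf_def quot_hopf_simps(2-4)[abs_def]
  by (rule QU.alg_hom_factor[OF k_algebra_opposite[OF Q_alg] antipode_\<pi>_hom antipode_I])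

lemma antipode_ug: "antipode u (ug g) = antipode_gen Q ug g"
proof -
  have "antipode u (ug g) = \<pi> (antipode UH (\<gamma> g))"
    unfolding u_hopf_def quot_hopf_simps(2-4) ug_eq
    by (rule QU.k_linear_factor(2)[OF k_algebra_opposite[OF Q_alg] alg_homD(1)[OF antipode_\<pi>_hom] antipode_I \<gamma>_in])
  also have "\<dots> = antipode_gen Q ug g"
    using same unfolding antipode_U_gen
    by (cases g) (simp_all add: same_alg_iff \<gamma>_in alg_homD[OF \<pi>_hom] ug_eq)
  finally show ?thesis .
qed

lemma ug_hom: "alg_hom free_alg Q (\<lambda>p. \<pi> (U_proj r s p))"
proof -
  have "alg_hom free_alg UH (U_proj r s)" using U_proj_alg_hom alg_hom_cong[OF same_alg_refl same] by blast
  then show ?thesis by (rule alg_hom_comp[OF _ \<pi>_hom])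
qed

lemma carrier_Q: "x \<in> carrier Q \<Longrightarrow> \<exists>p. x = \<pi> (U_proj r s p)"
proof -
  assume "x \<in> carrier Q"
  then obtain y where y: "x = \<pi> y" "y \<in> carrier U" using QU.carrier_Q same by (auto simp: same_alg_iff)
  interpret F: quot_algebra free_alg "U_ideal r s" by (rule quot_algebra_U)
  from y(2) obtain p where "y = U_proj r s p" using F.carrier_Q by (auto simp: U_alg_def U_proj_def)
  then show ?thesis using y by blast
qed

lemma Q_generated: "carrier Q \<subseteq> subalg_generated Q (range ug)"
proof
  fix x assume "x \<in> carrier Q"
  then obtain p where p: "x = \<pi> (U_proj r s p)" using carrier_Q by blast
  interpret F: k_algebra "free_alg :: ('k, 'k free) module" by (rule k_algebra_free_alg)
  let ?W = "{p \<in> carrier free_alg. \<pi> (U_proj r s p) \<in> subalg_generated Q (range ug)}"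
  have "subalg free_alg ?W"
    by (rule F.subalg_preimage[OF ug_hom Q_alg QA.subalg_subalg_generated]) (use ug_in in auto)
  moreover have "G g \<in> ?W" for g using QA.subalg_generated_incl[of "range ug"] by (auto simp: ug_eq[symmetric])
  ultimately have "p \<in> ?W" by (rule subalg_free_alg)
  then show "x \<in> subalg_generated Q (range ug)" using p by simp
qed

lemma ug_inv: "ug (gW i) \<otimes>\<^bsub>Q\<^esub> ug (gWinv i) = \<one>\<^bsub>Q\<^esub>" "ug (gWinv i) \<otimes>\<^bsub>Q\<^esub> ug (gW i) = \<one>\<^bsub>Q\<^esub>"
  "ug (gW' i) \<otimes>\<^bsub>Q\<^esub> ug (gW'inv i) = \<one>\<^bsub>Q\<^esub>" "ug (gW'inv i) \<otimes>\<^bsub>Q\<^esub> ug (gW' i) = \<one>\<^bsub>Q\<^esub>"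
  using R.W_inv[of i] R.inv_W[of i] R.W'_inv[of i] same alg_homD(6)[OF \<pi>_hom]
  by (simp_all add: ug_eq alg_homD(5)[OF \<pi>_hom, symmetric] \<gamma>_in same_alg_iff)

lemma u_simps: "carrier u = carrier Q" "mult u = mult Q" "\<one>\<^bsub>u\<^esub> = \<one>\<^bsub>Q\<^esub>"
  "\<zero>\<^bsub>u\<^esub> = \<zero>\<^bsub>Q\<^esub>" "add u = add Q" "smult u = smult Q"
  using same_u by (auto simp: same_alg_iff)

lemma u_tensor: "tensor u u = tensor Q Q" "pure_tensor u u = pure_tensor Q Q"
  using tensor_cong[OF same_u same_u] pure_tensor_cong[OF same_u same_u] by auto

lemma antipode_u_one: "antipode u \<one>\<^bsub>Q\<^esub> = \<one>\<^bsub>Q\<^esub>"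
  using alg_homD(6)[OF antipode_u_hom] by simp

lemma skew_E: "comult u (ug (gE i)) = pure_tensor u u (ug (gE i)) \<one>\<^bsub>u\<^esub> \<oplus>\<^bsub>tensor u u\<^esub> pure_tensor u u (ug (gW i)) (ug (gE i)) \<and>
    antipode u (ug (gE i)) = (- 1) \<odot>\<^bsub>u\<^esub> (antipode u (ug (gW i)) \<otimes>\<^bsub>u\<^esub> ug (gE i) \<otimes>\<^bsub>u\<^esub> antipode u \<one>\<^bsub>u\<^esub>)"
  using ug_in by (simp add: comult_ug antipode_ug u_tensor u_simps antipode_u_one)

lemma skew_F: "comult u (ug (gF i)) = pure_tensor u u (ug (gF i)) (ug (gW' i)) \<oplus>\<^bsub>tensor u u\<^esub> pure_tensor u u \<one>\<^bsub>u\<^esub> (ug (gF i)) \<and>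
    antipode u (ug (gF i)) = (- 1) \<odot>\<^bsub>u\<^esub> (antipode u \<one>\<^bsub>u\<^esub> \<otimes>\<^bsub>u\<^esub> ug (gF i) \<otimes>\<^bsub>u\<^esub> antipode u (ug (gW' i)))"
proof -
  interpret TQ: k_algebra "tensor Q Q" by (rule QQ.T_alg)
  show ?thesis using ug_in by (simp add: comult_ug antipode_ug u_tensor u_simps antipode_u_one TQ.a_comm)
qed

text \<open>The unit joins the toral generators because it is one of the two grouplike partners of
  each e and f.\<close>

sublocale u: skew_generated u "insert \<one>\<^bsub>u\<^esub> (ug ` toral)" "ug ` (range gE \<union> range gF)"
proof -
  interpret ua: k_algebra u by (rule k_algebra_cong[OF same_u Q_alg])
  have sub: "subalg u W \<longleftrightarrow> subalg Q W" for W by (simp add: ua.subalg_iff QA.subalg_iff u_simps)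
  have all: "g \<in> toral \<union> range gE \<union> range gF" for g
    by (cases g) auto
  note S = alg_homD[OF antipode_u_hom]
  show "skew_generated u (insert \<one>\<^bsub>u\<^esub> (ug ` toral)) (ug ` (range gE \<union> range gF))"
  proof unfold_locales
    show "alg_hom u (tensor u u) (comult u)" by (rule comult_u_hom)
    show "alg_hom u base (counit u)" by (rule counit_u_hom)
    show "k_linear u u (antipode u)" by (rule k_linearI) (use S in \<open>auto simp: u_simps\<close>)
    show "antipode u (x \<otimes>\<^bsub>u\<^esub> y) = antipode u y \<otimes>\<^bsub>u\<^esub> antipode u x" if "x \<in> carrier u" "y \<in> carrier u" for x y
      using that S by (simp add: u_simps)
    show "antipode u \<one>\<^bsub>u\<^esub> = \<one>\<^bsub>u\<^esub>" by (simp add: u_simps antipode_u_one)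
    show "insert \<one>\<^bsub>u\<^esub> (ug ` toral) \<subseteq> carrier u" "ug ` (range gE \<union> range gF) \<subseteq> carrier u"
      using ug_in by (auto simp: u_simps)
    show "\<one>\<^bsub>u\<^esub> \<in> insert \<one>\<^bsub>u\<^esub> (ug ` toral)" by simp
    fix g assume g: "g \<in> insert \<one>\<^bsub>u\<^esub> (ug ` toral)"
    show "comult u g = pure_tensor u u g g"
    proof (cases "g = \<one>\<^bsub>u\<^esub>")
      case True
      then show ?thesis using alg_homD(6)[OF comult_u_hom] QQ.pt_one by (simp add: u_tensor u_simps)
    next
      case False
      then obtain h where "g = ug h" "h \<in> toral" using g by auto
      then show ?thesis by (auto elim!: toral_cases simp: comult_ug u_tensor)
    qed
    show "counit u g = 1"
      using g alg_homD(6)[OF counit_u_hom] by (auto elim!: toral_cases simp: counit_ug)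
    show "antipode u g \<otimes>\<^bsub>u\<^esub> g = \<one>\<^bsub>u\<^esub>" "g \<otimes>\<^bsub>u\<^esub> antipode u g = \<one>\<^bsub>u\<^esub>"
      using g by (auto elim!: toral_cases simp: antipode_ug u_simps antipode_u_one ug_inv)
  next
    fix x assume "x \<in> ug ` (range gE \<union> range gF)"
    then obtain i where i: "x = ug (gE i) \<or> x = ug (gF i)" by auto
    then show "counit u x = 0" by (auto simp: counit_ug)
    show "\<exists>g\<in>insert \<one>\<^bsub>u\<^esub> (ug ` toral). \<exists>h\<in>insert \<one>\<^bsub>u\<^esub> (ug ` toral).
      comult u x = pure_tensor u u x h \<oplus>\<^bsub>tensor u u\<^esub> pure_tensor u u g x \<and>
      antipode u x = (- 1) \<odot>\<^bsub>u\<^esub> (antipode u g \<otimes>\<^bsub>u\<^esub> x \<otimes>\<^bsub>u\<^esub> antipode u h)"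
      using i
    proof
      assume x: "x = ug (gE i)"
      show ?thesis by (rule bexI[of _ "ug (gW i)"], rule bexI[of _ "\<one>\<^bsub>u\<^esub>"]) (use skew_E[of i] x in auto)
    next
      assume x: "x = ug (gF i)"
      show ?thesis by (rule bexI[of _ "\<one>\<^bsub>u\<^esub>"], rule bexI[of _ "ug (gW' i)"]) (use skew_F[of i] x in auto)
    qed
  next
    show "carrier u \<subseteq> subalg_generated u (insert \<one>\<^bsub>u\<^esub> (ug ` toral) \<union> ug ` (range gE \<union> range gF))"
    proof -
      have "carrier Q \<subseteq> W" if "subalg Q W" "insert \<one>\<^bsub>u\<^esub> (ug ` toral) \<union> ug ` (range gE \<union> range gF) \<subseteq> W" for W
      proof -
        have "ug g \<in> W" for g by (rule subsetD[OF that(2)]) (use all[of g] in auto)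
        then have "range ug \<subseteq> W" by auto
        then show ?thesis by (rule order_trans[OF Q_generated QA.subalg_generated_least[OF that(1)]])
      qed
      then show ?thesis unfolding subalg_generated_def sub u_simps(1) by (intro Inter_greatest) simp
    qed
  qed
qed

text \<open>Subalgebras contain the unit anyway; this reconciles the generating sets in
  \<open>u_b\<close> and \<open>u_b'\<close> with grouplike sets that contain it.\<close>

lemma subalg_generated_insert_one: "subalg_generated u (insert \<one>\<^bsub>u\<^esub> X \<union> Y) = subalg_generated u (Y \<union> X)"
proof -
  have "\<one>\<^bsub>u\<^esub> \<in> B" if "subalg u B" for B using that by (simp add: subalg_def)
  then have "subalg u B \<and> insert \<one>\<^bsub>u\<^esub> X \<union> Y \<subseteq> B \<longleftrightarrow> subalg u B \<and> Y \<union> X \<subseteq> B" for B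
    by (metis Un_commute insert_subset Un_insert_left)
  then have "{B. subalg u B \<and> insert \<one>\<^bsub>u\<^esub> X \<union> Y \<subseteq> B} = {B. subalg u B \<and> Y \<union> X \<subseteq> B}" by simp
  then show ?thesis unfolding subalg_generated_def by (rule arg_cong)
qed

text \<open>Common to both halves: the antipode exchanges each toral generator in \<open>K\<close>
  with its inverse in \<open>K\<close>, and the grouplike partners of \<open>L\<close> are the unit
  and elements from \<open>K\<close>.\<close>

lemma generated_facts:
  assumes K: "K \<subseteq> toral" "\<And>g. g \<in> K \<Longrightarrow> antipode_gen Q ug g \<in> ug ` K"
    and L: "L \<subseteq> range gE \<union> range gF"
    and sk: "\<And>x. x \<in> L \<Longrightarrow> \<exists>g\<in>insert \<one>\<^bsub>u\<^esub> (ug ` K). \<exists>h\<in>insert \<one>\<^bsub>u\<^esub> (ug ` K).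
      comult u (ug x) = pure_tensor u u (ug x) h \<oplus>\<^bsub>tensor u u\<^esub> pure_tensor u u g (ug x) \<and>
      antipode u (ug x) = (- 1) \<odot>\<^bsub>u\<^esub> (antipode u g \<otimes>\<^bsub>u\<^esub> ug x \<otimes>\<^bsub>u\<^esub> antipode u h)"
    and B: "B = subalg_generated u (ug ` (L \<union> K))"
  shows "hopf_subalgebra u B \<and> hopf_algebra (hopf_restrict u B) \<and> pointed (hopf_restrict u B)"
proof -
  let ?G = "insert \<one>\<^bsub>u\<^esub> (ug ` K)" and ?S = "ug ` L"
  have e: "B = subalg_generated u (?G \<union> ?S)"
    unfolding subalg_generated_insert_one B image_Un ..
  have 1: "?G \<subseteq> insert \<one>\<^bsub>u\<^esub> (ug ` toral)" "\<one>\<^bsub>u\<^esub> \<in> ?G" using K(1) by auto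
  have 2: "antipode u g \<in> ?G" if "g \<in> ?G" for g using that K(2) by (auto simp: antipode_ug u_simps antipode_u_one)
  have 3: "?S \<subseteq> ug ` (range gE \<union> range gF)" using L by (rule image_mono)
  have 4: "\<exists>g\<in>?G. \<exists>h\<in>?G. comult u x = pure_tensor u u x h \<oplus>\<^bsub>tensor u u\<^esub> pure_tensor u u g x \<and>
      antipode u x = (- 1) \<odot>\<^bsub>u\<^esub> (antipode u g \<otimes>\<^bsub>u\<^esub> x \<otimes>\<^bsub>u\<^esub> antipode u h)" if "x \<in> ?S" for x
    using that sk by auto
  interpret C: skew_generated "hopf_restrict u B" ?G ?S
    unfolding e by (rule u.skew_generated_restrict[OF 1 2 3 4])
  have "hopf_subalgebra u B" unfolding e by (rule u.hopf_subalgebra_B[OF 1 2 3 4])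
  then show ?thesis using C.hopf_algebra C.pointed by blast
qed

lemma b_facts: "hopf_subalgebra u (u_b r s l) \<and> hopf_algebra (hopf_restrict u (u_b r s l)) \<and> pointed (hopf_restrict u (u_b r s l))"
proof (rule generated_facts[of "range gW \<union> range gWinv" "range gE"])
  fix x assume "x \<in> range gE"
  then obtain i where "x = gE i" by auto
  then show "\<exists>g\<in>insert \<one>\<^bsub>u\<^esub> (ug ` (range gW \<union> range gWinv)). \<exists>h\<in>insert \<one>\<^bsub>u\<^esub> (ug ` (range gW \<union> range gWinv)).
      comult u (ug x) = pure_tensor u u (ug x) h \<oplus>\<^bsub>tensor u u\<^esub> pure_tensor u u g (ug x) \<and>
      antipode u (ug x) = (- 1) \<odot>\<^bsub>u\<^esub> (antipode u g \<otimes>\<^bsub>u\<^esub> ug x \<otimes>\<^bsub>u\<^esub> antipode u h)"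
    by (intro bexI[of _ "ug (gW i)"] bexI[of _ "\<one>\<^bsub>u\<^esub>"]) (use skew_E[of i] in auto)
qed (auto simp: u_b_def Un_assoc)

lemma b'_facts: "hopf_subalgebra u (u_b' r s l) \<and> hopf_algebra (hopf_restrict u (u_b' r s l)) \<and> pointed (hopf_restrict u (u_b' r s l))"
proof (rule generated_facts[of "range gW' \<union> range gW'inv" "range gF"])
  fix x assume "x \<in> range gF"
  then obtain i where "x = gF i" by auto
  then show "\<exists>g\<in>insert \<one>\<^bsub>u\<^esub> (ug ` (range gW' \<union> range gW'inv)). \<exists>h\<in>insert \<one>\<^bsub>u\<^esub> (ug ` (range gW' \<union> range gW'inv)).
      comult u (ug x) = pure_tensor u u (ug x) h \<oplus>\<^bsub>tensor u u\<^esub> pure_tensor u u g (ug x) \<and>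
      antipode u (ug x) = (- 1) \<odot>\<^bsub>u\<^esub> (antipode u g \<otimes>\<^bsub>u\<^esub> ug x \<otimes>\<^bsub>u\<^esub> antipode u h)"
    by (intro bexI[of _ "\<one>\<^bsub>u\<^esub>"] bexI[of _ "ug (gW' i)"]) (use skew_F[of i] in auto)
qed (auto simp: u_b'_def Un_assoc)

end

theorem proposition4p1:
  fixes r s :: "'k::field_char_0" and d d' l :: nat
  assumes "primitive_root_of_unity d r"
    and "primitive_root_of_unity d' s"
    and "l = lcm d d'"
    and "\<exists>\<theta>::'k. primitive_root_of_unity l \<theta>"
    and "coprime l 3"
    and "r ^ 3 \<noteq> s ^ 3"
    and "r ^ 4 \<noteq> s ^ 4"
    and "hopf_ideal (U_hopf r s) (restricted_ideal r s l)"
  shows "hopf_algebra (u_hopf r s l) \<and> pointed (u_hopf r s l)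
    \<and> hopf_subalgebra (u_hopf r s l) (u_b r s l)
    \<and> hopf_algebra (hopf_restrict (u_hopf r s l) (u_b r s l))
    \<and> pointed (hopf_restrict (u_hopf r s l) (u_b r s l))
    \<and> hopf_subalgebra (u_hopf r s l) (u_b' r s l)
    \<and> hopf_algebra (hopf_restrict (u_hopf r s l) (u_b' r s l))
    \<and> pointed (hopf_restrict (u_hopf r s l) (u_b' r s l))"
proof -
  have "r \<noteq> 0" "s \<noteq> 0" using assms(1,2) by (auto simp: primitive_root_of_unity_def zero_power)
  then interpret restricted_G2 r s l using assms(8) by (simp add: restricted_G2_def)
  show ?thesis using u.hopf_algebra u.pointed b_facts b'_facts by blast
qed

end
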